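(* Let $\mu$ be a finite positive Borel measure on $(-1,1)$ that is regular. Assume that for some $\rho>0$, $\mu$ is absolutely continuous in $J=[1-\rho,1]$, and that in $J$ its absolutely continuous component has the form $w(x)=h(x)(1-x)^{\alpha}(1+x)^{\beta}$, where $\alpha,\beta>-1$. Assume that $h(1)>0$ and that $h$ is continuous at $1$. Then, uniformly for $a,b$ in compact subsets of $(0,\infty)$, $$\lim_{n\to\infty}\frac{1}{2n^{2}}\,\widetilde{K}_{n}\left(1-\frac{a}{2n^{2}},\,1-\frac{b}{2n^{2}}\right)=\mathbb{J}_{\alpha}(a,b).$$ If $\alpha\ge 0$, the same limit holds uniformly for $a,b$ in compact subsets of $[0,\infty)$.
   Context: For a finite positive Borel measure $\mu$ on $(-1,1)$, let $p_n(x)=\gamma_n x^n+\dots$, $\gamma_n>0$, $n=0,1,2,\dots$, be the orthonormal polynomials: $\int_{-1}^{1}p_np_m\,d\mu=\delta_{mn}$. The measure $\mu$ is called regular if $\lim_{n\to\infty}\gamma_n^{1/n}=2$. The interval $J=[1-\rho,1]$ is understood to be contained in $[-1,1]$. Let $w=\frac{d\mu}{dx}$ denote the density of the absolutely continuous part of $\mu$; in $J$ its pointwise values are those given by $w(x)=h(x)(1-x)^\alpha(1+x)^\beta$. The reproducing kernel and its normalized version are $$K_n(x,y)=\sum_{k=0}^{n-1}p_k(x)p_k(y),\qquad \widetilde K_n(x,y)=w(x)^{1/2}w(y)^{1/2}K_n(x,y).$$ The Bessel kernel of order $\alpha$ is $$\mathbb{J}_\alpha(u,v)=\frac{J_\alpha(\sqrt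 u)\,\sqrt v\,J_\alpha'(\sqrt v)-J_\alpha(\sqrt v)\,\sqrt u\,J_\alpha'(\sqrt u)}{2(u-v)},$$ where $J_\alpha$ is the usual Bessel function of the first kind of order $\alpha$; on the diagonal $u=v$ (and, when $\alpha\ge0$, when $u=0$ or $v=0$) it is defined by continuous extension. *)

theory Defs
  imports "HOL-Analysis.Analysis" "HOL-Computational_Algebra.Polynomial"
begin

text \<open>Real powers of a nonnegative base with the convention \<open>0\<^sup>0 = 1\<close>.  HOL's \<open>powr\<close> has
  \<open>0 powr 0 = 0\<close>, which would give the wrong value at the endpoint \<open>x = 1\<close> of the weight
  \<open>h(x) (1 - x)\<^sup>\<alpha> (1 + x)\<^sup>\<beta>\<close>, and of the Bessel function at \<open>0\<close>, when the exponent is \<open>0\<close>.\<close>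

definition rpow :: "real \<Rightarrow> real \<Rightarrow> real" where
  "rpow x a = (if a = 0 then 1 else x powr a)"

text \<open>A measure on \<open>(-1,1)\<close> is represented as a Borel measure on the real line that gives no
  mass to the complement of \<open>(-1,1)\<close>.\<close>

definition finite_borel_measure_on :: "real set \<Rightarrow> real measure \<Rightarrow> bool" where
  "finite_borel_measure_on S M \<longleftrightarrow>
     sets M = sets borel \<and> finite_measure M \<and> emeasure M (- S) = 0"

definition orthonormal_polynomials :: "real measure \<Rightarrow> (nat \<Rightarrow> real poly) \<Rightarrow> bool" where
  "orthonormal_polynomials M p \<longleftrightarrow>
     (\<forall>n. degree (p n) = n \<and> lead_coeff (p n) > 0) \<and>
     (\<forall>n m. (LINT x|M. poly (p n) x * poly (p m) x) = (if n = m then 1 else 0))"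

text \<open>The orthonormal polynomials of a measure are unique when they exist, so the existential
  quantifier merely names them.\<close>

definition regular_measure :: "real measure \<Rightarrow> bool" where
  "regular_measure M \<longleftrightarrow>
     (\<exists>p. orthonormal_polynomials M p \<and> (\<lambda>n. root n (lead_coeff (p n))) \<longlonglongrightarrow> 2)"

definition absolutely_continuous_in :: "real set \<Rightarrow> real measure \<Rightarrow> bool" where
  "absolutely_continuous_in J M \<longleftrightarrow>
     absolutely_continuous (restrict_space lborel J) (restrict_space M J)"

text \<open>The function \<open>w\<close> is (a version of) the density of the absolutely continuous part in the
  Lebesgue decomposition of \<open>M\<close>: the singular part is the restriction of \<open>M\<close> to a Lebesgue null
  set \<open>N\<close>, and the absolutely continuous part is the restriction to the complement of \<open>N\<close>.\<close>

definition ac_density :: "real measure \<Rightarrow> (real \<Rightarrow> real) \<Rightarrow> bool" where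
  "ac_density M w \<longleftrightarrow>
     w \<in> borel_measurable lebesgue \<and> (AE x in lebesgue. 0 \<le> w x) \<and>
     (\<exists>N \<in> null_sets lborel. \<forall>A \<in> sets borel.
        emeasure M (A - N) = (\<integral>\<^sup>+x\<in>A. ennreal (w x) \<partial>lebesgue))"

definition reproducing_kernel :: "(nat \<Rightarrow> real poly) \<Rightarrow> nat \<Rightarrow> real \<Rightarrow> real \<Rightarrow> real" where
  "reproducing_kernel p n x y = (\<Sum>k<n. poly (p k) x * poly (p k) y)"

definition normalized_kernel ::
    "(real \<Rightarrow> real) \<Rightarrow> (nat \<Rightarrow> real poly) \<Rightarrow> nat \<Rightarrow> real \<Rightarrow> real \<Rightarrow> real" where
  "normalized_kernel w p n x y = sqrt (w x) * sqrt (w y) * reproducing_kernel p n x y"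

text \<open>The Bessel function of the first kind on \<open>[0,\<infinity>)\<close>, given by its usual power series
  \<open>\<Sum>k. (-1)\<^sup>k / (k! \<Gamma>(k + \<alpha> + 1)) (z/2)\<close> to the power \<open>2k + \<alpha>\<close>, with the factor
  \<open>(z/2)\<^sup>\<alpha>\<close> taken out of the sum.\<close>

definition bessel_J :: "real \<Rightarrow> real \<Rightarrow> real" where
  "bessel_J \<alpha> z =
     rpow (z / 2) \<alpha> * (\<Sum>k. (-1) ^ k / (fact k * Gamma (real k + \<alpha> + 1)) * (z / 2) ^ (2 * k))"

definition bessel_kernel_quotient :: "real \<Rightarrow> real \<Rightarrow> real \<Rightarrow> real" where
  "bessel_kernel_quotient \<alpha> u v =
     (bessel_J \<alpha> (sqrt u) * sqrt v * deriv (bessel_J \<alpha>) (sqrt v) -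
      bessel_J \<alpha> (sqrt v) * sqrt u * deriv (bessel_J \<alpha>) (sqrt u)) / (2 * (u - v))"

text \<open>On the diagonal, and on the coordinate axes, the kernel is the continuous extension of the
  quotient from the off-diagonal part of the open quadrant.\<close>

definition bessel_kernel :: "real \<Rightarrow> real \<Rightarrow> real \<Rightarrow> real" where
  "bessel_kernel \<alpha> u v =
     (if 0 < u \<and> 0 < v \<and> u \<noteq> v then bessel_kernel_quotient \<alpha> u v
      else Lim (at (u, v) within {(s, t). 0 < s \<and> 0 < t \<and> s \<noteq> t})
             (\<lambda>(s, t). bessel_kernel_quotient \<alpha> s t))"

end

theory Submission
  imports Defs "HOL-Complex_Analysis.Conformal_Mappings"
begin

text \<open>The kernel of \<open>M\<close> is compared with that of the explicit measure with density
  \<open>c (1 - x)\<^sup>\<alpha>\<close>, where \<open>c = h(1) 2\<^sup>\<beta>\<close>.  The latter kernel comes from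
  inverting the Cauchy matrix \<open>1 / (\<alpha> + 1 + i + j)\<close> of moments; scaled at the endpoint, it
  tends to a double power series, which a Christoffel-Darboux identity turns into the Bessel kernel.

  For the comparison, a kernel of degree below \<open>n\<close> is multiplied by the power
  \<open>\<lfloor>\<kappa> n\<rfloor>\<close> of \<open>(1 + x) / 2\<close>, which is close to \<open>1\<close> at distance \<open>O(1 / n\<^sup>2)\<close> from
  the endpoint and exponentially small away from it.  Regularity enters only through the fact that
  the orthonormal polynomials grow subexponentially on \<open>[-1, 1]\<close>, so that the cutoff beats them.
  The extremal property of the kernels then bounds the diagonal of the kernel of \<open>M\<close> from above,
  and the \<open>L\<^sup>2(M)\<close> distance between that kernel and the cut off reference kernel, relative to
  the size of the kernel, is bounded by a quantity that vanishes as \<open>\<kappa> \<rightarrow> 0\<close>.\<close>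

section \<open>Orthonormal polynomials and their reproducing kernels\<close>

text \<open>The Cauchy matrix arises because the moments of \<open>(1 - x) / 2\<close> under the
  density \<open>c (1 - x) ^ \<alpha>\<close> are a constant over \<open>\<alpha> + 1 + i\<close>;
  freezing the factor \<open>(1 + x) ^ \<beta>\<close> at its endpoint value keeps this Gram matrix
  explicitly invertible. The obstacle in the comparison is that nothing relates the two measures
  away from the endpoint, while the kernel of each is integrated against the other. Hence the growth
  of \<open>p n\<close> has to be bounded at every point of [-1, 1], not just almost everywhere for
  \<open>M\<close>. The cutoff costs degree: the reference kernels have degrees near
  \<open>(1 + \<kappa>) n\<close> and \<open>(1 - \<kappa>) n\<close>, so their asymptotics are
  proved along arbitrary degree sequences, and continuity of the limit closes the gap as \<kappa>
  tends to 0. Off-diagonal values come from diagonal ones: the squared distance from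
  \<open>K(x, .)\<close> to a test polynomial \<open>P\<close> is \<open>K(x, x) - 2 P(x)\<close>
  plus the squared norm of \<open>P\<close>, which involves the unknown kernel only on the diagonal.
  All limits are taken along convergent sequences of points; compactness turns them into uniform
  ones.\<close>

locale interval_measure =
  fixes M :: "real measure"
  assumes measure_on: "finite_borel_measure_on {-1<..<1} M"
begin

lemma sets_M [measurable_cong]: "sets M = sets borel"
  using measure_on by (simp add: finite_borel_measure_on_def)

lemma space_M [simp]: "space M = UNIV"
  using sets_eq_imp_space_eq[OF sets_M] by simp

sublocale finite_measure M
  using measure_on by (simp add: finite_borel_measure_on_def)

lemma AE_in: "AE x in M. x \<in> {-1<..<1}"
proof (rule AE_I)
  show "{x \<in> space M. x \<notin> {-1<..<1}} \<subseteq> - {-1<..<1}" by auto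
  show "emeasure M (- {-1<..<1}) = 0"
    using measure_on by (simp add: finite_borel_measure_on_def)
  show "- {-1<..<1::real} \<in> sets M" by (simp add: sets_M)
qed

lemma integrable_bounded:
  fixes f :: "real \<Rightarrow> 'b :: {second_countable_topology, banach}"
  assumes f: "f \<in> borel_measurable borel" and B: "\<And>x. x \<in> {-1<..<1} \<Longrightarrow> norm (f x) \<le> B"
  shows "integrable M f"
proof (rule integrable_const_bound)
  show "AE x in M. norm (f x) \<le> B" using AE_in by eventually_elim (use B in auto)
  show "f \<in> borel_measurable M" using f by (simp cong: measurable_cong_sets add: sets_M)
qed

lemma integrable_continuous:
  fixes f :: "real \<Rightarrow> 'b :: {second_countable_topology, banach}"
  assumes "continuous_on UNIV f"
  shows "integrable M f"
proof -
  have "compact (f ` {-1..1})"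
    by (intro compact_continuous_image continuous_on_subset[OF assms]) auto
  then obtain B where "\<And>x. x \<in> {-1..1} \<Longrightarrow> norm (f x) \<le> B"
    using compact_imp_bounded[of "f ` {-1..1}"] unfolding bounded_iff by (metis imageI)
  moreover have "f \<in> borel_measurable borel"
    using assms by (rule borel_measurable_continuous_onI)
  ultimately show ?thesis by (intro integrable_bounded[of f B]) auto
qed

lemma integrable_poly_mult: "integrable M (\<lambda>x. poly P x * poly Q x)"
  by (intro integrable_continuous continuous_intros)

lemma integrable_indicator_poly:
  assumes "A \<in> sets borel"
  shows "integrable M (\<lambda>x. indicator A x * (poly P x)\<^sup>2)"
proof -
  have "integrable M (\<lambda>x. indicator A x *\<^sub>R (poly P x)\<^sup>2)"
    using assms by (intro integrable_mult_indicator integrable_continuous continuous_intros) (simp add: sets_M)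
  then show ?thesis by simp
qed

end

section \<open>Reproducing and extremal properties of an orthonormal system\<close>

locale orthonormal_system = interval_measure +
  fixes p :: "nat \<Rightarrow> real poly"
  assumes degree_p [simp]: "degree (p n) = n"
    and orthonormal: "(LINT x|M. poly (p n) x * poly (p m) x) = (if n = m then 1 else 0)"
begin

lemma p_nz: "p n \<noteq> 0"
proof
  assume "p n = 0"
  then show False using orthonormal[of n n] by simp
qed

lemma expansion:
  assumes "degree P < n"
  obtains c where "P = (\<Sum>k<n. smult (c k) (p k))"
proof -
  have "\<exists>c. P = (\<Sum>k<n. smult (c k) (p k))"
    using assms
  proof (induction n arbitrary: P)
    case 0
    then show ?case by simp
  next
    case (Suc n)
    define a where "a = coeff P n / lead_coeff (p n)"
    define Q where "Q = P - smult a (p n)"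
    have lc: "coeff (p n) n \<noteq> 0" using leading_coeff_neq_0[OF p_nz[of n]] by simp
    have "\<exists>c. Q = (\<Sum>k<n. smult (c k) (p k))"
    proof (cases "Q = 0")
      case True
      then show ?thesis by (intro exI[of _ "\<lambda>_. 0"]) simp
    next
      case False
      have "coeff Q n = 0" using lc by (simp add: Q_def a_def)
      moreover have "degree Q \<le> n" unfolding Q_def
        using Suc.prems by (intro degree_diff_le) (auto intro: degree_smult_le[THEN order_trans])
      ultimately have "degree Q < n" using False
        by (metis eq_zero_or_degree_less)
      then show ?thesis by (rule Suc.IH)
    qed
    then obtain c where c: "Q = (\<Sum>k<n. smult (c k) (p k))" by blast
    have "P = (\<Sum>k<Suc n. smult ((c(n := a)) k) (p k))"
    proof -
      have "(\<Sum>k<n. smult ((c(n := a)) k) (p k)) = (\<Sum>k<n. smult (c k) (p k))"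
        by (intro sum.cong) auto
      then show ?thesis using c by (simp add: Q_def algebra_simps)
    qed
    then show ?case by blast
  qed
  then show ?thesis using that by blast
qed

lemma integral_expansion:
  "(LINT x|M. poly (\<Sum>k<n. smult (c k) (p k)) x * poly (\<Sum>k<n. smult (d k) (p k)) x) = (\<Sum>k<n. c k * d k)"
proof -
  have "(LINT x|M. poly (\<Sum>k<n. smult (c k) (p k)) x * poly (\<Sum>k<n. smult (d k) (p k)) x)
      = (LINT x|M. (\<Sum>k<n. \<Sum>l<n. c k * d l * (poly (p k) x * poly (p l) x)))"
    by (simp add: poly_sum sum_product mult_ac)
  also have "\<dots> = (\<Sum>k<n. \<Sum>l<n. c k * d l * (LINT x|M. poly (p k) x * poly (p l) x))"
    by (simp add: integral_sum integrable_poly_mult)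
  also have "\<dots> = (\<Sum>k<n. \<Sum>l<n. if l = k then c k * d l else 0)"
    by (intro sum.cong) (auto simp: orthonormal)
  also have "\<dots> = (\<Sum>k<n. c k * d k)" by (simp add: sum.delta)
  finally show ?thesis .
qed

lemma orthogonal_lower_degree:
  assumes "degree P < n"
  shows "(LINT x|M. poly (p n) x * poly P x) = 0"
proof -
  obtain c where c: "P = (\<Sum>k<n. smult (c k) (p k))" using expansion[OF assms] .
  have "(LINT x|M. poly (p n) x * poly P x) = (LINT x|M. (\<Sum>k<n. c k * (poly (p n) x * poly (p k) x)))"
    unfolding c by (simp add: poly_sum sum_distrib_left mult_ac)
  also have "\<dots> = (\<Sum>k<n. c k * (LINT x|M. poly (p n) x * poly (p k) x))"
    by (simp add: integrable_poly_mult)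
  also have "\<dots> = 0" by (intro sum.neutral) (auto simp: orthonormal)
  finally show ?thesis .
qed

abbreviation K :: "nat \<Rightarrow> real \<Rightarrow> real \<Rightarrow> real" where "K \<equiv> reproducing_kernel p"

definition kernel_poly :: "nat \<Rightarrow> real \<Rightarrow> real poly" where
  "kernel_poly n x = (\<Sum>k<n. smult (poly (p k) x) (p k))"

lemma poly_kernel_poly [simp]: "poly (kernel_poly n x) y = K n x y"
  by (simp add: kernel_poly_def reproducing_kernel_def poly_sum)

lemma degree_kernel_poly: "0 < n \<Longrightarrow> degree (kernel_poly n x) < n"
  unfolding kernel_poly_def by (rule degree_sum_less) (auto intro: le_less_trans[OF degree_smult_le])

lemma K_sym: "K n x y = K n y x"
  by (simp add: reproducing_kernel_def mult.commute)

lemma K_nonneg: "0 \<le> K n x x"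
  by (auto simp: reproducing_kernel_def intro: sum_nonneg)

lemma K_pos: "0 < n \<Longrightarrow> 0 < K n x x"
proof -
  assume "0 < n"
  have "poly (p 0) x \<noteq> 0"
    using p_nz[of 0] degree_p[of 0]
    by (metis add_0_right degree_eq_zeroE mult_zero_right pCons_0_0 poly_0 poly_pCons)
  then have "0 < poly (p 0) x * poly (p 0) x" by (simp add: zero_less_mult_iff) linarith
  moreover have "poly (p 0) x * poly (p 0) x \<le> K n x x"
    unfolding reproducing_kernel_def using \<open>0 < n\<close> by (intro member_le_sum) auto
  ultimately show ?thesis by linarith
qed

lemma reproducing:
  assumes "degree P < n"
  shows "(LINT t|M. poly P t * K n x t) = poly P x"
proof -
  obtain c where c: "P = (\<Sum>k<n. smult (c k) (p k))" using expansion[OF assms] .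
  show ?thesis
    using integral_expansion[where n=n and c=c and d="\<lambda>k. poly (p k) x"]
    unfolding c by (simp add: kernel_poly_def[symmetric] poly_sum)
qed

lemma integral_K_square: "(LINT t|M. K n x t * K n x t) = K n x x"
proof (cases "n = 0")
  case True
  then show ?thesis by (simp add: reproducing_kernel_def)
next
  case False
  then show ?thesis using reproducing[OF degree_kernel_poly, of n x x] by simp
qed

text \<open>Cauchy-Schwarz for the coefficients of \<open>P\<close> in the orthonormal basis. This
  half of the extremal property of \<open>K n x x\<close> turns a bound for an integral into a bound
  at a point, and so lets kernels of two measures be compared.\<close>

lemma christoffel_bound:
  assumes "degree P < n"
  shows "(poly P x)\<^sup>2 \<le> K n x x * (LINT t|M. (poly P t)\<^sup>2)"
proof -
  obtain c where c: "P = (\<Sum>k<n. smult (c k) (p k))" using expansion[OF assms] .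
  have "(LINT t|M. (poly P t)\<^sup>2) = (\<Sum>k<n. (c k)\<^sup>2)"
    using integral_expansion[where n=n and c=c and d=c] unfolding c by (simp add: power2_eq_square)
  moreover have "(poly P x)\<^sup>2 = (\<Sum>k<n. poly (p k) x * c k)\<^sup>2"
    unfolding c by (simp add: poly_sum mult.commute)
  moreover have "\<dots> \<le> (\<Sum>k<n. (poly (p k) x)\<^sup>2) * (\<Sum>k<n. (c k)\<^sup>2)"
    by (rule Cauchy_Schwarz_ineq_sum)
  ultimately show ?thesis by (simp add: reproducing_kernel_def power2_eq_square)
qed

lemma K_square_le: "(K n x y)\<^sup>2 \<le> K n x x * K n y y"
  unfolding reproducing_kernel_def
  using Cauchy_Schwarz_ineq_sum[of "\<lambda>k. poly (p k) x" "\<lambda>k. poly (p k) y" "{..<n}"]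
  by (simp add: power2_eq_square)

text \<open>This is \<open>christoffel_bound\<close> for the kernel at \<open>x\<close> minus
  \<open>P\<close>; the reproducing property turns the cross term of the squared norm into
  \<open>P(x)\<close>. A polynomial that is nearly extremal at \<open>x\<close> is thus close to the
  kernel at every \<open>y\<close>.\<close>

lemma K_diff_bound:
  assumes "degree P < n"
  shows "(K n x y - poly P y)\<^sup>2 \<le> K n y y * (K n x x - 2 * poly P x + (LINT t|M. (poly P t)\<^sup>2))"
proof -
  have n: "0 < n" using assms by simp
  have "(poly (kernel_poly n x - P) y)\<^sup>2 \<le> K n y y * (LINT t|M. (poly (kernel_poly n x - P) t)\<^sup>2)"
    by (intro christoffel_bound degree_diff_less assms degree_kernel_poly n)
  moreover have "(LINT t|M. (poly (kernel_poly n x - P) t)\<^sup>2)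
     = (LINT t|M. (K n x t * K n x t - 2 * (poly P t * K n x t)) + (poly P t)\<^sup>2)"
    by (simp add: power2_eq_square algebra_simps)
  moreover have "\<dots> = K n x x - 2 * poly P x + (LINT t|M. (poly P t)\<^sup>2)"
  proof -
    have 1: "integrable M (\<lambda>t. K n x t * K n x t)" "integrable M (\<lambda>t. poly P t * K n x t)"
      using integrable_poly_mult[of "kernel_poly n x" "kernel_poly n x"] integrable_poly_mult[of P "kernel_poly n x"] by simp_all
    have 2: "integrable M (\<lambda>t. (poly P t)\<^sup>2)"
      using integrable_poly_mult[of P P] by (simp add: power2_eq_square)
    show ?thesis using 1 2
      by (simp add: integral_K_square reproducing[OF assms])
  qed
  ultimately show ?thesis by simp
qed

end

section \<open>Regular measures: subexponential growth of the orthonormal polynomials\<close>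

text \<open>The function \<open>ln (norm (f z) / c)\<close> is positive and harmonic. A holomorphic
  logarithm of \<open>f / c\<close> has positive real part, a Moebius map sends the right half plane
  to the unit disc, and there the Schwarz lemma applies.\<close>

lemma harnack_modulus:
  fixes f :: "complex \<Rightarrow> complex"
  assumes hol: "f holomorphic_on ball 0 1" and c: "0 < c"
    and lower: "\<And>z. norm z < 1 \<Longrightarrow> c < norm (f z)"
    and rho: "0 \<le> \<rho>" "\<rho> < 1" and z: "norm z \<le> \<rho>"
  shows "ln (norm (f z)) - ln c \<le> (1 + \<rho>) / (1 - \<rho>) * (ln (norm (f 0)) - ln c)"
proof -
  have nz: "f z \<noteq> 0" if "z \<in> ball 0 1" for z using lower[of z] that c by auto
  obtain h where h: "h holomorphic_on ball 0 1" "\<And>z. z \<in> ball 0 1 \<Longrightarrow> f z = exp (h z)"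
    using contractible_imp_holomorphic_log[OF hol convex_imp_contractible nz] by (metis convex_ball)
  have Reh: "Re (h z) = ln (norm (f z))" if "norm z < 1" for z
    using h(2)[of z] that by simp
  \<comment> \<open>Subtracting the imaginary part at 0 makes \<open>F 0\<close> the real number
    \<open>a\<close>, so that \<open>H 0 = 0\<close> below.\<close>
  define F where "F z = h z - of_real (ln c) - \<i> * of_real (Im (h 0))" for z
  define a where "a = ln (norm (f 0)) - ln c"
  have a: "0 < a" using ln_less_cancel_iff[of c "norm (f 0)"] lower[of 0] c
    unfolding a_def by (metis diff_gt_0_iff_gt norm_zero order_less_trans zero_less_one)
  have F0: "F 0 = of_real a" using Reh[of 0] by (simp add: F_def a_def complex_eq_iff)
  have ReF: "Re (F z) = ln (norm (f z)) - ln c" if "norm z < 1" for z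
    using Reh[of z] that by (simp add: F_def)
  have ReF_pos: "0 < Re (F z)" if "norm z < 1" for z
    using ReF[OF that] ln_less_cancel_iff[of c "norm (f z)"] lower[OF that] c by linarith
  have Fhol: "F holomorphic_on ball 0 1"
    unfolding F_def by (intro holomorphic_intros h)
  define H where "H z = (F z - of_real a) / (F z + of_real a)" for z
  have den: "F z + of_real a \<noteq> 0" if "norm z < 1" for z
    using ReF_pos[OF that] a by (auto simp: complex_eq_iff)
  have Hhol: "H holomorphic_on ball 0 1"
    unfolding H_def by (intro holomorphic_intros Fhol) (use den in auto)
  have H1: "norm (H z) < 1" if "norm z < 1" for z
  proof -
    have "(norm (F z - of_real a))\<^sup>2 < (norm (F z + of_real a))\<^sup>2"
      unfolding cmod_power2 using ReF_pos[OF that] a by (simp add: power2_eq_square algebra_simps)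
    then have "norm (F z - of_real a) < norm (F z + of_real a)"
      by (rule power2_less_imp_less) simp
    moreover have "0 < norm (F z + of_real a)" using den[OF that] by simp
    ultimately show ?thesis unfolding H_def norm_divide by (simp add: divide_less_eq)
  qed
  have H0: "H 0 = 0" by (simp add: H_def F0)
  have z1: "norm z < 1" using z rho by simp
  have "norm (H z) \<le> norm z" by (rule Schwarz_Lemma(1)[OF Hhol H0 H1 z1])
  with z have Hz: "norm (H z) \<le> \<rho>" by simp
  have eq: "F z - of_real a = H z * (F z + of_real a)"
    using den[OF z1] by (simp add: H_def)
  \<comment> \<open>Solving \<open>norm (F z - a) \<le> \<rho> * norm (F z + a)\<close> for the norm
    of \<open>F z\<close> produces the Harnack constant.\<close>
  have "norm (F z) - a \<le> norm (F z - of_real a)"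
    using norm_triangle_ineq2[of "F z" "of_real a"] a by simp
  also have "\<dots> \<le> \<rho> * (norm (F z) + a)"
  proof -
    have "norm (F z + of_real a) \<le> norm (F z) + a"
      using norm_triangle_ineq[of "F z" "of_real a"] a by simp
    then show ?thesis unfolding eq norm_mult using Hz rho
      by (intro mult_mono) auto
  qed
  finally have "norm (F z) * (1 - \<rho>) \<le> (1 + \<rho>) * a" by (simp add: algebra_simps)
  then have "norm (F z) \<le> (1 + \<rho>) / (1 - \<rho>) * a"
    using rho by (simp add: field_simps)
  with complex_Re_le_cmod[of "F z"] ReF[OF z1] show ?thesis by (simp add: a_def)
qed

section \<open>Chebyshev polynomials and the Joukowski map\<close>

text \<open>These are the comparison polynomials for the orthonormal ones: at most 1 in modulus on
  [-1, 1], but of order \<open>norm \<zeta> ^ (- n)\<close> at the Joukowski image of a small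
  \<zeta>. The coefficients are complex because of the evaluation off the interval.\<close>

fun chebyshev :: "nat \<Rightarrow> complex poly" where
  "chebyshev 0 = 1"
| "chebyshev (Suc 0) = [:0, 1:]"
| "chebyshev (Suc (Suc n)) = [:0, 2:] * chebyshev (Suc n) - chebyshev n"

lemma degree_chebyshev: "degree (chebyshev n) \<le> n"
proof (induction n rule: chebyshev.induct)
  case (3 n)
  have "degree ([:0, 2:] * chebyshev (Suc n)) \<le> Suc (Suc n)"
    using degree_mult_le[of "[:0, 2:]" "chebyshev (Suc n)"] 3 by simp
  then show ?case using 3 by (auto intro!: degree_diff_le)
qed auto

lemma poly_chebyshev:
  assumes "\<zeta> \<noteq> 0"
  shows "poly (chebyshev n) ((\<zeta> + 1 / \<zeta>) / 2) = (\<zeta> ^ n + 1 / \<zeta> ^ n) / 2"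
  using assms
proof (induction n rule: chebyshev.induct)
  case (3 n)
  define w where "w = 1 / \<zeta>"
  have w: "\<zeta> * w = 1" "1 / \<zeta> ^ k = w ^ k" for k
    using 3 by (auto simp: w_def power_divide)
  have "(\<zeta> + w) * (\<zeta> ^ Suc n + w ^ Suc n)
      = \<zeta> ^ Suc (Suc n) + w ^ Suc (Suc n) + (\<zeta> * w) * (\<zeta> ^ n + w ^ n)"
    by (simp add: algebra_simps)
  then have "(\<zeta> + w) * (\<zeta> ^ Suc n + w ^ Suc n) - (\<zeta> ^ n + w ^ n) = \<zeta> ^ Suc (Suc n) + w ^ Suc (Suc n)"
    unfolding w(1) by simp
  moreover have "poly (chebyshev (Suc (Suc n))) ((\<zeta> + w) / 2)
      = ((\<zeta> + w) * (\<zeta> ^ Suc n + w ^ Suc n) - (\<zeta> ^ n + w ^ n)) / 2"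
  proof -
    have "poly (chebyshev (Suc n)) ((\<zeta> + w) / 2) = (\<zeta> ^ Suc n + w ^ Suc n) / 2"
      "poly (chebyshev n) ((\<zeta> + w) / 2) = (\<zeta> ^ n + w ^ n) / 2"
      using "3.IH"(1)[OF 3(3)] "3.IH"(2)[OF 3(3)] unfolding w(2) w_def by simp_all
    moreover have "poly (chebyshev (Suc (Suc n))) x = 2 * x * poly (chebyshev (Suc n)) x - poly (chebyshev n) x" for x
      by simp
    ultimately show ?thesis by (simp only:) (simp add: diff_divide_distrib del: power_Suc)
  qed
  ultimately show ?case unfolding w(2) by (simp only: w_def)
qed auto

lemma joukowski_cis: "(cis t + 1 / cis t) / 2 = of_real (cos t)"
proof -
  have "1 / cis t = cis (- t)" by (simp add: divide_inverse)
  then show ?thesis by (simp add: complex_eq_iff)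
qed

lemma norm_chebyshev_le:
  assumes "x \<in> {-1..1}"
  shows "norm (poly (chebyshev n) (of_real x)) \<le> 1"
proof -
  have x: "cos (arccos x) = x" using assms by (intro cos_arccos) auto
  have "poly (chebyshev n) (of_real x) = (cis (arccos x) ^ n + 1 / cis (arccos x) ^ n) / 2"
    using poly_chebyshev[of "cis (arccos x)" n] unfolding joukowski_cis x by simp
  also have "\<dots> = of_real (cos (real n * arccos x))"
    using joukowski_cis[of "real n * arccos x"] by (simp only: Complex.DeMoivre)
  finally show ?thesis by simp
qed

lemma poly_map_poly_of_real:
  "poly (map_poly of_real P) (of_real x) = (of_real (poly P x) :: 'a :: real_field)"
  by (induction P) (auto simp: map_poly_pCons)

text \<open>The direction is that from \<open>z\<close> to its nearest point on the segment. It puts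
  all values \<open>1 / (t - z)\<close> in one half plane, which excludes cancellation when they are
  integrated against the square of \<open>p n\<close>.\<close>

lemma segment_separation:
  fixes z :: complex
  assumes "0 < d" and "\<And>t. t \<in> {-1..1} \<Longrightarrow> d \<le> norm (of_real t - z)"
  obtains v where "norm v = 1" "\<And>t. t \<in> {-1..1} \<Longrightarrow> d \<le> inner v (of_real t - z)"
proof -
  define c where "c = max (-1) (min 1 (Re z))"
  define x where "x = of_real c - z"
  have dx: "d \<le> norm x" unfolding x_def c_def by (rule assms(2)) auto
  show ?thesis
  proof
    show "norm (sgn x) = 1" using dx assms(1) by (auto simp: norm_sgn)
    fix t :: real assume t: "t \<in> {-1..1}"
    define y where "y = of_real t - z"
    \<comment> \<open>\<open>c\<close> differs from \<open>Re z\<close> only when it is an endpoint,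
      and then both factors have the same sign.\<close>
    have "0 \<le> (c - Re z) * (t - c)"
      using t unfolding c_def by (cases "Re z < -1"; cases "1 < Re z") (auto simp: mult_nonpos_nonpos)
    moreover have "norm x * norm x = (c - Re z)\<^sup>2 + (Im z)\<^sup>2"
      unfolding power2_eq_square[symmetric] cmod_power2 by (simp add: x_def)
    moreover have "inner x y = (c - Re z)\<^sup>2 + (Im z)\<^sup>2 + (c - Re z) * (t - c)"
      by (simp add: inner_complex_def x_def y_def power2_eq_square algebra_simps)
    ultimately have "norm x * norm x \<le> inner x y" by simp
    moreover have "0 < norm x" using dx assms(1) by linarith
    ultimately have "norm x \<le> inner (sgn x) y"
      by (simp add: sgn_div_norm field_simps)
    with dx show "d \<le> inner (sgn x) (of_real t - z)" by (simp add: y_def)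
  qed
qed

section \<open>Lower bounds for orthonormal polynomials off the interval\<close>

context orthonormal_system
begin

definition cp :: "nat \<Rightarrow> complex poly" where "cp n = map_poly of_real (p n)"

lemma poly_cp [simp]: "poly (cp n) (of_real x) = of_real (poly (p n) x)"
  by (simp add: cp_def poly_map_poly_of_real)

lemma degree_cp [simp]: "degree (cp n) = n"
  by (simp add: cp_def degree_map_poly)

lemma orthogonal_complex:
  assumes "degree S < n"
  shows "(LINT t|M. of_real (poly (p n) t) * poly S (of_real t)) = (0::complex)"
proof -
  have "(LINT t|M. of_real (poly (p n) t) * poly S (of_real t))
      = (LINT t|M. (\<Sum>i\<le>degree S. coeff S i * of_real (poly (p n) t * poly (monom 1 i) t)))"
    by (simp add: poly_altdef[of S] sum_distrib_left mult_ac poly_monom)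
  also have "\<dots> = (\<Sum>i\<le>degree S. coeff S i * (LINT t|M. of_real (poly (p n) t * poly (monom 1 i) t)))"
    by (subst Bochner_Integration.integral_sum) (auto intro!: integrable_continuous continuous_intros)
  also have "\<dots> = 0"
  proof (intro sum.neutral ballI)
    fix i assume "i \<in> {..degree S}"
    then have "(LINT t|M. poly (p n) t * poly (monom 1 i) t) = 0"
      using assms by (intro orthogonal_lower_degree) (simp add: degree_monom_eq)
    then show "coeff S i * (LINT t|M. of_real (poly (p n) t * poly (monom 1 i) t)) = (0::complex)"
      by (subst integral_complex_of_real) simp
  qed
  finally show ?thesis .
qed

lemma integral_p_square: "(LINT t|M. (poly (p n) t)\<^sup>2) = 1"
  using orthonormal[of n n] by (simp add: power2_eq_square)

text \<open>The polynomial \<open>S\<close> with \<open>(t - z) S(t) = T(z) p\<^sub>n(t) - p\<^sub>n(z) T(t)\<close> has degree below \<open>n\<close>, hence is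
  orthogonal to \<open>p\<^sub>n\<close>.\<close>

lemma p_lower_bound:
  fixes z :: complex
  assumes n: "0 < n" and d: "0 < d" and dist: "\<And>t. t \<in> {-1..1} \<Longrightarrow> d \<le> norm (of_real t - z)"
    and T: "degree T \<le> n" "\<And>t. t \<in> {-1..1} \<Longrightarrow> norm (poly T (of_real t)) \<le> 1"
  shows "norm (poly T z) * (d / (1 + norm z))\<^sup>2 \<le> (measure M UNIV + 1) / 2 * norm (poly (cp n) z)"
proof -
  obtain v where v: "norm v = 1" "\<And>t. t \<in> {-1..1} \<Longrightarrow> d \<le> inner v (of_real t - z)"
    using segment_separation[OF d dist] by blast
  define D where "D = smult (poly T z) (cp n) - smult (poly (cp n) z) T"
  define S where "S = synthetic_div D z"
  \<comment> \<open>\<open>D\<close> vanishes at \<open>z\<close>, so the synthetic division leaves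
    no remainder.\<close>
  have D: "D = [:-z, 1:] * S"
    using synthetic_div_correct'[of z D] by (simp add: S_def D_def)
  have "degree D \<le> n" unfolding D_def using T(1)
    by (intro degree_diff_le order_trans[OF degree_smult_le]) auto
  then have "degree S < n" using n by (simp add: S_def degree_synthetic_div)
  then have orth: "(LINT t|M. of_real (poly (p n) t) * poly S (of_real t)) = (0::complex)"
    by (rule orthogonal_complex)
  define f where "f t = complex_of_real ((poly (p n) t)\<^sup>2) / (of_real t - z)" for t
  define g where "g t = complex_of_real (poly (p n) t) * poly T (of_real t) / (of_real t - z)" for t
  have ne: "of_real t - z \<noteq> 0" if "t \<in> {-1..1}" for t using dist[OF that] d by auto
  have pb: "\<exists>B. \<forall>t\<in>{-1..1}. norm (poly (p n) t) \<le> B"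
  proof -
    have "continuous_on {-1..1} (poly (p n))" by (intro continuous_intros)
    then show ?thesis
      using compact_imp_bounded[OF compact_continuous_image[of "{-1..1}" "poly (p n)"]]
      by (auto simp: bounded_iff)
  qed
  then obtain B where B: "\<And>t. t \<in> {-1..1} \<Longrightarrow> \<bar>poly (p n) t\<bar> \<le> B"
    unfolding real_norm_def by blast
  have intf: "integrable M f"
  proof (rule integrable_bounded)
    show "f \<in> borel_measurable borel" unfolding f_def
      by (intro borel_measurable_divide borel_measurable_continuous_onI continuous_intros)
    fix t :: real assume "t \<in> {-1<..<1}"
    then have t: "t \<in> {-1..1}" by auto
    have "(poly (p n) t)\<^sup>2 \<le> B\<^sup>2" using B[OF t] by (metis abs_ge_zero power2_abs power_mono)
    then show "norm (f t) \<le> B\<^sup>2 / d"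
      unfolding f_def norm_divide using dist[OF t] d by (intro frac_le) (auto simp: norm_power)
  qed
  have g_le: "norm (g t) \<le> \<bar>poly (p n) t\<bar> / d" if t: "t \<in> {-1..1}" for t
    unfolding g_def norm_divide norm_mult
    using dist[OF t] d T(2)[OF t] by (intro frac_le) (auto intro: mult_left_le)
  have intg: "integrable M g"
  proof (rule integrable_bounded)
    show "g \<in> borel_measurable borel" unfolding g_def
      by (intro borel_measurable_divide borel_measurable_continuous_onI continuous_intros)
    fix t :: real assume "t \<in> {-1<..<1}"
    then have t: "t \<in> {-1..1}" by auto
    show "norm (g t) \<le> B / d"
      using g_le[OF t] B[OF t] d by (meson divide_right_mono less_imp_le order_trans)
  qed
  \<comment> \<open>Orthogonality makes the right-hand side 0, so the integrals of \<open>f\<close>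
    and \<open>g\<close> are in the ratio of \<open>p n\<close> to \<open>T\<close> at
    \<open>z\<close>. A lower bound for the one and an upper bound for the other then bound
    \<open>p n\<close> from below.\<close>
  have "(LINT t|M. poly T z * f t - poly (cp n) z * g t)
      = (LINT t|M. of_real (poly (p n) t) * poly S (of_real t))"
  proof (rule integral_cong_AE)
    show "AE t in M. poly T z * f t - poly (cp n) z * g t = of_real (poly (p n) t) * poly S (of_real t)"
      using AE_in
    proof eventually_elim
      case (elim t)
      then have t: "of_real t - z \<noteq> 0" by (intro ne) auto
      have "poly D (of_real t) = (of_real t - z) * poly S (of_real t)" by (simp add: D algebra_simps)
      define u where "u = 1 / (of_real t - z)"
      have "poly S (of_real t) = poly D (of_real t) * u"
        using t \<open>poly D (of_real t) = _\<close> by (simp add: u_def)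
      moreover have "f t = of_real (poly (p n) t) * of_real (poly (p n) t) * u"
        "g t = of_real (poly (p n) t) * poly T (of_real t) * u"
        by (simp_all add: f_def g_def u_def power2_eq_square)
      ultimately show ?case
        by (simp only: D_def poly_diff poly_smult poly_cp) (simp add: algebra_simps)
    qed
    show "(\<lambda>t. poly T z * f t - poly (cp n) z * g t) \<in> borel_measurable M"
      using intf intg by (auto intro!: borel_measurable_diff borel_measurable_times borel_measurable_integrable)
    show "(\<lambda>t. of_real (poly (p n) t) * poly S (of_real t)) \<in> borel_measurable M"
      by (intro borel_measurable_integrable integrable_continuous continuous_intros)
  qed
  then have eq: "poly T z * integral\<^sup>L M f = poly (cp n) z * integral\<^sup>L M g"
    using intf intg orth by simp
  \<comment> \<open>\<open>1 / w\<close> is the conjugate of \<open>w\<close> over its squared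
    modulus, hence the conjugate of the separating direction.\<close>
  have Re_f: "d / (1 + norm z)\<^sup>2 * (poly (p n) t)\<^sup>2 \<le> inner (cnj v) (f t)" if t: "t \<in> {-1..1}" for t
  proof -
    define w where "w = of_real t - z"
    have w0: "norm w \<noteq> 0" using ne[OF t] by (simp add: w_def)
    have w: "norm w \<le> 1 + norm z"
      unfolding w_def using norm_triangle_ineq4[of "of_real t" z] t by (auto simp: abs_le_iff)
    have "inner (cnj v) (1 / w) = inner v w / (norm w)\<^sup>2"
      by (simp add: inner_complex_def Re_divide Im_divide cmod_power2 add_divide_distrib)
    moreover have "\<dots> \<ge> d / (1 + norm z)\<^sup>2"
      using v(2)[OF t] d w w0 by (intro frac_le power_mono) (auto simp: w_def)
    moreover have "f t = (poly (p n) t)\<^sup>2 *\<^sub>R (1 / w)" by (simp add: f_def w_def scaleR_conv_of_real)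
    moreover have "inner (cnj v) ((poly (p n) t)\<^sup>2 *\<^sub>R (1 / w)) = (poly (p n) t)\<^sup>2 * inner (cnj v) (1 / w)"
      by (rule inner_scaleR_right)
    moreover have "d / (1 + norm z)\<^sup>2 * (poly (p n) t)\<^sup>2 = (poly (p n) t)\<^sup>2 * (d / (1 + norm z)\<^sup>2)"
      by (rule mult.commute)
    ultimately show ?thesis by (simp only:) (intro mult_left_mono, auto)
  qed
  have "d / (1 + norm z)\<^sup>2 = (LINT t|M. d / (1 + norm z)\<^sup>2 * (poly (p n) t)\<^sup>2)"
    by (simp add: integral_p_square)
  also have "\<dots> \<le> (LINT t|M. inner (cnj v) (f t))"
  proof (rule integral_mono_AE)
    show "AE t in M. d / (1 + norm z)\<^sup>2 * (poly (p n) t)\<^sup>2 \<le> inner (cnj v) (f t)"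
      using AE_in by eventually_elim (rule Re_f, auto)
    show "integrable M (\<lambda>t. d / (1 + norm z)\<^sup>2 * (poly (p n) t)\<^sup>2)"
      by (intro integrable_continuous continuous_on_mult continuous_on_const continuous_on_power continuous_on_poly continuous_on_id)
    show "integrable M (\<lambda>t. inner (cnj v) (f t))" using intf by simp
  qed
  also have "\<dots> = inner (cnj v) (integral\<^sup>L M f)" by (simp add: intf)
  also have "\<dots> \<le> norm (integral\<^sup>L M f)"
    using norm_cauchy_schwarz[of "cnj v" "integral\<^sup>L M f"] v(1) by simp
  finally have lower: "d / (1 + norm z)\<^sup>2 \<le> norm (integral\<^sup>L M f)" .
  \<comment> \<open>The integral of the modulus of \<open>p n\<close> is estimated by that of
    \<open>(1 + (p n)^2) / 2\<close>, which is the source of the factor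
    \<open>(measure M UNIV + 1) / 2\<close>.\<close>
  have "norm (integral\<^sup>L M g) \<le> (LINT t|M. norm (g t))" by (rule integral_norm_bound)
  also have "\<dots> \<le> (LINT t|M. (1 + (poly (p n) t)\<^sup>2) / 2 / d)"
  proof (rule integral_mono_AE)
    show "AE t in M. norm (g t) \<le> (1 + (poly (p n) t)\<^sup>2) / 2 / d"
      using AE_in
    proof eventually_elim
      case (elim t)
      have "\<bar>poly (p n) t\<bar> \<le> (1 + (poly (p n) t)\<^sup>2) / 2"
        using zero_le_power2[of "\<bar>poly (p n) t\<bar> - 1"] by (simp add: power2_diff)
      then have "\<bar>poly (p n) t\<bar> / d \<le> (1 + (poly (p n) t)\<^sup>2) / 2 / d"
        using d by (intro divide_right_mono) auto
      with g_le[of t] elim show ?case by auto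
    qed
    show "integrable M (\<lambda>t. norm (g t))" using intg by simp
    show "integrable M (\<lambda>t. (1 + (poly (p n) t)\<^sup>2) / 2 / d)"
      using d by (intro integrable_continuous continuous_intros) auto
  qed
  also have "\<dots> = (measure M UNIV + 1) / 2 / d"
  proof -
    have "integrable M (\<lambda>t. (poly (p n) t)\<^sup>2)" by (intro integrable_continuous continuous_intros)
    then show ?thesis by (simp add: integral_p_square)
  qed
  finally have upper: "norm (integral\<^sup>L M g) \<le> (measure M UNIV + 1) / 2 / d" .
  have "norm (poly T z) * (d / (1 + norm z)\<^sup>2) \<le> norm (poly T z) * norm (integral\<^sup>L M f)"
    by (intro mult_left_mono lower) auto
  also have "\<dots> = norm (poly (cp n) z) * norm (integral\<^sup>L M g)"
    using eq by (metis norm_mult)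
  also have "\<dots> \<le> norm (poly (cp n) z) * ((measure M UNIV + 1) / 2 / d)"
    by (intro mult_left_mono upper) auto
  finally have "norm (poly T z) * (d / (1 + norm z)\<^sup>2) * d \<le> norm (poly (cp n) z) * ((measure M UNIV + 1) / 2 / d) * d"
    using d by (intro mult_right_mono) auto
  then show ?thesis using d by (simp add: power2_eq_square mult_ac)
qed

section \<open>Pulling the orthonormal polynomials back to the unit disc\<close>

text \<open>This is \<open>\<zeta> ^ n\<close> times \<open>p n\<close> at the Joukowski image of
  \<zeta>, multiplied out so that it makes sense at 0. Its value there is the leading coefficient
  over \<open>2 ^ n\<close>, which regularity controls; on the unit circle its modulus is that of
  \<open>p n\<close> on [-1, 1], which is to be bounded.\<close>

definition circle_poly :: "nat \<Rightarrow> complex \<Rightarrow> complex" where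
  "circle_poly n \<zeta> = (\<Sum>j\<le>n. coeff (cp n) j * \<zeta> ^ (n - j) * ((\<zeta>\<^sup>2 + 1) / 2) ^ j)"

lemma circle_poly_eq:
  assumes "\<zeta> \<noteq> 0"
  shows "circle_poly n \<zeta> = \<zeta> ^ n * poly (cp n) ((\<zeta> + 1 / \<zeta>) / 2)"
proof -
  have "\<zeta> ^ n * ((\<zeta> + 1 / \<zeta>) / 2) ^ j = \<zeta> ^ (n - j) * ((\<zeta>\<^sup>2 + 1) / 2) ^ j" if "j \<le> n" for j
  proof -
    have "\<zeta> ^ n = \<zeta> ^ (n - j) * \<zeta> ^ j" using that by (simp flip: power_add)
    moreover have "\<zeta> * ((\<zeta> + 1 / \<zeta>) / 2) = (\<zeta>\<^sup>2 + 1) / 2"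
      using assms by (simp add: power2_eq_square algebra_simps)
    ultimately show ?thesis by (metis mult.assoc power_mult_distrib)
  qed
  then show ?thesis
    by (auto simp: circle_poly_def poly_altdef sum_distrib_left mult_ac intro!: sum.cong)
qed

lemma circle_poly_0: "circle_poly n 0 = of_real (lead_coeff (p n)) / 2 ^ n"
proof -
  have "circle_poly n 0 = (\<Sum>j\<in>{n}. coeff (cp n) j * 0 ^ (n - j) * (1 / 2) ^ j)"
    unfolding circle_poly_def by (rule sum.mono_neutral_cong_right) (auto simp: power_0_left)
  then show ?thesis by (simp add: cp_def coeff_map_poly power_divide)
qed

lemma circle_poly_holomorphic: "circle_poly n holomorphic_on A"
  unfolding circle_poly_def by (intro holomorphic_intros) auto

text \<open>The Joukowski map is invariant under inversion. Bounds inside the unit circle thus carry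
  over to the outside.\<close>

lemma circle_poly_self_reciprocal:
  assumes "\<zeta> \<noteq> 0"
  shows "circle_poly n \<zeta> = \<zeta> ^ (2 * n) * circle_poly n (1 / \<zeta>)"
  using assms by (simp add: circle_poly_eq mult_2 power_add power_divide add.commute)

text \<open>This is \<open>p_lower_bound\<close> with the Chebyshev polynomial, for which
  \<open>\<zeta> ^ n\<close> times its value is \<open>(1 + \<zeta> ^ (2 * n)) / 2\<close> and stays
  away from 0. The bound is free of \<open>n\<close>, as the use of Harnack's inequality
  requires.\<close>

lemma circle_poly_lower:
  assumes n: "0 < n" and r: "0 < r" "r < 1" and z: "norm \<zeta> < r"
  shows "(1 - r) ^ 5 / (16 * (measure M UNIV + 1)) \<le> norm (circle_poly n \<zeta>)"
proof -
  define B where "B = (measure M UNIV + 1) / 2"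
  have B: "0 < B" by (simp add: B_def add_nonneg_pos)
  have nz: "(1 - r) ^ 5 / (32 * B) \<le> norm (circle_poly n \<zeta>)" if z: "norm \<zeta> < r" "\<zeta> \<noteq> 0" for \<zeta>
  proof -
    define z where "z = (\<zeta> + 1 / \<zeta>) / 2"
    \<comment> \<open>For \<open>t = cos \<theta>\<close>, the difference \<open>z - t\<close> is
      \<open>(cis \<theta> - \<zeta>) * (cis (- \<theta>) - \<zeta>) / (2 * \<zeta>)\<close>, and
      both factors of the numerator are at least \<open>1 - r\<close> in modulus.\<close>
    define d where "d = (1 - r)\<^sup>2 / (2 * norm \<zeta>)"
    have d: "0 < d" using z r by (simp add: d_def)
    have dist: "d \<le> norm (of_real t - z)" if t: "t \<in> {-1..1}" for t
    proof -
      define \<theta> where "\<theta> = arccos t"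
      have t': "t = cos \<theta>" using t by (simp add: \<theta>_def cos_arccos)
      have "(cis \<theta> - \<zeta>) * (cis (-\<theta>) - \<zeta>) = \<zeta>\<^sup>2 - 2 * of_real t * \<zeta> + 1"
      proof -
        have "cis \<theta> * cis (-\<theta>) = 1" by (simp add: cis_mult)
        moreover have "cis \<theta> + cis (-\<theta>) = 2 * of_real t" by (simp add: t' complex_eq_iff)
        moreover have "(cis \<theta> - \<zeta>) * (cis (-\<theta>) - \<zeta>) = \<zeta>\<^sup>2 - (cis \<theta> + cis (-\<theta>)) * \<zeta> + cis \<theta> * cis (-\<theta>)"
          by (simp add: algebra_simps power2_eq_square)
        ultimately show ?thesis by simp
      qed
      moreover have "z - of_real t = (\<zeta>\<^sup>2 - 2 * of_real t * \<zeta> + 1) / (2 * \<zeta>)"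
        using z by (simp add: z_def add_divide_distrib diff_divide_distrib power2_eq_square)
      ultimately have "z - of_real t = (cis \<theta> - \<zeta>) * (cis (-\<theta>) - \<zeta>) / (2 * \<zeta>)" by simp
      then have "norm (of_real t - z) = norm (cis \<theta> - \<zeta>) * norm (cis (-\<theta>) - \<zeta>) / (2 * norm \<zeta>)"
        by (simp add: norm_minus_commute[of "of_real t"] norm_divide norm_mult)
      moreover have "1 - r \<le> norm (cis s - \<zeta>)" for s
        using norm_triangle_ineq2[of "cis s" \<zeta>] z by simp
      then have "(1 - r)\<^sup>2 \<le> norm (cis \<theta> - \<zeta>) * norm (cis (-\<theta>) - \<zeta>)"
        unfolding power2_eq_square using r by (intro mult_mono) auto
      ultimately show ?thesis using z by (simp add: d_def divide_right_mono)
    qed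
    \<comment> \<open>The \<open>1 / norm \<zeta>\<close> here cancels the one in \<open>d\<close>,
      so the estimate does not degenerate near the centre.\<close>
    have zb: "1 + norm z \<le> 2 / norm \<zeta>"
    proof -
      have "norm z \<le> (norm \<zeta> + 1 / norm \<zeta>) / 2"
        using norm_triangle_ineq[of \<zeta> "1 / \<zeta>"] by (simp add: z_def norm_divide)
      moreover have "1 + (norm \<zeta> + 1 / norm \<zeta>) / 2 \<le> 2 / norm \<zeta>"
      proof -
        have "2 * norm \<zeta> + norm \<zeta> * norm \<zeta> + 1 \<le> 4"
        proof -
          have "norm \<zeta> \<le> 1" using z r by linarith
          then have "norm \<zeta> * norm \<zeta> \<le> 1" by (intro mult_le_one) auto
          with \<open>norm \<zeta> \<le> 1\<close> show ?thesis by linarith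
        qed
        then have "(2 * norm \<zeta> + norm \<zeta> * norm \<zeta> + 1) / (2 * norm \<zeta>) \<le> 4 / (2 * norm \<zeta>)"
          by (intro divide_right_mono) auto
        then show ?thesis using z by (simp add: add_divide_distrib)
      qed
      ultimately show ?thesis by linarith
    qed
    have "(1 - r)\<^sup>2 / 4 = d / (2 / norm \<zeta>)" using z by (simp add: d_def)
    also have "\<dots> \<le> d / (1 + norm z)"
      using zb d by (intro frac_le) (auto intro!: add_pos_nonneg)
    finally have ratio: "((1 - r)\<^sup>2 / 4)\<^sup>2 \<le> (d / (1 + norm z))\<^sup>2"
      by (intro power_mono) auto
    have cheb: "(1 - r) / 2 \<le> norm (\<zeta> ^ n * poly (chebyshev n) z)"
    proof -
      have "\<zeta> ^ n * poly (chebyshev n) z = (1 + \<zeta> ^ (2 * n)) / 2"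
        unfolding z_def poly_chebyshev[OF z(2)] using z by (simp add: distrib_left mult_2 power_add add.commute)
      moreover have "norm (\<zeta> ^ (2 * n)) \<le> r"
      proof -
        have "norm (\<zeta> ^ (2 * n)) \<le> norm \<zeta> ^ 1"
          unfolding norm_power using n z r by (intro power_decreasing) auto
        then show ?thesis using z by simp
      qed
      moreover have "1 - norm (\<zeta> ^ (2 * n)) \<le> norm (1 + \<zeta> ^ (2 * n))"
        using norm_diff_ineq[of 1 "\<zeta> ^ (2 * n)"] by simp
      ultimately show ?thesis by (simp only: norm_divide) simp
    qed
    have "(1 - r) / 2 * ((1 - r)\<^sup>2 / 4)\<^sup>2 \<le> norm (\<zeta> ^ n * poly (chebyshev n) z) * (d / (1 + norm z))\<^sup>2"
      using r by (intro mult_mono cheb ratio) auto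
    also have "\<dots> = norm (\<zeta> ^ n) * (norm (poly (chebyshev n) z) * (d / (1 + norm z))\<^sup>2)"
      by (simp add: norm_mult)
    also have "\<dots> \<le> norm (\<zeta> ^ n) * (B * norm (poly (cp n) z))"
      unfolding B_def
      by (intro mult_left_mono p_lower_bound[OF n d dist] degree_chebyshev norm_chebyshev_le) auto
    also have "\<dots> = B * norm (circle_poly n \<zeta>)"
      by (simp add: circle_poly_eq[OF z(2)] z_def norm_mult)
    also have "(1 - r) / 2 * ((1 - r)\<^sup>2 / 4)\<^sup>2 = (1 - r) ^ 5 / 32"
    proof -
      have "q / 2 * (q\<^sup>2 / 4)\<^sup>2 = q ^ 5 / 32" for q :: real by (simp add: eval_nat_numeral)
      then show ?thesis .
    qed
    finally have "(1 - r) ^ 5 / 32 / B \<le> B * norm (circle_poly n \<zeta>) / B"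
      using B by (intro divide_right_mono) auto
    then show ?thesis using B by simp
  qed
  have "(1 - r) ^ 5 / (32 * B) \<le> norm (circle_poly n \<zeta>)"
  proof (cases "\<zeta> = 0")
    case True
    \<comment> \<open>The Joukowski map has a pole at 0, so the bound is extended there by
      continuity.\<close>
    have "isCont (circle_poly n) 0"
      unfolding circle_poly_def by (intro continuous_intros) auto
    then have "((\<lambda>w. norm (circle_poly n w)) \<longlongrightarrow> norm (circle_poly n 0)) (at 0)"
      by (intro tendsto_norm) (simp add: isCont_def)
    moreover have "eventually (\<lambda>w. (1 - r) ^ 5 / (32 * B) \<le> norm (circle_poly n w)) (at 0)"
      using nz r by (auto simp: eventually_at intro!: exI[of _ r])
    ultimately show ?thesis using True by (auto intro: tendsto_lowerbound)
  qed (use nz z in auto)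
  moreover have "32 * B = 16 * (measure M UNIV + 1)" by (simp add: B_def)
  ultimately show ?thesis by (simp only:)
qed

text \<open>On discs of radius below \<open>1\<close> the logarithm of \<open>\<bar>circle_poly n\<bar>\<close> is harmonic and bounded below uniformly in
  \<open>n\<close>, so by Harnack's inequality its value at \<open>0\<close>, which regularity controls, bounds it from above on
  smaller discs.  Self-reciprocity and the maximum principle extend the bound to the unit circle.\<close>

theorem regular_imp_subexponential:
  assumes reg: "\<And>\<delta>. 0 < \<delta> \<Longrightarrow> \<exists>C. \<forall>n. \<bar>lead_coeff (p n)\<bar> \<le> exp (C + \<delta> * n) * 2 ^ n"
    and \<delta>: "0 < \<delta>"
  shows "\<exists>C. \<forall>n. \<forall>x\<in>{-1..1}. \<bar>poly (p n) x\<bar> \<le> exp (C + \<delta> * n)"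
proof -
  \<comment> \<open>The rate \<delta> is spent in two halves. Harnack's inequality amplifies the
    rate \<open>\<delta> / (2 * L)\<close> of the leading coefficients to
    \<open>\<delta> / 2\<close>, and the reciprocity factor \<open>(1 / R) ^ (2 * n)\<close> with
    \<open>R = \<rho> ^ 2 = exp (- \<delta> / 4)\<close> costs the rest.\<close>
  define \<rho> where "\<rho> = exp (- \<delta> / 8)"
  have \<rho>: "0 < \<rho>" "\<rho> < 1" using \<delta> by (auto simp: \<rho>_def)
  define L where "L = (1 + \<rho>) / (1 - \<rho>)"
  have L: "1 \<le> L" using \<rho> by (simp add: L_def field_simps)
  define X where "X = (1 - \<rho>) ^ 5 / (16 * (measure M UNIV + 1))"
  \<comment> \<open>Halved because \<open>harnack_modulus\<close> asks for a strict lower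
    bound.\<close>
  define c where "c = X / 2"
  have "0 < X" using \<rho> by (auto simp: X_def intro!: divide_pos_pos mult_pos_pos add_nonneg_pos)
  then have c: "0 < c" by (simp add: c_def)
  obtain C where C: "\<And>n. \<bar>lead_coeff (p n)\<bar> \<le> exp (C + \<delta> / (2 * L) * n) * 2 ^ n"
    using reg[of "\<delta> / (2 * L)"] \<delta> L by auto
  define A where "A = ln c + L * (C - ln c)"
  define R where "R = \<rho>\<^sup>2"
  have R: "0 < R" "R < 1" using \<rho> by (auto simp: R_def power_less_one_iff)
  have inner: "norm (circle_poly n \<zeta>) \<le> exp (A + \<delta> / 2 * n)" if n: "0 < n" and z: "norm \<zeta> \<le> R" for n \<zeta>
  proof -
    define f where "f w = circle_poly n (of_real \<rho> * w)" for w
    have hol: "f holomorphic_on ball 0 1"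
      unfolding f_def
      using holomorphic_on_compose[OF _ circle_poly_holomorphic, of "\<lambda>w. of_real \<rho> * w" "ball 0 1" n]
      by (simp add: o_def holomorphic_intros)
    have low: "c < norm (f w)" if "norm w < 1" for w
    proof -
      have "c < 2 * c" using c by simp
      also have "2 * c \<le> norm (f w)"
        using circle_poly_lower[OF n \<rho>, of "of_real \<rho> * w"] that \<rho> unfolding X_def[symmetric]
          by (simp add: c_def f_def norm_mult)
      finally show ?thesis .
    qed
    \<comment> \<open>The lower bound holds on the disc of radius \<rho>, which \<open>f\<close>
      rescales to the unit disc; the points of modulus up to \<open>\<rho> ^ 2\<close> are then at
      radius at most \<rho>.\<close>
    have "norm (\<zeta> / of_real \<rho>) \<le> \<rho>"
      using z \<rho> by (simp add: norm_divide R_def power2_eq_square field_simps)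
    from harnack_modulus[OF hol c low _ \<rho>(2) this] \<rho>
    have 1: "ln (norm (circle_poly n \<zeta>)) - ln c \<le> L * (ln (norm (circle_poly n 0)) - ln c)"
      by (simp add: f_def L_def)
    have pos: "0 < norm (circle_poly n 0)" using low[of 0] c by (auto simp: f_def)
    have "norm (circle_poly n 0) \<le> exp (C + \<delta> / (2 * L) * n)"
      using C[of n] by (simp add: circle_poly_0 norm_divide norm_power field_simps)
    then have "ln (norm (circle_poly n 0)) \<le> C + \<delta> / (2 * L) * n"
      using pos by (metis ln_exp ln_le_cancel_iff exp_gt_zero)
    then have "L * (ln (norm (circle_poly n 0)) - ln c) \<le> L * (C + \<delta> / (2 * L) * n - ln c)"
      using L by (intro mult_left_mono) auto
    also have "\<dots> = L * (C - ln c) + \<delta> / 2 * n" using L by (simp add: field_simps)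
    finally have "ln (norm (circle_poly n \<zeta>)) \<le> A + \<delta> / 2 * n" using 1 by (simp add: A_def)
    moreover have "0 < norm (circle_poly n \<zeta>)"
    proof -
      have "norm (\<zeta> / of_real \<rho>) < 1"
        using \<open>norm (\<zeta> / of_real \<rho>) \<le> \<rho>\<close> \<rho> by linarith
      from low[OF this] c show ?thesis using \<rho> by (auto simp: f_def)
    qed
    ultimately show ?thesis by (metis exp_le_cancel_iff exp_ln)
  qed
  have outer: "norm (circle_poly n \<zeta>) \<le> exp (A + \<delta> * n)" if n: "0 < n" and z: "norm \<zeta> \<le> 1 / R" for n \<zeta>
  proof (rule maximum_modulus_frontier[where S = "cball 0 (1 / R)" and f = "circle_poly n"])
    fix w :: complex assume "w \<in> frontier (cball 0 (1 / R))"
    then have w: "norm w = 1 / R" using R by (simp add: frontier_cball)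
    then have w0: "w \<noteq> 0" using R by auto
    have "norm (circle_poly n w) = (1 / R) ^ (2 * n) * norm (circle_poly n (1 / w))"
      unfolding circle_poly_self_reciprocal[OF w0] norm_mult norm_power w ..
    also have "\<dots> \<le> (1 / R) ^ (2 * n) * exp (A + \<delta> / 2 * n)"
      using R w by (intro mult_left_mono inner[OF n]) (auto simp: norm_divide)
    finally have le: "norm (circle_poly n w) \<le> (1 / R) ^ (2 * n) * exp (A + \<delta> / 2 * n)" .
    have pw: "(1 / R) ^ (2 * n) = exp (\<delta> / 2 * n)"
    proof -
      have "R = exp (- \<delta> / 4)"
        unfolding R_def \<rho>_def power2_eq_square exp_add[symmetric] by simp
      then have "1 / R = exp (\<delta> / 4)" by (simp add: exp_minus inverse_eq_divide)
      then have "(1 / R) ^ (2 * n) = exp (of_nat (2 * n) * (\<delta> / 4))"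
        by (simp only: exp_of_nat_mult)
      then show ?thesis by (simp add: algebra_simps)
    qed
    have "exp (\<delta> / 2 * n) * exp (A + \<delta> / 2 * n) = exp (A + \<delta> * n)"
      unfolding exp_add[symmetric] by simp
    with le show "norm (circle_poly n w) \<le> exp (A + \<delta> * n)" unfolding pw by simp
  qed (use z in \<open>auto simp: circle_poly_holomorphic intro!: holomorphic_on_imp_continuous_on\<close>)
  \<comment> \<open>The estimates above are for \<open>0 < n\<close>; the constant polynomial
    \<open>p 0\<close> is absorbed in the constant.\<close>
  define C' where "C' = max A (ln (\<bar>coeff (p 0) 0\<bar> + 1))"
  have "\<bar>poly (p n) x\<bar> \<le> exp (C' + \<delta> * n)" if x: "x \<in> {-1..1}" for n x
  proof (cases "n = 0")
    case True
    have "poly (p 0) x = coeff (p 0) 0"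
      using degree_p[of 0] by (metis add_0_right coeff_pCons_0 degree_eq_zeroE mult_zero_right poly_0 poly_pCons)
    moreover have "\<bar>coeff (p 0) 0\<bar> \<le> exp (ln (\<bar>coeff (p 0) 0\<bar> + 1))" by simp
    moreover have "\<dots> \<le> exp C'" unfolding C'_def exp_le_cancel_iff by (rule max.cobounded2)
    ultimately show ?thesis using True by simp
  next
    case False
    define \<theta> where "\<theta> = arccos x"
    have x': "x = cos \<theta>" using x by (simp add: \<theta>_def cos_arccos)
    have "circle_poly n (cis \<theta>) = cis \<theta> ^ n * of_real (poly (p n) x)"
      by (subst circle_poly_eq) (simp_all only: joukowski_cis x' poly_cp cis_neq_zero not_False_eq_True)
    then have "\<bar>poly (p n) x\<bar> = norm (circle_poly n (cis \<theta>))"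
      by (simp add: norm_mult norm_power)
    also have "\<dots> \<le> exp (A + \<delta> * n)"
      using False R by (intro outer) auto
    also have "\<dots> \<le> exp (C' + \<delta> * n)" by (simp add: C'_def)
    finally show ?thesis .
  qed
  then show ?thesis by blast
qed

end

section \<open>Alternating binomial sums and the inverse Cauchy matrix\<close>

text \<open>Pascal's rule. It makes the alternating binomial sum an iterated difference: passing
  from \<open>n\<close> to \<open>Suc n\<close> replaces \<open>f k\<close> by
  \<open>f k - f (Suc k)\<close>.\<close>

lemma alternating_binomial_Suc:
  fixes f :: "nat \<Rightarrow> real"
  shows "(\<Sum>k\<le>Suc n. (-1) ^ k * real (Suc n choose k) * f k)
    = (\<Sum>k\<le>n. (-1) ^ k * real (n choose k) * f k) - (\<Sum>k\<le>n. (-1) ^ k * real (n choose k) * f (Suc k))"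
proof -
  have "(\<Sum>k\<le>Suc n. (-1) ^ k * real (Suc n choose k) * f k)
     = f 0 + (\<Sum>k\<le>n. (-1) ^ Suc k * real (Suc n choose Suc k) * f (Suc k))"
    by (subst sum.atMost_Suc_shift) simp
  also have "(\<Sum>k\<le>n. (-1) ^ Suc k * real (Suc n choose Suc k) * f (Suc k))
     = (\<Sum>k\<le>n. (-1) ^ Suc k * real (n choose Suc k) * f (Suc k)) - (\<Sum>k\<le>n. (-1) ^ k * real (n choose k) * f (Suc k))"
    by (simp add: algebra_simps sum_subtractf sum_negf sum.distrib)
  also have "f 0 + \<dots> = (\<Sum>k\<le>Suc n. (-1) ^ k * real (n choose k) * f k) - (\<Sum>k\<le>n. (-1) ^ k * real (n choose k) * f (Suc k))"
    by (subst sum.atMost_Suc_shift) simp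
  finally show ?thesis by simp
qed

text \<open>Each difference \<open>P(x) - P(x + 1)\<close> loses the leading term, so
  \<open>n\<close> of them annihilate a polynomial of degree below \<open>n\<close>.\<close>

lemma alternating_binomial_poly:
  fixes P :: "real poly"
  assumes "degree P < n"
  shows "(\<Sum>k\<le>n. (-1) ^ k * real (n choose k) * poly P (real k)) = 0"
  using assms
proof (induction n arbitrary: P)
  case (Suc n)
  define D where "D = P - pcompose P [:1, 1:]"
  have "(\<Sum>k\<le>Suc n. (-1) ^ k * real (Suc n choose k) * poly P (real k))
      = (\<Sum>k\<le>n. (-1) ^ k * real (n choose k) * poly P (real k))
        - (\<Sum>k\<le>n. (-1) ^ k * real (n choose k) * poly P (real (Suc k)))"
    by (rule alternating_binomial_Suc)
  also have "\<dots> = (\<Sum>k\<le>n. (-1) ^ k * real (n choose k) * poly D (real k))"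
    by (simp add: D_def poly_pcompose algebra_simps sum_subtractf)
  also have "\<dots> = 0"
  proof (cases "D = 0")
    case True
    then show ?thesis by simp
  next
    case False
    have deg: "degree (pcompose P [:1, 1:]) = degree P" by (simp add: degree_pcompose)
    have "coeff (pcompose P [:1, 1:]) (degree P) = coeff P (degree P)"
      using lead_coeff_comp[of "[:1, 1:]" P] deg by simp
    then have "coeff D (degree P) = 0" by (simp add: D_def)
    moreover have "degree D \<le> degree P" unfolding D_def by (intro degree_diff_le) (auto simp: deg)
    ultimately have "degree D < degree P" using False by (metis eq_zero_or_degree_less)
    then show ?thesis using Suc by auto
  qed
  finally show ?case .
qed simp

text \<open>The partial fraction expansion of \<open>n! / (s (s + 1) ... (s + n))\<close>, read as
  iterated differences of \<open>1 / s\<close>.\<close>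

lemma alternating_binomial_inverse:
  fixes s :: real
  assumes "0 < s"
  shows "(\<Sum>k\<le>n. (-1) ^ k * real (n choose k) / (s + real k)) = fact n / pochhammer s (Suc n)"
  using assms
proof (induction n arbitrary: s)
  case (Suc n)
  have "(\<Sum>k\<le>Suc n. (-1) ^ k * real (Suc n choose k) / (s + real k))
      = (\<Sum>k\<le>n. (-1) ^ k * real (n choose k) / (s + real k))
        - (\<Sum>k\<le>n. (-1) ^ k * real (n choose k) / (s + 1 + real k))"
    using alternating_binomial_Suc[of n "\<lambda>k. 1 / (s + real k)"] by (simp add: add.assoc)
  also have "\<dots> = fact n / pochhammer s (Suc n) - fact n / pochhammer (s + 1) (Suc n)"
    using Suc.IH[of s] Suc.IH[of "s + 1"] Suc.prems by simp
  also have "\<dots> = fact (Suc n) / pochhammer s (Suc (Suc n))"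
  proof -
    define Z where "Z = pochhammer (s + 1) n"
    have Z: "0 < Z" using Suc.prems by (simp add: Z_def pochhammer_pos)
    have eqs: "pochhammer s (Suc n) = s * Z" "pochhammer (s + 1) (Suc n) = Z * (s + 1 + n)"
      "pochhammer s (Suc (Suc n)) = s * Z * (s + 1 + n)"
      unfolding Z_def pochhammer_rec[of s] by (simp_all add: pochhammer_Suc)
    have "s + 1 + n > 0" using Suc.prems by simp
    then have "fact n / (s * Z) = fact n * (s + 1 + n) / (s * Z * (s + 1 + n))"
      "fact n / (Z * (s + 1 + n)) = fact n * s / (s * Z * (s + 1 + n))"
      using Suc.prems Z by simp_all
    then show ?thesis unfolding eqs by (simp add: diff_divide_distrib[symmetric] algebra_simps)
  qed
  finally show ?case .
qed simp

text \<open>Division by the linear factor leaves a polynomial of degree below \<open>n\<close>,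
  which the alternating sum annihilates, and the constant remainder \<open>Q(- s)\<close>, to which
  the partial fraction expansion applies.\<close>

lemma alternating_binomial_quotient:
  fixes Q :: "real poly"
  assumes "degree Q \<le> n" and s: "0 < s"
  shows "(\<Sum>k\<le>n. (-1) ^ k * real (n choose k) * poly Q (real k) / (s + real k))
     = fact n * poly Q (- s) / pochhammer s (Suc n)"
proof -
  define S where "S = synthetic_div Q (- s)"
  have Q: "Q = [:s, 1:] * S + [:poly Q (- s):]"
    using synthetic_div_correct'[of "- s" Q] by (simp add: S_def)
  have z: "(\<Sum>k\<le>n. (-1) ^ k * real (n choose k) * poly S (real k)) = 0"
  proof (cases "n = 0")
    case True
    then have "degree Q = 0" using assms by simp
    then have "S = 0" by (simp add: S_def synthetic_div_eq_0_iff)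
    then show ?thesis by simp
  next
    case False
    then show ?thesis using assms
      by (intro alternating_binomial_poly) (simp add: S_def degree_synthetic_div)
  qed
  have "(-1) ^ k * real (n choose k) * poly Q (real k) / (s + real k)
     = (-1) ^ k * real (n choose k) * poly S (real k)
       + poly Q (- s) * ((-1) ^ k * real (n choose k) / (s + real k))" for k
  proof -
    have "poly Q (real k) = (s + real k) * poly S (real k) + poly Q (- s)"
      by (subst Q) (simp add: algebra_simps)
    moreover have "s + real k \<noteq> 0" using s by (simp add: add_pos_nonneg less_imp_neq[symmetric])
    ultimately show ?thesis by (simp add: field_simps)
  qed
  then have "(\<Sum>k\<le>n. (-1) ^ k * real (n choose k) * poly Q (real k) / (s + real k))
     = (\<Sum>k\<le>n. (-1) ^ k * real (n choose k) * poly S (real k))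
       + poly Q (- s) * (\<Sum>k\<le>n. (-1) ^ k * real (n choose k) / (s + real k))"
    by (simp only: sum.distrib sum_distrib_left)
  then show ?thesis
    unfolding z alternating_binomial_inverse[OF s, of n] by simp
qed

section \<open>Rising factorials and the inverse of the Cauchy matrix\<close>

text \<open>For \<open>J = {..<n}\<close> this is the rising factorial of \<open>a + x\<close> as a
  polynomial in \<open>x\<close>; removing an index from \<open>J\<close> amounts to division by
  that factor.\<close>

definition poch_poly :: "real \<Rightarrow> nat set \<Rightarrow> real poly" where
  "poch_poly a J = (\<Prod>j\<in>J. [:a + real j, 1:])"

lemma poly_poch_poly: "poly (poch_poly a {..<n}) x = pochhammer (a + x) n"
  by (simp add: poch_poly_def poly_prod pochhammer_prod algebra_simps atLeast0LessThan)

lemma degree_poch_poly: "finite J \<Longrightarrow> degree (poch_poly a J) = card J"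
  unfolding poch_poly_def by (subst degree_prod_eq_sum_degree) auto

lemma poch_poly_remove:
  assumes "l < n" and "a + real l + x \<noteq> 0"
  shows "pochhammer (a + x) n / (a + real l + x) = poly (poch_poly a ({..<n} - {l})) x"
proof -
  have "poch_poly a {..<n} = [:a + real l, 1:] * poch_poly a ({..<n} - {l})"
    unfolding poch_poly_def using assms by (subst prod.remove[of _ l]) auto
  then have "pochhammer (a + x) n = (a + real l + x) * poly (poch_poly a ({..<n} - {l})) x"
    unfolding poly_poch_poly[symmetric] by (simp add: algebra_simps)
  then show ?thesis using assms by simp
qed

lemma poly_poch_poly_remove_self:
  assumes "l < n"
  shows "poly (poch_poly a ({..<n} - {l})) (- (a + real l)) = (-1) ^ l * fact l * fact (n - 1 - l)"
proof -
  have "poly (poch_poly a ({..<n} - {l})) (- (a + real l)) = (\<Prod>j\<in>{..<n} - {l}. real j - real l)"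
    by (simp add: poch_poly_def poly_prod)
  also have "\<dots> = (\<Prod>j\<in>{..<l} \<union> {Suc l..<n}. real j - real l)"
    using assms by (intro prod.cong) auto
  also have "(\<Prod>j\<in>{..<l} \<union> {Suc l..<n}. real j - real l)
     = (\<Prod>j<l. real j - real l) * (\<Prod>j\<in>{Suc l..<n}. real j - real l)"
    by (rule prod.union_disjoint) auto
  also have "(\<Prod>j<l. real j - real l) = (\<Prod>j<l. - real (Suc j))"
    by (rule prod.reindex_bij_witness[of _ "\<lambda>j. l - 1 - j" "\<lambda>j. l - 1 - j"]) auto
  also have "\<dots> = (-1) ^ l * fact l"
    by (simp only: prod_uminus card_lessThan fact_prod_Suc atLeast0LessThan of_nat_prod)
  also have "(\<Prod>j\<in>{Suc l..<n}. real j - real l) = (\<Prod>j<n - 1 - l. real (Suc j))"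
    by (rule prod.reindex_bij_witness[of _ "\<lambda>j. j + Suc l" "\<lambda>j. j - Suc l"]) auto
  also have "\<dots> = fact (n - 1 - l)" by (simp add: fact_prod_Suc atLeast0LessThan)
  finally show ?thesis .
qed

text \<open>Let \<open>c i\<close> be these numbers. The \<open>n\<close> by \<open>n\<close> Cauchy
  matrix with entries \<open>1 / (a + i + j)\<close> has the inverse with entries
  \<open>(-1) ^ (i + j) * c i * c j / (a + i + j)\<close>; the case \<open>a = 1\<close> is the
  Hilbert matrix.\<close>

definition cauchy_coeff :: "real \<Rightarrow> nat \<Rightarrow> nat \<Rightarrow> real" where
  "cauchy_coeff a n i = pochhammer (a + real i) n * real (n - 1 choose i) / fact (n - 1)"

lemma cauchy_coeff_pos: "0 < a \<Longrightarrow> i < n \<Longrightarrow> 0 < cauchy_coeff a n i"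
  by (auto simp: cauchy_coeff_def intro!: divide_pos_pos mult_pos_pos pochhammer_pos)

text \<open>The rising factorial in \<open>cauchy_coeff\<close> is divisible by
  \<open>a + i + l\<close>, which leaves a polynomial \<open>Q\<close> of degree
  \<open>n - 1\<close> in \<open>i\<close>. By \<open>alternating_binomial_quotient\<close> the sum
  is a multiple of \<open>Q\<close> at \<open>- (a + j)\<close>, where a factor of \<open>Q\<close>
  vanishes unless it is the removed one.\<close>

lemma cauchy_inverse:
  assumes a: "0 < a" and j: "j < n" and l: "l < n"
  shows "(\<Sum>i<n. (-1) ^ i * cauchy_coeff a n i / ((a + real i + real j) * (a + real i + real l)))
     = (if j = l then (-1) ^ l / cauchy_coeff a n l else 0)"
proof -
  define N where "N = n - 1"
  have n: "n = Suc N" using j by (simp add: N_def)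
  define Q where "Q = poch_poly a ({..<n} - {l})"
  have degQ: "degree Q = N" unfolding Q_def using l n by (subst degree_poch_poly) auto
  have *: "pochhammer (a + real i) n / (a + real i + real l) = poly Q (real i)" for i
    using poch_poly_remove[OF l, of a "real i"] a unfolding Q_def by (simp add: algebra_simps add_pos_nonneg)
  have sum_eq: "(\<Sum>i<n. (-1) ^ i * cauchy_coeff a n i / ((a + real i + real j) * (a + real i + real l)))
     = (\<Sum>i\<le>N. (-1) ^ i * real (N choose i) * poly Q (real i) / (a + real j + real i)) / fact N"
    unfolding sum_divide_distrib
    by (rule sum.cong) (auto simp: n lessThan_Suc_atMost cauchy_coeff_def *[unfolded n, symmetric] algebra_simps)
  also have "\<dots> = poly Q (- (a + real j)) / pochhammer (a + real j) n"
    using degQ a by (subst alternating_binomial_quotient) (auto simp: n)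
  also have "\<dots> = (if j = l then (-1) ^ l / cauchy_coeff a n l else 0)"
  proof (cases "j = l")
    case True
    have "real (N choose l) = fact N / (fact l * fact (N - l))"
      using l n by (simp add: binomial_fact)
    moreover have "poly Q (- (a + real l)) = (-1) ^ l * fact l * fact (N - l)"
      unfolding Q_def N_def using poly_poch_poly_remove_self[OF l] by simp
    moreover have "cauchy_coeff a n l = pochhammer (a + real l) n / (fact l * fact (N - l))"
      using calculation(1) by (simp add: cauchy_coeff_def n)
    ultimately show ?thesis using True by simp
  next
    case False
    have "poly Q (- (a + real j)) = 0"
      unfolding Q_def poch_poly_def poly_prod using j False by (intro prod_zero) (auto intro!: bexI[of _ j])
    then show ?thesis using False by simp
  qed
  finally show ?thesis .
qed

section \<open>Jacobi coefficients and their orthogonality\<close>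

text \<open>The coefficients, in powers of \<open>(1 - x) / 2\<close>, of the Jacobi polynomial of
  degree \<open>n\<close> with parameters \<open>a - 1\<close> and 0.\<close>

definition jac :: "real \<Rightarrow> nat \<Rightarrow> nat \<Rightarrow> real" where
  "jac a n k = (-1) ^ k * real (n choose k) * pochhammer (a + real k) n / fact n"

text \<open>Orthogonality to the lower powers: the denominator divides the rising factorial, and
  what remains has degree below \<open>n\<close> in \<open>k\<close>.\<close>

lemma jac_moment:
  assumes a: "0 < a" and l: "l < n"
  shows "(\<Sum>k\<le>n. jac a n k / (a + real (k + l))) = 0"
proof -
  define Q where "Q = poch_poly a ({..<n} - {l})"
  have "degree Q < n" unfolding Q_def using l by (subst degree_poch_poly) auto
  moreover have "pochhammer (a + real i) n / (a + real (i + l)) = poly Q (real i)" for i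
    using poch_poly_remove[OF l, of a "real i"] a unfolding Q_def by (simp add: algebra_simps add_pos_nonneg)
  then have "jac a n k / (a + real (k + l)) = (-1) ^ k * real (n choose k) * poly Q (real k) / fact n" for k
    by (simp add: jac_def mult_ac flip: \<open>\<And>i. _ = poly Q (real i)\<close>)
  ultimately show ?thesis
    using alternating_binomial_poly[of Q n] by (simp flip: sum_divide_distrib)
qed

text \<open>The squared norm up to the factor \<open>mass\<close>. For \<open>l = n\<close> the
  denominator is no longer a factor of the rising factorial, and the quotient formula leaves its
  value \<open>pochhammer (- n) n\<close>.\<close>

lemma jac_moment_self:
  assumes a: "0 < a"
  shows "jac a n n * (\<Sum>k\<le>n. jac a n k / (a + real (k + n))) = 1 / (a + 2 * real n)"
proof -
  have "(\<Sum>k\<le>n. jac a n k / (a + real (k + n)))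
     = (\<Sum>k\<le>n. (-1) ^ k * real (n choose k) * poly (poch_poly a {..<n}) (real k) / (a + real n + real k)) / fact n"
    unfolding sum_divide_distrib
    by (rule sum.cong) (auto simp: jac_def poly_poch_poly algebra_simps)
  also have "\<dots> = pochhammer (- real n) n / pochhammer (a + real n) (Suc n)"
    using a by (subst alternating_binomial_quotient) (auto simp: degree_poch_poly poly_poch_poly)
  also have "pochhammer (- real n) n = (-1) ^ n * fact n"
    by (simp add: pochhammer_minus pochhammer_fact)
  also have "pochhammer (a + real n) (Suc n) = pochhammer (a + real n) n * (a + 2 * real n)"
    by (simp add: pochhammer_Suc)
  finally have "jac a n n * (\<Sum>k\<le>n. jac a n k / (a + real (k + n)))
     = (-1) ^ n * (pochhammer (a + real n) n) / fact n * ((-1) ^ n * fact n / (pochhammer (a + real n) n * (a + 2 * real n)))"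
    by (simp add: jac_def)
  also have "\<dots> = 1 / (a + 2 * real n)"
  proof -
    have "pochhammer (a + real n) n \<noteq> 0" using a by (intro less_imp_neq[symmetric] pochhammer_pos) simp
    moreover have "(-1::real) ^ n * (-1) ^ n = 1" by (simp flip: power_mult_distrib)
    moreover have "e * X / f * (e * f / (X * Y)) = 1 / Y"
      if "e * e = 1" "X \<noteq> 0" "f \<noteq> 0" for e X f Y :: real
    proof -
      have "e * X / f * (e * f / (X * Y)) = (e * e) * (X / X) * (f / f) / Y" by simp
      then show ?thesis using that by simp
    qed
    ultimately show ?thesis by simp
  qed
  finally show ?thesis .
qed

text \<open>Growth \<open>4 ^ n\<close> in powers of \<open>(1 - x) / 2\<close> means
  \<open>2 ^ n\<close> in powers of \<open>x\<close>, as for a regular measure. Rounding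
  \<open>a\<close> up to an integer turns the rising factorial over \<open>fact n\<close> into a
  binomial coefficient.\<close>

lemma jac_top_bound:
  assumes a: "0 < a" and A: "a \<le> real A"
  shows "\<bar>jac a n n\<bar> \<le> 2 ^ A * 4 ^ n"
proof -
  have A1: "1 \<le> A" using a A by (metis One_nat_def Suc_leI gr0I not_le of_nat_0)
  have "\<bar>jac a n n\<bar> = pochhammer (a + real n) n / fact n"
    using a by (simp add: jac_def abs_mult pochhammer_nonneg)
  also have "pochhammer (a + real n) n \<le> pochhammer (real A + real n) n"
    unfolding pochhammer_prod using a A by (intro prod_mono) auto
  also have "pochhammer (real A + real n) n / fact n = real (A + 2 * n - 1 choose n)"
    using A1 by (simp add: binomial_gbinomial gbinomial_pochhammer' of_nat_diff algebra_simps)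
  also have "\<dots> \<le> real (2 ^ (A + 2 * n - 1))"
    by (intro of_nat_mono binomial_le_pow2)
  also have "\<dots> \<le> 2 ^ (A + 2 * n)" by simp
  also have "\<dots> = 2 ^ A * 4 ^ n" by (simp add: power_add power_mult)
  finally show ?thesis by (simp add: divide_right_mono)
qed

section \<open>The reference measure\<close>

definition edge_measure :: "real \<Rightarrow> real \<Rightarrow> real measure" where
  "edge_measure a c = density lborel (\<lambda>x. ennreal (c * (1 - x) powr (a - 1)) * indicator {-1<..<1} x)"

lemma nn_integral_edge:
  fixes g :: real
  assumes g: "0 < g"
  shows "(\<integral>\<^sup>+x. ennreal ((1 - x) powr (g - 1)) * indicator {-1<..<1} x \<partial>lborel) = ennreal (2 powr g / g)"
proof -
  have "((\<lambda>x. x powr (g - 1)) has_integral (2 powr g / g)) {0..2}"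
    using has_integral_powr_from_0[of "g - 1" 2] g by simp
  then have "ennreal (2 powr g / g) = (\<integral>\<^sup>+x. ennreal (x powr (g - 1)) * indicator {0..2} x \<partial>lborel)"
    by (subst nn_integral_has_integral_lebesgue') auto
  also have "\<dots> = (\<integral>\<^sup>+x. ennreal ((1 - x) powr (g - 1)) * indicator {0..2} (1 - x) \<partial>lborel)"
    by (subst nn_integral_real_affine[where c = "-1" and t = 1]) auto
  also have "\<dots> = (\<integral>\<^sup>+x. ennreal ((1 - x) powr (g - 1)) * indicator {-1<..<1} x \<partial>lborel)"
  proof (rule nn_integral_cong_AE)
    have "AE x in lborel. x \<noteq> 1 \<and> x \<noteq> (-1 :: real)"
      using AE_lborel_singleton[of 1] AE_lborel_singleton[of "-1"] by eventually_elim auto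
    then show "AE x in lborel. ennreal ((1 - x) powr (g - 1)) * indicator {0..2} (1 - x)
        = ennreal ((1 - x) powr (g - 1)) * indicator {-1<..<1} x"
      by eventually_elim (auto simp: indicator_def)
  qed
  finally show ?thesis ..
qed

locale edge =
  fixes a c :: real
  assumes a_pos: "0 < a" and c_pos: "0 < c"
begin

abbreviation N where "N \<equiv> edge_measure a c"

text \<open>The total mass is \<open>mass / a\<close>; \<open>mass\<close> is the common numerator
  of all moments of \<open>(1 - x) / 2\<close>.\<close>

definition mass :: real where "mass = 2 powr a * c"

lemma mass_pos: "0 < mass" using c_pos by (simp add: mass_def)

lemma nn_moment: "(\<integral>\<^sup>+x. ennreal (((1 - x) / 2) ^ i) \<partial>N) = ennreal (mass / (a + real i))"
proof -
  have "(\<integral>\<^sup>+x. ennreal (((1 - x) / 2) ^ i) \<partial>N)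
     = (\<integral>\<^sup>+x. ennreal (c * (1 - x) powr (a - 1)) * indicator {-1<..<1} x * ennreal (((1 - x) / 2) ^ i) \<partial>lborel)"
    unfolding edge_measure_def by (subst nn_integral_density) auto
  also have "\<dots> = (\<integral>\<^sup>+x. ennreal (c / 2 ^ i) * (ennreal ((1 - x) powr (a + real i - 1)) * indicator {-1<..<1} x) \<partial>lborel)"
  proof (rule nn_integral_cong)
    fix x :: real
    show "ennreal (c * (1 - x) powr (a - 1)) * indicator {-1<..<1} x * ennreal (((1 - x) / 2) ^ i)
       = ennreal (c / 2 ^ i) * (ennreal ((1 - x) powr (a + real i - 1)) * indicator {-1<..<1} x)"
    proof (cases "x \<in> {-1<..<1}")
      case True
      then have "(1 - x) powr (a + real i - 1) = (1 - x) powr (a - 1) * (1 - x) ^ i"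
        by (simp add: powr_realpow[symmetric] powr_add[symmetric] algebra_simps)
      then have "c * (1 - x) powr (a - 1) * ((1 - x) / 2) ^ i = c / 2 ^ i * (1 - x) powr (a + real i - 1)"
        by (simp add: power_divide)
      then have "ennreal (c * (1 - x) powr (a - 1)) * ennreal (((1 - x) / 2) ^ i)
          = ennreal (c / 2 ^ i) * ennreal ((1 - x) powr (a + real i - 1))"
        using True c_pos by (simp flip: ennreal_mult'')
      then show ?thesis using True by simp
    qed simp
  qed
  also have "\<dots> = ennreal (c / 2 ^ i) * ennreal (2 powr (a + real i) / (a + real i))"
    using a_pos by (simp add: nn_integral_cmult nn_integral_edge add_pos_nonneg)
  also have "\<dots> = ennreal (mass / (a + real i))"
    using a_pos c_pos by (simp add: mass_def powr_add powr_realpow flip: ennreal_mult'')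
  finally show ?thesis .
qed

sublocale interval_measure N
proof
  have "emeasure N (space N) = (\<integral>\<^sup>+x. ennreal (((1 - x) / 2) ^ 0) \<partial>N)" by simp
  also have "\<dots> < \<infinity>" unfolding nn_moment by simp
  finally have "finite_measure N" by (intro finite_measureI) simp
  moreover have "emeasure N (- {-1<..<1}) = 0"
    unfolding edge_measure_def by (subst emeasure_density) (auto simp: indicator_def nn_integral_0_iff_AE)
  ultimately show "finite_borel_measure_on {-1<..<1} N"
    by (simp add: finite_borel_measure_on_def edge_measure_def)
qed

lemma moment: "(LINT x|N. ((1 - x) / 2) ^ i) = mass / (a + real i)"
proof -
  have "(LINT x|N. ((1 - x) / 2) ^ i) = enn2real (\<integral>\<^sup>+x. ennreal (((1 - x) / 2) ^ i) \<partial>N)"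
  proof (rule integral_eq_nn_integral)
    show "AE x in N. 0 \<le> ((1 - x) / 2) ^ i" using AE_in by eventually_elim auto
    show "(\<lambda>x. ((1 - x) / 2) ^ i) \<in> borel_measurable N"
      by (intro borel_measurable_integrable integrable_continuous continuous_intros) auto
  qed
  then show ?thesis using mass_pos a_pos by (simp add: nn_moment add_pos_nonneg less_imp_le)
qed

definition edge_poly :: "real poly \<Rightarrow> real poly" where "edge_poly P = pcompose P [:1/2, -1/2:]"

lemma poly_edge_poly: "poly (edge_poly P) x = poly P ((1 - x) / 2)"
  by (simp add: edge_poly_def poly_pcompose diff_divide_distrib)

lemma degree_edge_poly: "degree (edge_poly P) = degree P"
  by (simp add: edge_poly_def degree_pcompose)

lemma edge_poly_surj: "\<exists>P'. P = edge_poly P'"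
proof
  have "pcompose [:1, -2:] [:1/2, -1/2:] = ([:0, 1:] :: real poly)" by (simp add: pcompose_pCons)
  then show "P = edge_poly (pcompose P [:1, -2:])"
    unfolding edge_poly_def by (simp add: pcompose_assoc[symmetric])
qed

lemma integral_edge_poly:
  "(LINT x|N. poly (edge_poly P) x * ((1 - x) / 2) ^ l) = mass * (\<Sum>k\<le>degree P. coeff P k / (a + real (k + l)))"
proof -
  have "(LINT x|N. poly (edge_poly P) x * ((1 - x) / 2) ^ l)
      = (LINT x|N. (\<Sum>k\<le>degree P. coeff P k * ((1 - x) / 2) ^ (k + l)))"
    by (simp add: poly_edge_poly poly_altdef[of P] sum_distrib_right power_add mult.assoc)
  also have "\<dots> = (\<Sum>k\<le>degree P. coeff P k * (LINT x|N. ((1 - x) / 2) ^ (k + l)))"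
    by (subst Bochner_Integration.integral_sum) (auto intro!: integrable_continuous continuous_intros)
  also have "\<dots> = mass * (\<Sum>k\<le>degree P. coeff P k / (a + real (k + l)))"
    unfolding moment by (simp add: sum_distrib_left mult_ac)
  finally show ?thesis .
qed

definition jacobi :: "nat \<Rightarrow> real poly" where
  "jacobi n = (\<Sum>k\<le>n. monom (jac a n k) k)"

lemma coeff_jacobi: "coeff (jacobi n) k = (if k \<le> n then jac a n k else 0)"
  by (simp add: jacobi_def coeff_sum sum.delta')

lemma jac_top_nz: "jac a n n \<noteq> 0"
  using a_pos by (simp add: jac_def less_imp_neq[symmetric] pochhammer_pos)

lemma degree_jacobi: "degree (jacobi n) = n"
  using jac_top_nz[of n] by (intro antisym degree_le le_degree) (auto simp: coeff_jacobi)

lemma integral_jacobi_power: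
  "(LINT x|N. poly (edge_poly (jacobi n)) x * ((1 - x) / 2) ^ l)
     = mass * (\<Sum>k\<le>n. jac a n k / (a + real (k + l)))"
  unfolding integral_edge_poly degree_jacobi by (simp add: coeff_jacobi cong: sum.cong_simp)

lemma integral_jacobi_jacobi:
  assumes "m \<le> n"
  shows "(LINT x|N. poly (edge_poly (jacobi n)) x * poly (edge_poly (jacobi m)) x)
     = (if n = m then mass / (a + 2 * real n) else 0)"
proof -
  have "(LINT x|N. poly (edge_poly (jacobi n)) x * poly (edge_poly (jacobi m)) x)
     = (LINT x|N. (\<Sum>l\<le>m. jac a m l * (poly (edge_poly (jacobi n)) x * ((1 - x) / 2) ^ l)))"
    unfolding poly_edge_poly[of "jacobi m"] poly_altdef[of "jacobi m"] degree_jacobi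
    by (simp add: coeff_jacobi sum_distrib_left mult_ac cong: sum.cong_simp)
  also have "\<dots> = (\<Sum>l\<le>m. jac a m l * (LINT x|N. poly (edge_poly (jacobi n)) x * ((1 - x) / 2) ^ l))"
    by (subst Bochner_Integration.integral_sum) (auto intro!: integrable_continuous continuous_intros)
  also have "\<dots> = (\<Sum>l\<le>m. if l = n then mass * (jac a n n * (\<Sum>k\<le>n. jac a n k / (a + real (k + n)))) else 0)"
    unfolding integral_jacobi_power using assms a_pos
    by (intro sum.cong) (auto simp: jac_moment simp del: of_nat_add)
  also have "\<dots> = (if n = m then mass / (a + 2 * real n) else 0)"
    unfolding jac_moment_self[OF a_pos] using assms by (simp add: sum.delta)
  finally show ?thesis .
qed

definition q :: "nat \<Rightarrow> real poly" where
  "q n = smult (sqrt ((a + 2 * real n) / mass)) (edge_poly (jacobi n))"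

sublocale orthonormal_system N q
proof
  show "degree (q n) = n" for n
    using a_pos mass_pos by (simp add: q_def degree_edge_poly degree_jacobi)
  have *: "(LINT x|N. poly (q n) x * poly (q m) x) = (if n = m then 1 else 0)" if "m \<le> n" for n m
  proof -
    have "(LINT x|N. poly (q n) x * poly (q m) x)
      = (LINT x|N. sqrt ((a + 2 * real n) / mass) * sqrt ((a + 2 * real m) / mass)
           * (poly (edge_poly (jacobi n)) x * poly (edge_poly (jacobi m)) x))"
      by (simp add: q_def mult_ac)
    also have "\<dots> = sqrt ((a + 2 * real n) / mass) * sqrt ((a + 2 * real m) / mass)
       * (if n = m then mass / (a + 2 * real n) else 0)"
      by (simp only: integral_mult_right_zero integral_jacobi_jacobi[OF that])
    also have "\<dots> = (if n = m then 1 else 0)"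
    proof -
      have "0 < a + 2 * real n" using a_pos by simp
      then have "sqrt ((a + 2 * real n) / mass) * sqrt ((a + 2 * real n) / mass) * (mass / (a + 2 * real n)) = 1"
        using mass_pos by (subst real_sqrt_mult_self) simp
      then show ?thesis by (cases "n = m") (simp_all only: refl if_True if_False mult_zero_right)
    qed
    finally show ?thesis .
  qed
  show "(LINT x|N. poly (q n) x * poly (q m) x) = (if n = m then 1 else 0)" for n m
    using *[of m n] *[of n m] by (cases "m \<le> n") (auto simp: mult.commute)
qed

lemma lead_coeff_q_bound:
  assumes "0 < \<delta>"
  shows "\<exists>C. \<forall>n. \<bar>lead_coeff (q n)\<bar> \<le> exp (C + \<delta> * n) * 2 ^ n"
proof -
  obtain A where A: "a \<le> real A" using real_arch_simple by blast
  \<comment> \<open>Chosen so that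
    \<open>1 + (a + 2 * n) / mass \<le> B * (1 + \<delta> * n)\<close>, whose right-hand side is at
    most \<open>B * exp (\<delta> * n)\<close>.\<close>
  define B where "B = 1 + a / mass + 2 / (mass * \<delta>)"
  have B: "0 < B" using a_pos mass_pos assms by (simp add: B_def add_pos_pos)
  have "\<bar>lead_coeff (q n)\<bar> \<le> exp (ln (B * 2 ^ A) + \<delta> * n) * 2 ^ n" for n
  proof -
    have "lead_coeff (edge_poly (jacobi n)) = jac a n n * (- 1 / 2) ^ n"
      unfolding edge_poly_def by (subst lead_coeff_comp) (simp_all add: degree_jacobi coeff_jacobi)
    then have "\<bar>lead_coeff (q n)\<bar> = sqrt ((a + 2 * real n) / mass) * (\<bar>jac a n n\<bar> * (1 / 2) ^ n)"
      using a_pos mass_pos by (simp add: q_def abs_mult power_abs)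
    also have "\<dots> \<le> (B * exp (\<delta> * n)) * (2 ^ A * 4 ^ n * (1 / 2) ^ n)"
    proof (intro mult_mono jac_top_bound a_pos A)
      define y where "y = (a + 2 * real n) / mass"
      have y: "0 \<le> y" using a_pos mass_pos by (simp add: y_def)
      have "sqrt y \<le> 1 + y"
        using y by (intro real_le_lsqrt) (auto simp: power2_eq_square algebra_simps)
      also have "1 + y = 1 + a / mass + 2 / (mass * \<delta>) * (\<delta> * n)"
      proof -
        have "2 / (mass * \<delta>) * (\<delta> * n) = 2 * real n / mass" using assms by simp
        then show ?thesis by (simp only: y_def add_divide_distrib)
      qed
      also have "\<dots> \<le> B * (1 + \<delta> * n)"
      proof -
        have "B * (1 + \<delta> * n) = 1 + a / mass + 2 / (mass * \<delta>) * (\<delta> * n) + (2 / (mass * \<delta>) + (1 + a / mass) * (\<delta> * n))"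
        proof -
          have "(1 + u + v) * (1 + w) = 1 + u + v * w + (v + (1 + u) * w)" for u v w :: real
            by (simp add: algebra_simps)
          then show ?thesis unfolding B_def .
        qed
        moreover have "0 \<le> 2 / (mass * \<delta>) + (1 + a / mass) * (\<delta> * n)"
          using a_pos mass_pos assms by (intro add_nonneg_nonneg mult_nonneg_nonneg divide_nonneg_nonneg) auto
        ultimately show ?thesis by linarith
      qed
      also have "\<dots> \<le> B * exp (\<delta> * n)" using B by (intro mult_left_mono exp_ge_add_one_self) auto
      finally show "sqrt ((a + 2 * real n) / mass) \<le> B * exp (\<delta> * n)" by (simp add: y_def)
    qed (use B in auto)
    also have "\<dots> = exp (ln (B * 2 ^ A) + \<delta> * n) * 2 ^ n"
    proof -
      have "(4::real) ^ n * (1 / 2) ^ n = 2 ^ n" by (simp flip: power_mult_distrib)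
      then show ?thesis using B by (simp add: exp_add mult_ac)
    qed
    finally show ?thesis .
  qed
  then show ?thesis by blast
qed

section \<open>Closed form of the reference kernel\<close>

text \<open>The inverse moment matrix applied to the vector of powers of \<open>s\<close>, as a
  polynomial in \<open>(1 - y) / 2\<close>.\<close>

definition edge_kernel_poly :: "nat \<Rightarrow> real \<Rightarrow> real poly" where
  "edge_kernel_poly n s = (\<Sum>j<n. monom ((\<Sum>i<n. (-1) ^ (i + j) * cauchy_coeff a n i * cauchy_coeff a n j
      / (a + real i + real j) * s ^ i) / mass) j)"

text \<open>Integration against the powers multiplies the coefficient vector by the moment matrix,
  which \<open>cauchy_inverse\<close> undoes.\<close>

lemma reproducing_edge_power:
  assumes "l < n"
  shows "(LINT y|N. poly (edge_poly (edge_kernel_poly n s)) y * ((1 - y) / 2) ^ l) = s ^ l"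
proof -
  let ?c = "cauchy_coeff a n"
  have deg: "degree (edge_kernel_poly n s) \<le> n - 1"
    unfolding edge_kernel_poly_def by (intro degree_sum_le) (auto intro: order_trans[OF degree_monom_le])
  have coeff: "coeff (edge_kernel_poly n s) j = (if j < n then (\<Sum>i<n. (-1) ^ (i + j) * ?c i * ?c j
      / (a + real i + real j) * s ^ i) / mass else 0)" for j
    by (simp add: edge_kernel_poly_def coeff_sum sum.delta')
  have "(LINT y|N. poly (edge_poly (edge_kernel_poly n s)) y * ((1 - y) / 2) ^ l)
     = mass * (\<Sum>j\<le>degree (edge_kernel_poly n s). coeff (edge_kernel_poly n s) j / (a + real (j + l)))"
    by (rule integral_edge_poly)
  also have "(\<Sum>j\<le>degree (edge_kernel_poly n s). coeff (edge_kernel_poly n s) j / (a + real (j + l)))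
     = (\<Sum>j<n. coeff (edge_kernel_poly n s) j / (a + real (j + l)))"
    using deg assms by (intro sum.mono_neutral_left) (auto simp: coeff_eq_0 not_le)
  also have "mass * \<dots> = (\<Sum>j<n. \<Sum>i<n. (-1) ^ i * ?c i * s ^ i * ((-1) ^ j * ?c j / ((a + real j + real i) * (a + real j + real l))))"
    unfolding sum_distrib_left
  proof (intro sum.cong refl)
    fix j assume "j \<in> {..<n}"
    then have "mass * (coeff (edge_kernel_poly n s) j / (a + real (j + l)))
       = (\<Sum>i<n. (-1) ^ (i + j) * ?c i * ?c j / (a + real i + real j) * s ^ i) / (a + real j + real l)"
      using mass_pos by (simp add: coeff add.assoc)
    also have "\<dots> = (\<Sum>i<n. (-1) ^ i * ?c i * s ^ i * ((-1) ^ j * ?c j / ((a + real j + real i) * (a + real j + real l))))"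
      unfolding sum_divide_distrib
    proof (intro sum.cong refl)
      fix i
      have "a + real i + real j = a + real j + real i" by simp
      then show "(-1) ^ (i + j) * ?c i * ?c j / (a + real i + real j) * s ^ i / (a + real j + real l)
         = (-1) ^ i * ?c i * s ^ i * ((-1) ^ j * ?c j / ((a + real j + real i) * (a + real j + real l)))"
        by (simp only:) (simp add: power_add)
    qed
    finally show "mass * (coeff (edge_kernel_poly n s) j / (a + real (j + l)))
      = (\<Sum>i<n. (-1) ^ i * ?c i * s ^ i * ((-1) ^ j * ?c j / ((a + real j + real i) * (a + real j + real l))))" .
  qed
  also have "\<dots> = (\<Sum>i<n. (-1) ^ i * ?c i * s ^ i * (\<Sum>j<n. (-1) ^ j * ?c j / ((a + real j + real i) * (a + real j + real l))))"
    by (subst sum.swap) (simp add: sum_distrib_left)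
  also have "\<dots> = (\<Sum>i<n. if i = l then (-1) ^ l * ?c l * s ^ l * ((-1) ^ l / ?c l) else 0)"
    using cauchy_inverse[OF a_pos _ assms] by (intro sum.cong) auto
  also have "\<dots> = s ^ l"
  proof -
    have "?c l \<noteq> 0" using cauchy_coeff_pos[OF a_pos assms] by simp
    moreover have "(-1::real) ^ l * (-1) ^ l = 1" by (simp flip: power_mult_distrib)
    ultimately have "(-1) ^ l * ?c l * s ^ l * ((-1) ^ l / ?c l) = s ^ l"
      by (simp add: field_simps)
    then show ?thesis using assms by (simp add: sum.delta)
  qed
  finally show ?thesis .
qed

theorem edge_kernel_formula:
  "K n x y = (\<Sum>i<n. \<Sum>j<n. (-1) ^ (i + j) * cauchy_coeff a n i * cauchy_coeff a n j / (a + real i + real j)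
      * ((1 - x) / 2) ^ i * ((1 - y) / 2) ^ j) / mass"
proof (cases "n = 0")
  case True
  then show ?thesis by (simp add: reproducing_kernel_def)
next
  case False
  define G where "G = edge_poly (edge_kernel_poly n ((1 - x) / 2))"
  have degG: "degree G < n"
    unfolding G_def degree_edge_poly edge_kernel_poly_def using False
    by (intro degree_sum_less) (auto intro: le_less_trans[OF degree_monom_le])
  have rep: "(LINT t|N. poly G t * poly P t) = poly P x" if P: "degree P < n" for P
  proof -
    obtain P' where P': "P = edge_poly P'" using edge_poly_surj by blast
    have deg: "degree P' < n" using P by (simp add: P' degree_edge_poly)
    have "(LINT t|N. poly G t * poly P t)
      = (LINT t|N. (\<Sum>l\<le>degree P'. coeff P' l * (poly G t * ((1 - t) / 2) ^ l)))"
      by (simp add: P' poly_edge_poly[of P'] poly_altdef[of P'] sum_distrib_left mult_ac)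
    also have "\<dots> = (\<Sum>l\<le>degree P'. coeff P' l * (LINT t|N. poly G t * ((1 - t) / 2) ^ l))"
      by (subst Bochner_Integration.integral_sum) (auto intro!: integrable_continuous continuous_intros)
    also have "\<dots> = (\<Sum>l\<le>degree P'. coeff P' l * ((1 - x) / 2) ^ l)"
      unfolding G_def using deg by (intro sum.cong refl) (simp add: reproducing_edge_power)
    also have "\<dots> = poly P x" by (simp add: P' poly_edge_poly[of P'] poly_altdef[of P'])
    finally show ?thesis .
  qed
  \<comment> \<open>The pairing of \<open>G\<close> with the kernel at \<open>y\<close> is evaluated
    twice, by the reproducing property of \<open>G\<close> and by that of the kernel.\<close>
  have "K n x y = poly (kernel_poly n y) x" by (simp add: K_sym)
  also have "\<dots> = (LINT t|N. poly G t * K n y t)"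
    using rep[OF degree_kernel_poly, of y] False by simp
  also have "\<dots> = poly G y" by (rule reproducing[OF degG])
  also have "\<dots> = (\<Sum>j<n. \<Sum>i<n. (-1) ^ (i + j) * cauchy_coeff a n i * cauchy_coeff a n j / (a + real i + real j)
      * ((1 - x) / 2) ^ i * ((1 - y) / 2) ^ j) / mass"
    unfolding G_def poly_edge_poly edge_kernel_poly_def
    by (simp add: poly_sum poly_monom sum_divide_distrib sum_distrib_right)
  finally show ?thesis by (subst sum.swap)
qed

end

section \<open>Hard edge asymptotics of the reference kernel\<close>

lemma tannery_uniform_bound:
  fixes f :: "'a \<Rightarrow> nat \<Rightarrow> real"
  assumes "\<And>k. ((\<lambda>n. f n k) \<longlongrightarrow> b k) F" and "eventually (\<lambda>n. \<forall>k. \<bar>f n k\<bar> \<le> B k) F"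
    and "summable B" and "F \<noteq> bot"
  shows "((\<lambda>n. \<Sum>k. f n k) \<longlongrightarrow> (\<Sum>k. b k)) F"
proof -
  have "eventually (\<lambda>(k, n). norm (f n k) \<le> B k) (at_top \<times>\<^sub>F F)"
    unfolding eventually_prod_filter using assms(2)
    by (intro exI[of _ "\<lambda>_. True"] exI[of _ "\<lambda>n. \<forall>k. \<bar>f n k\<bar> \<le> B k"]) auto
  with tannerys_theorem[where a = "\<lambda>k n. f n k" and b = b and M = B and F = F] assms
  show ?thesis by auto
qed

text \<open>The reference kernel and its limit are both values of this form, at different sequences,
  so the asymptotics reduce to the convergence of these sequences.\<close>

definition cauchy_form :: "real \<Rightarrow> (nat \<Rightarrow> real) \<Rightarrow> (nat \<Rightarrow> real) \<Rightarrow> real" where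
  "cauchy_form a x y = (\<Sum>i. x i * (\<Sum>j. y j / (a + real i + real j)))"

lemma abs_div_le:
  assumes "0 < a" and "\<bar>y\<bar> \<le> (D::real)"
  shows "\<bar>y / (a + real i + real j)\<bar> \<le> D / a"
proof -
  have "\<bar>y / (a + real i + real j)\<bar> = \<bar>y\<bar> / (a + real i + real j)"
    using assms by (simp add: abs_divide)
  also have "\<dots> \<le> D / a" using assms by (intro frac_le) auto
  finally show ?thesis .
qed

text \<open>Tannery's theorem for the inner and then for the outer series. Since
  \<open>a + i + j\<close> is at least \<open>a\<close>, the inner series are bounded uniformly in
  \<open>i\<close>, and one summable majorant for each sequence is enough.\<close>

lemma cauchy_form_tendsto:
  assumes a: "0 < a"
    and X: "\<And>i. (\<lambda>n. X n i) \<longlonglongrightarrow> x i" and Y: "\<And>j. (\<lambda>n. Y n j) \<longlonglongrightarrow> y j"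
    and BX: "eventually (\<lambda>n. \<forall>i. \<bar>X n i\<bar> \<le> D i) sequentially"
    and BY: "eventually (\<lambda>n. \<forall>i. \<bar>Y n i\<bar> \<le> D' i) sequentially"
    and D: "summable D" "summable D'"
  shows "(\<lambda>n. cauchy_form a (X n) (Y n)) \<longlonglongrightarrow> cauchy_form a x y"
  unfolding cauchy_form_def
proof (rule tannery_uniform_bound[where B = "\<lambda>i. D i * (\<Sum>j. D' j / a)"])
  have sD: "summable (\<lambda>j. D' j / a)" using D(2) by (rule summable_divide)
  show "(\<lambda>n. X n i * (\<Sum>j. Y n j / (a + real i + real j))) \<longlonglongrightarrow> x i * (\<Sum>j. y j / (a + real i + real j))" for i
  proof (intro tendsto_mult X, rule tannery_uniform_bound[where B = "\<lambda>j. D' j / a"])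
    show "(\<lambda>n. Y n j / (a + real i + real j)) \<longlonglongrightarrow> y j / (a + real i + real j)" for j
      using a by (intro tendsto_divide Y tendsto_const) auto
    show "eventually (\<lambda>n. \<forall>j. \<bar>Y n j / (a + real i + real j)\<bar> \<le> D' j / a) sequentially"
      using BY by eventually_elim (intro allI abs_div_le[OF a], blast)
  qed (use sD in auto)
  show "eventually (\<lambda>n. \<forall>i. \<bar>X n i * (\<Sum>j. Y n j / (a + real i + real j))\<bar> \<le> D i * (\<Sum>j. D' j / a)) sequentially"
    using BX BY
  proof eventually_elim
    case (elim n)
    show ?case
    proof
      fix i
      have le: "\<bar>Y n j / (a + real i + real j)\<bar> \<le> D' j / a" for j
        using elim(2) a by (intro abs_div_le) auto
      have "\<bar>\<Sum>j. Y n j / (a + real i + real j)\<bar> \<le> (\<Sum>j. D' j / a)"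
      proof -
        have s: "summable (\<lambda>j. \<bar>Y n j / (a + real i + real j)\<bar>)"
          by (rule summable_comparison_test'[OF sD, of 0]) (use le in auto)
        have "\<bar>\<Sum>j. Y n j / (a + real i + real j)\<bar> \<le> (\<Sum>j. \<bar>Y n j / (a + real i + real j)\<bar>)"
          by (rule summable_rabs[OF s])
        also have "\<dots> \<le> (\<Sum>j. D' j / a)" by (rule suminf_le[OF le s sD])
        finally show ?thesis .
      qed
      moreover have "\<bar>X n i\<bar> \<le> D i" using elim(1) by auto
      ultimately show "\<bar>X n i * (\<Sum>j. Y n j / (a + real i + real j))\<bar> \<le> D i * (\<Sum>j. D' j / a)"
        unfolding abs_mult by (intro mult_mono) auto
    qed
  qed
  show "summable (\<lambda>i. D i * (\<Sum>j. D' j / a))" using D(1) by (rule summable_mult2)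
qed simp

section \<open>Limits and majorants of the rescaled Cauchy coefficients\<close>

text \<open>The reciprocal of the Gauss product for \<open>Gamma (a + i)\<close>.\<close>

definition pochhammer_ratio :: "real \<Rightarrow> nat \<Rightarrow> nat \<Rightarrow> real" where
  "pochhammer_ratio a m i = pochhammer (a + real i) m / (fact (m - 1) * real m powr (a + real i))"

text \<open>This is \<open>cauchy_coeff a m i\<close> over \<open>m powr (a + 2 * i)\<close>: the
  part \<open>2 * i\<close> matches the distance of order \<open>1 / m ^ 2\<close> to the endpoint,
  and \<open>a\<close> is half of the growth exponent \<open>2 * a\<close> of the kernel.\<close>

definition scaled_coeff :: "real \<Rightarrow> nat \<Rightarrow> nat \<Rightarrow> real" where
  "scaled_coeff a m i = pochhammer_ratio a m i * (real (m - 1 choose i) / real m ^ i)"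

text \<open>The base bounds the quotient of consecutive values of \<open>pochhammer_ratio\<close>;
  the factorial comes from the binomial coefficient.\<close>

definition exp_term :: "real \<Rightarrow> nat \<Rightarrow> real" where
  "exp_term a i = ((a + 2) / a) ^ i / fact i"

text \<open>For \<open>a = \<alpha> + 1\<close> these are, up to sign, the Taylor coefficients of
  \<open>J_\<alpha>(2 sqrt z)\<close> over \<open>z powr (\<alpha> / 2)\<close>.\<close>

definition bessel_coeff :: "real \<Rightarrow> nat \<Rightarrow> real" where
  "bessel_coeff a i = 1 / (fact i * Gamma (a + real i))"

lemma pochhammer_ratio_tendsto:
  assumes a: "0 < a"
  shows "(\<lambda>m. pochhammer_ratio a m i) \<longlonglongrightarrow> 1 / Gamma (a + real i)"
proof -
  have "(\<lambda>m. inverse (Gamma_series' (a + real i) m)) \<longlonglongrightarrow> inverse (Gamma (a + real i))"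
    using a by (intro tendsto_inverse Gamma_series'_LIMSEQ less_imp_neq[symmetric] Gamma_real_pos) auto
  moreover have "eventually (\<lambda>m. inverse (Gamma_series' (a + real i) m) = pochhammer_ratio a m i) sequentially"
    using eventually_gt_at_top[of 0]
    by eventually_elim (simp add: Gamma_series'_def pochhammer_ratio_def powr_def)
  ultimately show ?thesis by (simp add: tendsto_cong inverse_eq_divide)
qed

text \<open>The quotient of consecutive terms is \<open>(a + i + m) / ((a + i) * m)\<close>, which
  is bounded for \<open>i \<le> m\<close>. Beyond this range the binomial factor of
  \<open>scaled_coeff\<close> vanishes.\<close>

lemma pochhammer_ratio_bound:
  assumes a: "0 < a" and m: "0 < m" and i: "i \<le> m"
  shows "pochhammer_ratio a m i \<le> pochhammer_ratio a m 0 * ((a + 2) / a) ^ i"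
  using i
proof (induction i)
  case (Suc i)
  have pos: "0 \<le> pochhammer_ratio a m k" for k
    using a by (simp add: pochhammer_ratio_def pochhammer_nonneg)
  have "(a + real i) * pochhammer (a + real i + 1) m = pochhammer (a + real i) m * (a + real i + real m)"
    using pochhammer_rec[of "a + real i" m] pochhammer_Suc[of "a + real i" m] by simp
  then have "pochhammer (a + real (Suc i)) m = pochhammer (a + real i) m * (a + real i + real m) / (a + real i)"
    using a by (simp add: field_simps add_pos_nonneg)
  moreover have "real m powr (a + real (Suc i)) = real m powr (a + real i) * real m"
    using m by (simp add: powr_add add.assoc[symmetric])
  ultimately have "pochhammer_ratio a m (Suc i)
     = pochhammer_ratio a m i * ((a + real i + real m) / ((a + real i) * real m))"
    by (simp add: pochhammer_ratio_def mult_ac)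
  also have "\<dots> \<le> pochhammer_ratio a m i * ((a + 2) / a)"
  proof (intro mult_left_mono pos)
    have "a * (a + real i + real m) \<le> a * ((a + 2) * real m)"
    proof (intro mult_left_mono)
      have "a * 1 \<le> a * real m" using a m by (intro mult_left_mono) auto
      then show "a + real i + real m \<le> (a + 2) * real m" using Suc.prems by (simp add: algebra_simps)
    qed (use a in auto)
    also have "\<dots> \<le> (a + real i) * ((a + 2) * real m)" using a by (intro mult_right_mono) auto
    finally show "(a + real i + real m) / ((a + real i) * real m) \<le> (a + 2) / a"
      using a m by (simp add: divide_le_eq le_divide_eq mult_ac add_pos_nonneg)
  qed
  also have "\<dots> \<le> pochhammer_ratio a m 0 * ((a + 2) / a) ^ i * ((a + 2) / a)"
    using Suc a by (intro mult_right_mono) auto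
  finally show ?case by (simp add: mult_ac)
qed simp

lemma binomial_ratio_tendsto: "(\<lambda>m. real (m - 1 choose i) / real m ^ i) \<longlonglongrightarrow> 1 / fact i"
proof (induction i)
  case 0
  then show ?case by simp
next
  case (Suc i)
  have "(\<lambda>m. (real (m - 1 choose i) / real m ^ i) * ((1 - (1 + real i) / real m) / (1 + real i)))
     \<longlonglongrightarrow> 1 / fact i * ((1 - 0) / (1 + real i))"
    by (intro tendsto_mult Suc tendsto_divide tendsto_diff tendsto_const lim_const_over_n) auto
  moreover have "eventually (\<lambda>m. (real (m - 1 choose i) / real m ^ i) * ((1 - (1 + real i) / real m) / (1 + real i))
     = real (m - 1 choose Suc i) / real m ^ Suc i) sequentially"
    using eventually_gt_at_top[of "Suc i"]
  proof eventually_elim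
    case (elim m)
    have "Suc i * (m - 1 choose Suc i) = (m - 1 - i) * (m - 1 choose i)"
      by (metis binomial_absorb_comp binomial_absorption mult.commute)
    then have "real (Suc i) * real (m - 1 choose Suc i) = real (m - 1 - i) * real (m - 1 choose i)"
      by (metis of_nat_mult)
    moreover have "real (m - 1 - i) = real m - 1 - real i" using elim by simp
    ultimately have "real (m - 1 choose Suc i) = (real m - 1 - real i) * real (m - 1 choose i) / (1 + real i)"
      by (simp add: field_simps)
    moreover have "1 - (1 + real i) / real m = (real m - 1 - real i) / real m"
      using elim by (simp add: field_simps)
    ultimately show ?case by (simp add: mult_ac)
  qed
  ultimately show ?case by (simp add: tendsto_cong mult_ac)
qed

lemma cauchy_coeff_scaled:
  assumes "0 < m"
  shows "cauchy_coeff a m i * (- (u / (real m)\<^sup>2)) ^ i / real m powr a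
     = scaled_coeff a m i * (- u) ^ i"
proof -
  have "(- (u / (real m)\<^sup>2)) ^ i = (- u) ^ i / (real m ^ i * real m ^ i)"
  proof -
    have "- (u / (real m)\<^sup>2) = (- u) / (real m * real m)" by (simp add: power2_eq_square)
    then show ?thesis by (simp only: power_divide power_mult_distrib)
  qed
  moreover have "real m powr (a + real i) = real m powr a * real m ^ i"
    using assms by (simp add: powr_add powr_realpow)
  ultimately show ?thesis by (simp add: cauchy_coeff_def pochhammer_ratio_def scaled_coeff_def)
qed

text \<open>Tannery's theorem demands a majorant uniform in \<open>m\<close>. The constant
  \<open>E\<close> bounds the sequence at \<open>i = 0\<close>, which converges; the growth in
  \<open>i\<close> is that of an exponential series.\<close>

lemma cauchy_coeff_dominated:
  assumes a: "0 < a"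
  obtains E where "0 \<le> E" and "\<And>m i. 0 < m \<Longrightarrow>
    \<bar>scaled_coeff a m i\<bar> \<le> E * exp_term a i"
proof -
  have "Bseq (\<lambda>m. pochhammer_ratio a m 0)"
    using pochhammer_ratio_tendsto[OF a, of 0] by (intro convergent_imp_Bseq convergentI)
  then obtain E where E: "0 < E" "\<And>m. \<bar>pochhammer_ratio a m 0\<bar> \<le> E" by (auto elim: BseqE)
  have "\<bar>scaled_coeff a m i\<bar> \<le> E * exp_term a i"
    if m: "0 < m" for m i
  proof (cases "i \<le> m")
    case True
    have pos: "0 \<le> pochhammer_ratio a m i"
      using a by (simp add: pochhammer_ratio_def pochhammer_nonneg)
    have "pochhammer_ratio a m i \<le> pochhammer_ratio a m 0 * ((a + 2) / a) ^ i"
      by (rule pochhammer_ratio_bound[OF a m True])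
    also have "\<dots> \<le> E * ((a + 2) / a) ^ i" using E(2)[of m] a by (intro mult_right_mono) auto
    finally have 1: "pochhammer_ratio a m i \<le> E * ((a + 2) / a) ^ i" .
    have "real (m - 1 choose i) * fact i \<le> real (m - 1) ^ i"
    proof -
      have "real ((m - 1 choose i) * fact i) \<le> real ((m - 1) ^ i)"
        by (intro of_nat_mono binomial_fact_pow)
      then show ?thesis by simp
    qed
    also have "\<dots> \<le> real m ^ i" by (intro power_mono) auto
    finally have 2: "real (m - 1 choose i) / real m ^ i \<le> 1 / fact i"
      using m by (simp add: field_simps)
    have "scaled_coeff a m i \<le> E * ((a + 2) / a) ^ i * (1 / fact i)"
      unfolding scaled_coeff_def using 1 2 pos E(1) a by (intro mult_mono) auto
    then show ?thesis using pos by (simp add: abs_mult scaled_coeff_def exp_term_def)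
  next
    case False
    then have "real (m - 1 choose i) = 0" by (subst of_nat_eq_0_iff) (intro binomial_eq_0, auto)
    then show ?thesis
      using E(1) a unfolding scaled_coeff_def exp_term_def by (simp only:) simp
  qed
  then show ?thesis using that[of E] E(1) by simp
qed

lemma bessel_coeff_limit:
  assumes a: "0 < a"
  shows "(\<lambda>m. scaled_coeff a m i) \<longlonglongrightarrow> bessel_coeff a i"
  using tendsto_mult[OF pochhammer_ratio_tendsto[OF a] binomial_ratio_tendsto]
  by (simp add: bessel_coeff_def scaled_coeff_def mult.commute)

lemma bessel_coeff_bound:
  assumes a: "0 < a"
  obtains E where "0 \<le> E" and "\<And>i. \<bar>bessel_coeff a i\<bar> \<le> E * exp_term a i"
proof -
  obtain E where E: "0 \<le> E" "\<And>m i. 0 < m \<Longrightarrow>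
    \<bar>scaled_coeff a m i\<bar> \<le> E * exp_term a i"
    using cauchy_coeff_dominated[OF a] by blast
  have "\<bar>bessel_coeff a i\<bar> \<le> E * exp_term a i" for i
    using E(2)[of _ i]
    by (intro LIMSEQ_le_const2[OF tendsto_rabs[OF bessel_coeff_limit[OF a, of i]]]) (auto intro!: exI[of _ 1])
  then show ?thesis using that E(1) by blast
qed

lemma summable_exp_term: "summable (\<lambda>i. E * exp_term a i * B ^ i)"
proof -
  have "summable (\<lambda>i. E * (inverse (fact i) * ((a + 2) / a * B) ^ i))"
    by (intro summable_mult summable_exp)
  then show ?thesis unfolding exp_term_def power_mult_distrib by (simp add: divide_inverse mult_ac)
qed

definition bessel_series :: "real \<Rightarrow> real \<Rightarrow> nat \<Rightarrow> real" where
  "bessel_series a u i = bessel_coeff a i * (- u) ^ i"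

definition bessel_form :: "real \<Rightarrow> real \<Rightarrow> real \<Rightarrow> real" where
  "bessel_form a u v = cauchy_form a (bessel_series a u) (bessel_series a v)"

lemma bounded_power_mult:
  fixes c :: "nat \<Rightarrow> real"
  assumes "\<bar>c i\<bar> \<le> C" and "\<bar>u\<bar> \<le> B"
  shows "\<bar>c i * (- u) ^ i\<bar> \<le> C * B ^ i"
  unfolding abs_mult power_abs abs_minus_cancel using assms
  by (intro mult_mono power_mono) auto

lemma bessel_form_tendsto:
  assumes a: "0 < a" and u: "u \<longlonglongrightarrow> u0" and v: "v \<longlonglongrightarrow> v0"
  shows "(\<lambda>n. bessel_form a (u n) (v n)) \<longlonglongrightarrow> bessel_form a u0 v0"
proof -
  obtain E where E: "0 \<le> E" "\<And>i. \<bar>bessel_coeff a i\<bar> \<le> E * exp_term a i"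
    using bessel_coeff_bound[OF a] by blast
  have "Bseq u" "Bseq v" using u v by (auto intro: convergent_imp_Bseq convergentI)
  then obtain B B' where B: "\<And>n. \<bar>u n\<bar> \<le> B" "\<And>n. \<bar>v n\<bar> \<le> B'"
    unfolding Bseq_def real_norm_def by blast
  show ?thesis unfolding bessel_form_def
  proof (rule cauchy_form_tendsto[OF a,
      where D = "\<lambda>i. E * exp_term a i * B ^ i" and D' = "\<lambda>i. E * exp_term a i * B' ^ i"])
    show "(\<lambda>n. bessel_series a (u n) i) \<longlonglongrightarrow> bessel_series a u0 i"
      "(\<lambda>n. bessel_series a (v n) i) \<longlonglongrightarrow> bessel_series a v0 i" for i
      unfolding bessel_series_def by (intro tendsto_intros u v)+
    show "eventually (\<lambda>n. \<forall>i. \<bar>bessel_series a (u n) i\<bar> \<le> E * exp_term a i * B ^ i) sequentially"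
      "eventually (\<lambda>n. \<forall>i. \<bar>bessel_series a (v n) i\<bar> \<le> E * exp_term a i * B' ^ i) sequentially"
      unfolding bessel_series_def by (intro always_eventually allI bounded_power_mult E B)+
  qed (rule summable_exp_term)+
qed

section \<open>Scaling of the reference kernel at the endpoint\<close>

text \<open>At this point \<open>(1 - x) / 2\<close> is \<open>s / 4\<close> over
  \<open>n ^ 2\<close>, which is the origin of the quarters in the arguments of
  \<open>bessel_form\<close>.\<close>

definition edge_point :: "nat \<Rightarrow> real \<Rightarrow> real" where
  "edge_point n s = 1 - s / (2 * (real n)\<^sup>2)"

context edge
begin

text \<open>The degrees run through an arbitrary sequence \<open>m\<close> because the cutoff
  changes them by a fraction of \<open>n\<close>. The points move with \<open>n\<close> because
  uniformity is later deduced from convergence along sequences.\<close>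

theorem edge_kernel_asymptotics:
  fixes m :: "nat \<Rightarrow> nat"
  assumes m: "filterlim m at_top sequentially" and u: "u \<longlonglongrightarrow> u0" and v: "v \<longlonglongrightarrow> v0"
  shows "(\<lambda>n. K (m n) (edge_point (m n) (u n)) (edge_point (m n) (v n)) / real (m n) powr (2 * a))
     \<longlonglongrightarrow> bessel_form a (u0 / 4) (v0 / 4) / mass"
proof -
  define X where "X u n i = cauchy_coeff a (m n) i * (- (u n / 4 / (real (m n))\<^sup>2)) ^ i / real (m n) powr a" for u :: "nat \<Rightarrow> real" and n i
  have m0: "eventually (\<lambda>n. 0 < m n) sequentially"
    by (rule eventually_compose_filterlim[OF eventually_gt_at_top m])
  obtain E where E: "0 \<le> E" "\<And>m i. 0 < m \<Longrightarrow>
    \<bar>scaled_coeff a m i\<bar> \<le> E * exp_term a i"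
    using cauchy_coeff_dominated[OF a_pos] by blast
  have "Bseq u" "Bseq v" using u v by (auto intro: convergent_imp_Bseq convergentI)
  then obtain B B' where B: "\<And>n. \<bar>u n\<bar> \<le> B" "\<And>n. \<bar>v n\<bar> \<le> B'"
    unfolding Bseq_def real_norm_def by blast
  have lim: "(\<lambda>n. X u n i) \<longlonglongrightarrow> bessel_series a (u0 / 4) i" if "u \<longlonglongrightarrow> u0" for u u0 i
  proof -
    have "(\<lambda>n. scaled_coeff a (m n) i * (- (u n / 4)) ^ i)
       \<longlonglongrightarrow> bessel_coeff a i * (- (u0 / 4)) ^ i"
      by (intro tendsto_mult filterlim_compose[OF bessel_coeff_limit[OF a_pos] m] tendsto_power tendsto_minus tendsto_divide tendsto_const that) simp
    moreover have "eventually (\<lambda>n. scaled_coeff a (m n) i * (- (u n / 4)) ^ i = X u n i) sequentially"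
      using m0 by eventually_elim (simp only: X_def cauchy_coeff_scaled)
    ultimately show ?thesis unfolding bessel_series_def by (simp add: tendsto_cong)
  qed
  have dom: "eventually (\<lambda>n. \<forall>i. \<bar>X u n i\<bar> \<le> E * exp_term a i * B ^ i) sequentially"
    if "\<And>n. \<bar>u n\<bar> \<le> B" for u B
    using m0
  proof eventually_elim
    case (elim n)
    show ?case unfolding X_def cauchy_coeff_scaled[OF elim]
      using that[of n] by (intro allI bounded_power_mult E elim) simp
  qed
  have "(\<lambda>n. cauchy_form a (X u n) (X v n)) \<longlonglongrightarrow> bessel_form a (u0 / 4) (v0 / 4)"
    unfolding bessel_form_def
    by (rule cauchy_form_tendsto[OF a_pos lim[OF u] lim[OF v] dom[OF B(1)] dom[OF B(2)]])
      (rule summable_exp_term)+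
  then have "(\<lambda>n. cauchy_form a (X u n) (X v n) / mass) \<longlonglongrightarrow> bessel_form a (u0 / 4) (v0 / 4) / mass"
    using mass_pos by (intro tendsto_divide tendsto_const) auto
  moreover have "eventually (\<lambda>n. cauchy_form a (X u n) (X v n) / mass
     = K (m n) (edge_point (m n) (u n)) (edge_point (m n) (v n)) / real (m n) powr (2 * a)) sequentially"
    using m0
  proof eventually_elim
    case (elim n)
    \<comment> \<open>The binomial coefficient vanishes for \<open>i \<ge> m n\<close>, so the
      infinite series are the finite sums of the kernel formula.\<close>
    have z: "X w n i = 0" if "i \<notin> {..<m n}" for i w
      using that elim by (simp add: X_def cauchy_coeff_def binomial_eq_0)
    have "cauchy_form a (X u n) (X v n) = (\<Sum>i<m n. X u n i * (\<Sum>j<m n. X v n j / (a + real i + real j)))"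
      unfolding cauchy_form_def by (subst (1 2) suminf_finite[of "{..<m n}"]) (auto simp: z)
    also have "\<dots> = (\<Sum>i<m n. \<Sum>j<m n. (-1) ^ (i + j) * cauchy_coeff a (m n) i * cauchy_coeff a (m n) j / (a + real i + real j)
      * (u n / 4 / (real (m n))\<^sup>2) ^ i * (v n / 4 / (real (m n))\<^sup>2) ^ j) / real (m n) powr (2 * a)"
      unfolding sum_divide_distrib sum_distrib_left
    proof (intro sum.cong refl)
      fix i j
      have "real (m n) powr (2 * a) = real (m n) powr a * real (m n) powr a" by (simp flip: powr_add)
      moreover have "(- (u n / 4 / (real (m n))\<^sup>2)) ^ i = (-1) ^ i * (u n / 4 / (real (m n))\<^sup>2) ^ i"
        "(- (v n / 4 / (real (m n))\<^sup>2)) ^ j = (-1) ^ j * (v n / 4 / (real (m n))\<^sup>2) ^ j"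
        by (rule power_minus)+
      ultimately show "X u n i * (X v n j / (a + real i + real j)) = (-1) ^ (i + j) * cauchy_coeff a (m n) i * cauchy_coeff a (m n) j / (a + real i + real j)
      * (u n / 4 / (real (m n))\<^sup>2) ^ i * (v n / 4 / (real (m n))\<^sup>2) ^ j / real (m n) powr (2 * a)"
        unfolding X_def by (simp only: power_add) (simp add: mult_ac)
    qed
    moreover have "(1 - edge_point (m n) r) / 2 = r / 4 / (real (m n))\<^sup>2" for r by (simp add: edge_point_def)
    ultimately show ?case unfolding edge_kernel_formula by simp
  qed
  ultimately show ?thesis by (simp add: tendsto_cong)
qed

end

section \<open>Comparison of kernels near the endpoint\<close>

definition cutoff :: "nat \<Rightarrow> real poly" where "cutoff k = [:1/2, 1/2:] ^ k"

lemma poly_cutoff: "poly (cutoff k) x = ((1 + x) / 2) ^ k"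
  by (simp add: cutoff_def poly_power add_divide_distrib)

lemma degree_cutoff: "degree (cutoff k) = k"
  unfolding cutoff_def by (simp add: degree_power_eq)

text \<open>Squares of polynomials are the only functions that the extremal arguments integrate.
  Localization to a neighbourhood of 1 is on the left; on the right the whole integral is
  allowed.\<close>

definition dominated_near_one :: "real measure \<Rightarrow> real measure \<Rightarrow> bool" where
  "dominated_near_one M N \<longleftrightarrow> (\<forall>\<epsilon>>0. \<exists>\<delta>. 0 < \<delta> \<and> \<delta> < 2 \<and>
     (\<forall>P. (LINT x|M. indicator {1 - \<delta><..} x * (poly P x)\<^sup>2) \<le> (1 + \<epsilon>) * (LINT x|N. (poly P x)\<^sup>2)))"

definition subexponential :: "(nat \<Rightarrow> real poly) \<Rightarrow> bool" where
  "subexponential p \<longleftrightarrow> (\<forall>\<delta>>0. \<exists>C. \<forall>n. \<forall>x\<in>{-1..1}. \<bar>poly (p n) x\<bar> \<le> exp (C + \<delta> * real n))"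

lemma subexponential_kernel:
  assumes "subexponential p" and \<delta>: "0 < \<delta>"
  obtains C where "\<And>n x. x \<in> {-1..1} \<Longrightarrow> reproducing_kernel p n x x \<le> exp (C + \<delta> * real n)"
proof -
  \<comment> \<open>Squaring doubles the rate to \<open>2 * \<delta> / 3\<close>, and the last third
    absorbs the number \<open>n\<close> of terms.\<close>
  obtain C where C: "\<And>n x. x \<in> {-1..1} \<Longrightarrow> \<bar>poly (p n) x\<bar> \<le> exp (C + \<delta> / 3 * real n)"
    using assms unfolding subexponential_def by (metis divide_pos_pos zero_less_numeral)
  have "reproducing_kernel p n x x \<le> exp (2 * C + ln (3 / \<delta>) + \<delta> * real n)" if x: "x \<in> {-1..1}" for n x
  proof -
    have "reproducing_kernel p n x x \<le> (\<Sum>k<n. exp (2 * C + 2 * \<delta> / 3 * real n))"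
      unfolding reproducing_kernel_def
    proof (rule sum_mono)
      fix k assume k: "k \<in> {..<n}"
      have "poly (p k) x * poly (p k) x = \<bar>poly (p k) x\<bar> * \<bar>poly (p k) x\<bar>" by simp
      also have "\<dots> \<le> exp (C + \<delta> / 3 * real k) * exp (C + \<delta> / 3 * real k)"
        using C[OF x] by (intro mult_mono) auto
      also have "\<dots> = exp (2 * C + 2 * \<delta> / 3 * real k)" by (simp add: exp_add[symmetric])
      also have "\<dots> \<le> exp (2 * C + 2 * \<delta> / 3 * real n)" using k \<delta> by (auto intro!: mult_left_mono)
      finally show "poly (p k) x * poly (p k) x \<le> exp (2 * C + 2 * \<delta> / 3 * real n)" .
    qed
    also have "\<dots> = real n * exp (2 * C + 2 * \<delta> / 3 * real n)" by simp
    finally have "reproducing_kernel p n x x \<le> real n * exp (2 * C + 2 * \<delta> / 3 * real n)" .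
    moreover have "real n \<le> 3 / \<delta> * exp (\<delta> / 3 * real n)"
    proof -
      have "\<delta> / 3 * real n \<le> exp (\<delta> / 3 * real n)"
        using exp_ge_add_one_self[of "\<delta> / 3 * real n"] by linarith
      then show ?thesis using \<delta> by (simp add: field_simps)
    qed
    then have "real n * exp (2 * C + 2 * \<delta> / 3 * real n)
       \<le> 3 / \<delta> * exp (\<delta> / 3 * real n) * exp (2 * C + 2 * \<delta> / 3 * real n)"
      by (intro mult_right_mono) auto
    moreover have "3 / \<delta> * exp (\<delta> / 3 * real n) * exp (2 * C + 2 * \<delta> / 3 * real n)
       = exp (ln (3 / \<delta>)) * exp (\<delta> / 3 * real n) * exp (2 * C + 2 * \<delta> / 3 * real n)"
      using \<delta> by simp
    moreover have "exp (ln (3 / \<delta>)) * exp (\<delta> / 3 * real n) * exp (2 * C + 2 * \<delta> / 3 * real n)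
       = exp (2 * C + ln (3 / \<delta>) + \<delta> * real n)"
      unfolding exp_add[symmetric] by (simp add: algebra_simps)
    ultimately show ?thesis by linarith
  qed
  then show ?thesis using that by blast
qed

text \<open>Near 1 the cutoff is at most 1 and domination applies. Elsewhere it is at most
  \<open>(1 - \<delta> / 2) ^ k\<close>, and Cauchy-Schwarz bounds the squared kernel by its
  diagonal value at \<open>x\<close> times \<open>S\<close>; both contributions are thus relative to
  this diagonal value.\<close>

lemma cutoff_transfer:
  assumes "interval_measure M" and "orthonormal_system N q"
    and \<delta>: "0 < \<delta>" "\<delta> < 2" and \<epsilon>: "0 < \<epsilon>"
    and dom: "\<And>P. (LINT x|M. indicator {1 - \<delta><..} x * (poly P x)\<^sup>2) \<le> (1 + \<epsilon>) * (LINT x|N. (poly P x)\<^sup>2)"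
    and S: "\<And>t. t \<in> {-1..1} \<Longrightarrow> reproducing_kernel q n t t \<le> S"
  shows "(LINT t|M. (reproducing_kernel q n x t * poly (cutoff k) t)\<^sup>2)
     \<le> reproducing_kernel q n x x * (1 + \<epsilon> + measure M UNIV * S * (1 - \<delta> / 2) ^ (2 * k))"
proof -
  interpret M: interval_measure M by fact
  interpret N: orthonormal_system N q by fact
  define P where "P = N.kernel_poly n x"
  define Z where "Z = N.K n x x * S * (1 - \<delta> / 2) ^ (2 * k)"
  have ind: "integrable M (\<lambda>t. indicator {1 - \<delta><..} t * (poly P t)\<^sup>2)"
    by (rule M.integrable_indicator_poly) simp
  have "(LINT t|M. (poly P t * poly (cutoff k) t)\<^sup>2) \<le> (LINT t|M. indicator {1 - \<delta><..} t * (poly P t)\<^sup>2 + Z)"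
  proof (rule integral_mono_AE)
    show "integrable M (\<lambda>t. (poly P t * poly (cutoff k) t)\<^sup>2)"
      by (intro M.integrable_continuous continuous_intros)
    show "integrable M (\<lambda>t. indicator {1 - \<delta><..} t * (poly P t)\<^sup>2 + Z)" using ind by simp
    show "AE t in M. (poly P t * poly (cutoff k) t)\<^sup>2 \<le> indicator {1 - \<delta><..} t * (poly P t)\<^sup>2 + Z"
      using M.AE_in
    proof eventually_elim
      case (elim t)
      define Q where "Q = (1 + t) / 2"
      have Q: "0 \<le> Q" "Q \<le> 1" using elim by (auto simp: Q_def)
      have S0: "0 \<le> S" using S[of t] N.K_nonneg[of n t] elim by auto
      have PS: "(poly P t)\<^sup>2 \<le> N.K n x x * S"
      proof -
        have "(poly P t)\<^sup>2 \<le> N.K n x x * N.K n t t" unfolding P_def using N.K_square_le by simp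
        also have "\<dots> \<le> N.K n x x * S" using S[of t] elim N.K_nonneg by (intro mult_left_mono) auto
        finally show ?thesis .
      qed
      have Z0: "0 \<le> Z" unfolding Z_def using \<delta> S0 N.K_nonneg by (intro mult_nonneg_nonneg) auto
      have eq: "(poly P t * poly (cutoff k) t)\<^sup>2 = (poly P t)\<^sup>2 * Q ^ (2 * k)"
        by (simp add: poly_cutoff Q_def power_mult_distrib power_mult[symmetric] mult.commute)
      show ?case
      proof (cases "1 - \<delta> < t")
        case True
        have "(poly P t)\<^sup>2 * Q ^ (2 * k) \<le> (poly P t)\<^sup>2 * 1"
          using Q by (intro mult_left_mono power_le_one) auto
        then show ?thesis using True Z0 eq by simp
      next
        case False
        have "(poly P t)\<^sup>2 * Q ^ (2 * k) \<le> (N.K n x x * S) * (1 - \<delta> / 2) ^ (2 * k)"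
          using Q PS False by (intro mult_mono power_mono) (auto simp: Q_def intro: order_trans[OF zero_le_power2 PS])
        then show ?thesis using False eq by (simp add: Z_def)
      qed
    qed
  qed
  also have "\<dots> = (LINT t|M. indicator {1 - \<delta><..} t * (poly P t)\<^sup>2) + Z * measure M UNIV"
    using ind by simp
  also have "\<dots> \<le> (1 + \<epsilon>) * (LINT t|N. (poly P t)\<^sup>2) + Z * measure M UNIV"
    using dom by simp
  also have "(LINT t|N. (poly P t)\<^sup>2) = N.K n x x"
    unfolding P_def by (simp add: power2_eq_square N.integral_K_square)
  finally show ?thesis by (simp add: P_def Z_def algebra_simps)
qed

text \<open>The order of choices matters: \<kappa> fixes the neighbourhood of 1 and with it the
  decay of the cutoff, and only then the growth rate \<eta> is picked. This is why the orthonormal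
  polynomials have to be subexponential at every rate.\<close>

lemma exponential_tail:
  assumes \<theta>: "0 < \<theta>" "\<theta> < 1" and \<kappa>: "0 < \<kappa>"
  obtains \<eta> where "0 < \<eta>" and "\<And>c C. (\<lambda>n. c * exp (C + \<eta> * real n) * \<theta> ^ (2 * nat \<lfloor>\<kappa> * real n\<rfloor>)) \<longlonglongrightarrow> 0"
proof -
  \<comment> \<open>The power of \<theta> decays like \<open>exp (- 2 * l * \<kappa> * n)\<close>,
    up to a factor \<open>exp (2 * l)\<close> lost by rounding. The choice
    \<open>\<eta> = l * \<kappa>\<close> consumes half of the rate.\<close>
  define l where "l = - ln \<theta>"
  have l: "0 < l" using \<theta> by (simp add: l_def)
  have "(\<lambda>n. c * exp (C + l * \<kappa> * real n) * \<theta> ^ (2 * nat \<lfloor>\<kappa> * real n\<rfloor>)) \<longlonglongrightarrow> 0" for c C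
  proof (rule tendsto_rabs_zero_cancel, rule tendsto_sandwich[OF _ _ tendsto_const])
    have "(\<lambda>n. exp (- (l * \<kappa>)) ^ n) \<longlonglongrightarrow> 0"
      using l \<kappa> by (intro LIMSEQ_realpow_zero) auto
    then have "(\<lambda>n. \<bar>c\<bar> * exp (C + 2 * l) * exp (- (l * \<kappa>)) ^ n) \<longlonglongrightarrow> \<bar>c\<bar> * exp (C + 2 * l) * 0"
      by (intro tendsto_mult tendsto_const)
    then show "(\<lambda>n. \<bar>c\<bar> * exp (C + 2 * l) * exp (- (l * \<kappa>)) ^ n) \<longlonglongrightarrow> 0" by simp
    show "eventually (\<lambda>n. \<bar>c * exp (C + l * \<kappa> * real n) * \<theta> ^ (2 * nat \<lfloor>\<kappa> * real n\<rfloor>)\<bar>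
        \<le> \<bar>c\<bar> * exp (C + 2 * l) * exp (- (l * \<kappa>)) ^ n) sequentially"
    proof (intro always_eventually allI)
      fix n
      define k where "k = nat \<lfloor>\<kappa> * real n\<rfloor>"
      have "0 \<le> \<kappa> * real n" using \<kappa> by simp
      then have k: "\<kappa> * real n - 1 \<le> real k" unfolding k_def by linarith
      have "\<theta> ^ (2 * k) = exp (- l) ^ (2 * k)" using \<theta> by (simp add: l_def)
      also have "\<dots> = exp (- l * (2 * real k))" by (simp add: exp_of_nat_mult[symmetric] mult_ac)
      also have "\<dots> \<le> exp (- l * (2 * (\<kappa> * real n - 1)))" using k l by simp
      finally have "exp (C + l * \<kappa> * real n) * \<theta> ^ (2 * k) \<le> exp (C + l * \<kappa> * real n) * exp (- l * (2 * (\<kappa> * real n - 1)))"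
        by (intro mult_left_mono) auto
      also have "\<dots> = exp (C + 2 * l) * exp (real n * - (l * \<kappa>))"
        unfolding exp_add[symmetric] by (simp add: algebra_simps)
      also have "\<dots> = exp (C + 2 * l) * exp (- (l * \<kappa>)) ^ n" unfolding exp_of_nat_mult ..
      finally have "\<bar>c\<bar> * (exp (C + l * \<kappa> * real n) * \<theta> ^ (2 * k)) \<le> \<bar>c\<bar> * (exp (C + 2 * l) * exp (- (l * \<kappa>)) ^ n)"
        by (intro mult_left_mono) auto
      then show "\<bar>c * exp (C + l * \<kappa> * real n) * \<theta> ^ (2 * nat \<lfloor>\<kappa> * real n\<rfloor>)\<bar>
        \<le> \<bar>c\<bar> * exp (C + 2 * l) * exp (- (l * \<kappa>)) ^ n"
        using \<theta> by (simp add: abs_mult k_def mult.assoc)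
    qed
  qed simp
  then show ?thesis using that[of "l * \<kappa>"] l \<kappa> by simp
qed

lemma floor_ratio_tendsto:
  assumes "0 \<le> \<kappa>"
  shows "(\<lambda>n. real (nat \<lfloor>\<kappa> * real n\<rfloor>) / real n) \<longlonglongrightarrow> \<kappa>"
proof (rule tendsto_sandwich)
  show "eventually (\<lambda>n. \<kappa> - 1 / real n \<le> real (nat \<lfloor>\<kappa> * real n\<rfloor>) / real n) sequentially"
    using eventually_gt_at_top[of 0]
  proof eventually_elim
    case (elim n)
    have "0 \<le> \<kappa> * real n" using assms by simp
    then have "\<kappa> * real n - 1 \<le> real (nat \<lfloor>\<kappa> * real n\<rfloor>)" by linarith
    then have "(\<kappa> * real n - 1) / real n \<le> real (nat \<lfloor>\<kappa> * real n\<rfloor>) / real n"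
      by (intro divide_right_mono) auto
    then show ?case using elim by (simp add: diff_divide_distrib)
  qed
  show "eventually (\<lambda>n. real (nat \<lfloor>\<kappa> * real n\<rfloor>) / real n \<le> \<kappa>) sequentially"
    using eventually_gt_at_top[of 0]
  proof eventually_elim
    case (elim n)
    have "0 \<le> \<kappa> * real n" using assms by simp
    then have "real (nat \<lfloor>\<kappa> * real n\<rfloor>) \<le> \<kappa> * real n" by linarith
    then show ?case using elim by (simp add: field_simps)
  qed
  have "(\<lambda>n. \<kappa> - 1 / real n) \<longlonglongrightarrow> \<kappa> - 0"
    by (intro tendsto_diff tendsto_const lim_const_over_n)
  then show "(\<lambda>n. \<kappa> - 1 / real n) \<longlonglongrightarrow> \<kappa>" by simp
qed simp

lemma edge_point_tendsto:
  assumes "s \<longlonglongrightarrow> s0"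
  shows "(\<lambda>n. edge_point n (s n)) \<longlonglongrightarrow> 1"
proof -
  have "(\<lambda>n. s n * (1 / 2) * (1 / real n) ^ 2) \<longlonglongrightarrow> s0 * (1 / 2) * 0 ^ 2"
    by (intro tendsto_intros assms lim_const_over_n)
  then have "(\<lambda>n. 1 - s n * (1 / 2) * (1 / real n) ^ 2) \<longlonglongrightarrow> 1 - 0"
    by (intro tendsto_diff tendsto_const) simp
  then show ?thesis by (simp add: edge_point_def power_divide)
qed

lemma edge_point_eventually:
  assumes "s \<longlonglongrightarrow> s0" and "\<And>n. 0 \<le> s n"
  shows "eventually (\<lambda>n. edge_point n (s n) \<in> {-1..1}) sequentially"
proof -
  have "eventually (\<lambda>n. edge_point n (s n) > 0) sequentially"
    using order_tendstoD(1)[OF edge_point_tendsto[OF assms(1)], of 0] by simp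
  then show ?thesis
    by eventually_elim (use assms(2) in \<open>auto simp: edge_point_def\<close>)
qed

text \<open>By Bernoulli's inequality, a power at most \<open>n\<close> of
  \<open>1 - s / (4 * n ^ 2)\<close> is at least \<open>1 - s / (4 * n)\<close>.\<close>

lemma cutoff_tendsto:
  assumes s: "s \<longlonglongrightarrow> s0" and s0: "\<And>n. 0 \<le> s n" and k: "\<And>n. k n \<le> n"
  shows "(\<lambda>n. poly (cutoff (k n)) (edge_point n (s n))) \<longlonglongrightarrow> 1"
proof (rule tendsto_sandwich)
  have "(\<lambda>n. 1 - s n * (1 / 4) * (1 / real n)) \<longlonglongrightarrow> 1 - s0 * (1 / 4) * 0"
    by (intro tendsto_intros s lim_const_over_n)
  then show "(\<lambda>n. 1 - s n / (4 * real n)) \<longlonglongrightarrow> 1" by simp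
  show "eventually (\<lambda>n. 1 - s n / (4 * real n) \<le> poly (cutoff (k n)) (edge_point n (s n))) sequentially"
    using eventually_gt_at_top[of 0] edge_point_eventually[OF s s0]
  proof eventually_elim
    case (elim n)
    define y where "y = s n / (4 * (real n)\<^sup>2)"
    have half: "(1 + edge_point n (s n)) / 2 = 1 - y" by (simp add: edge_point_def y_def add_divide_distrib diff_divide_distrib)
    have y: "0 \<le> y" "y \<le> 1" using elim s0[of n] by (auto simp: y_def edge_point_def field_simps)
    have "poly (cutoff (k n)) (edge_point n (s n)) = (1 + (- y)) ^ k n"
      unfolding poly_cutoff half by simp
    also have "\<dots> \<ge> 1 + real (k n) * (- y)" using y by (intro Bernoulli_inequality) auto
    moreover have "real (k n) * y \<le> real n * y" using k y by (intro mult_right_mono) auto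
    moreover have "real n * y = s n / (4 * real n)" using elim by (simp add: y_def power2_eq_square)
    ultimately show ?case by linarith
  qed
  show "eventually (\<lambda>n. poly (cutoff (k n)) (edge_point n (s n)) \<le> 1) sequentially"
    using edge_point_eventually[OF s s0]
    by eventually_elim (auto simp: poly_cutoff intro!: power_le_one)
qed simp

section \<open>Comparison of two kernels at the endpoint\<close>

text \<open>Domination is assumed both ways: one direction bounds the diagonal of the kernel of
  \<open>M\<close> from above, the other the norm in \<open>M\<close> of the cut off reference
  kernel. Continuity of \<open>L\<close> lets the ratio of degrees tend to 1.\<close>

locale edge_comparison =
  M: orthonormal_system M p + N: orthonormal_system N q
  for M p N q +
  fixes a :: real and L :: "real \<Rightarrow> real \<Rightarrow> real"
  assumes domMN: "dominated_near_one M N" and domNM: "dominated_near_one N M"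
    and subM: "subexponential p" and subN: "subexponential q"
    and asymp: "\<And>m u v u0 v0. filterlim m at_top sequentially \<Longrightarrow> u \<longlonglongrightarrow> u0 \<Longrightarrow> v \<longlonglongrightarrow> v0 \<Longrightarrow>
       (\<lambda>n. N.K (m n) (edge_point (m n) (u n)) (edge_point (m n) (v n)) / real (m n) powr (2 * a)) \<longlonglongrightarrow> L u0 v0"
    and L_tendsto: "\<And>u v u0 v0. u \<longlonglongrightarrow> u0 \<Longrightarrow> v \<longlonglongrightarrow> v0 \<Longrightarrow> (\<lambda>n. L (u n) (v n)) \<longlonglongrightarrow> L u0 v0"
begin

text \<open>The limit for degrees \<open>m\<close> with \<open>m / n\<close> tending to \<tau>, at
  points still scaled by \<open>n\<close>: \<open>edge_point n s\<close> is
  \<open>edge_point m ((m / n) ^ 2 * s)\<close>, and the normalization changes by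
  \<open>(m / n) powr (2 * a)\<close>.\<close>

definition scaled_limit :: "real \<Rightarrow> real \<Rightarrow> real \<Rightarrow> real" where
  "scaled_limit \<tau> s t = \<tau> powr (2 * a) * L (\<tau>\<^sup>2 * s) (\<tau>\<^sup>2 * t)"

lemma asymp_scaled:
  assumes \<tau>: "0 < \<tau>" and m: "(\<lambda>n. real (m n) / real n) \<longlonglongrightarrow> \<tau>"
    and s: "s \<longlonglongrightarrow> s0" and t: "t \<longlonglongrightarrow> t0"
  shows "(\<lambda>n. N.K (m n) (edge_point n (s n)) (edge_point n (t n)) / real n powr (2 * a)) \<longlonglongrightarrow> scaled_limit \<tau> s0 t0"
proof -
  have "filterlim (\<lambda>n. real (m n) / real n * real n) at_top sequentially"
    by (rule filterlim_tendsto_pos_mult_at_top[OF m \<tau> filterlim_real_sequentially])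
  moreover have "eventually (\<lambda>n. real (m n) / real n * real n = real (m n)) sequentially"
    using eventually_gt_at_top[of 0] by eventually_elim simp
  ultimately have "filterlim (\<lambda>n. real (m n)) at_top sequentially"
    using filterlim_cong by fastforce
  then have m_top: "filterlim m at_top sequentially"
    by (simp add: filterlim_sequentially_iff_filterlim_real)
  define u where "u r n = (real (m n) / real n)\<^sup>2 * r n" for r :: "nat \<Rightarrow> real" and n
  have u: "u r \<longlonglongrightarrow> \<tau>\<^sup>2 * r0" if "r \<longlonglongrightarrow> r0" for r r0
    unfolding u_def by (intro tendsto_intros m that)
  have "(\<lambda>n. N.K (m n) (edge_point (m n) (u s n)) (edge_point (m n) (u t n)) / real (m n) powr (2 * a)
      * (real (m n) / real n) powr (2 * a)) \<longlonglongrightarrow> L (\<tau>\<^sup>2 * s0) (\<tau>\<^sup>2 * t0) * \<tau> powr (2 * a)"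
    using \<tau> by (intro tendsto_mult asymp m_top u s t tendsto_powr m tendsto_const) auto
  moreover have "eventually (\<lambda>n. N.K (m n) (edge_point (m n) (u s n)) (edge_point (m n) (u t n)) / real (m n) powr (2 * a)
      * (real (m n) / real n) powr (2 * a) = N.K (m n) (edge_point n (s n)) (edge_point n (t n)) / real n powr (2 * a)) sequentially"
    using eventually_gt_at_top[of 0] eventually_compose_filterlim[OF eventually_gt_at_top[of 0] m_top]
  proof eventually_elim
    case (elim n)
    have "edge_point (m n) (u r n) = edge_point n (r n)" for r
      using elim by (simp add: u_def edge_point_def power_divide)
    moreover have "(real (m n) / real n) powr (2 * a) = real (m n) powr (2 * a) / real n powr (2 * a)"
      by (simp add: powr_divide)
    moreover have "real (m n) powr (2 * a) \<noteq> 0" using elim by simp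
    ultimately show ?case by simp
  qed
  ultimately show ?thesis unfolding scaled_limit_def by (simp add: tendsto_cong mult.commute)
qed

lemma scaled_limit_tendsto:
  assumes "\<tau> \<longlonglongrightarrow> 1"
  shows "(\<lambda>j. scaled_limit (\<tau> j) s t) \<longlonglongrightarrow> L s t"
proof -
  have "(\<lambda>j. scaled_limit (\<tau> j) s t) \<longlonglongrightarrow> 1 powr (2 * a) * L (1\<^sup>2 * s) (1\<^sup>2 * t)"
    unfolding scaled_limit_def by (intro tendsto_mult tendsto_powr assms L_tendsto tendsto_intros) auto
  then show ?thesis by simp
qed

context
  fixes \<kappa> :: real
  assumes \<kappa>: "0 < \<kappa>" "\<kappa> < 1"
begin

definition k where "k n = nat \<lfloor>\<kappa> * real n\<rfloor>"

lemma k_le: "k n \<le> n"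
proof -
  have "\<kappa> * real n \<le> 1 * real n" using \<kappa> by (intro mult_right_mono) auto
  then have "\<lfloor>\<kappa> * real n\<rfloor> \<le> int n" by linarith
  then show ?thesis by (simp add: k_def)
qed

text \<open>For an arbitrary pair of measures, as it is applied in both directions. The relative
  error \<open>T n\<close> depends neither on the point nor on the degree
  \<open>m \<le> n\<close>.\<close>

lemma tail:
  assumes "interval_measure M'" and "orthonormal_system N' q'" and "subexponential q'" and "dominated_near_one M' N'"
  obtains T where "T \<longlonglongrightarrow> 0" and "\<And>n m x. m \<le> n \<Longrightarrow>
    (LINT t|M'. (reproducing_kernel q' m x t * poly (cutoff (k n)) t)\<^sup>2) \<le> reproducing_kernel q' m x x * (1 + \<kappa> + T n)"
proof -
  interpret N': orthonormal_system N' q' by fact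
  obtain \<delta> where \<delta>: "0 < \<delta>" "\<delta> < 2"
    and dom: "\<And>P. (LINT x|M'. indicator {1 - \<delta><..} x * (poly P x)\<^sup>2) \<le> (1 + \<kappa>) * (LINT x|N'. (poly P x)\<^sup>2)"
    using assms(4) \<kappa> unfolding dominated_near_one_def by blast
  obtain \<eta> where \<eta>: "0 < \<eta>"
    "\<And>c C. (\<lambda>n. c * exp (C + \<eta> * real n) * (1 - \<delta> / 2) ^ (2 * nat \<lfloor>\<kappa> * real n\<rfloor>)) \<longlonglongrightarrow> 0"
    using exponential_tail[of "1 - \<delta> / 2" \<kappa>] \<delta> \<kappa> by auto
  obtain C where C: "\<And>n x. x \<in> {-1..1} \<Longrightarrow> N'.K n x x \<le> exp (C + \<eta> * real n)"
    using subexponential_kernel[OF assms(3) \<eta>(1)] by blast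
  show ?thesis
  proof (rule that[OF \<eta>(2)[of "measure M' UNIV" C]])
    fix n m :: nat and x :: real assume mn: "m \<le> n"
    have "N'.K m t t \<le> exp (C + \<eta> * real n)" if "t \<in> {-1..1}" for t
    proof -
      have "exp (C + \<eta> * real m) \<le> exp (C + \<eta> * real n)" using mn \<eta>(1) by simp
      with C[OF that, of m] show ?thesis by linarith
    qed
    then show "(LINT t|M'. (reproducing_kernel q' m x t * poly (cutoff (k n)) t)\<^sup>2)
      \<le> reproducing_kernel q' m x x * (1 + \<kappa> + measure M' UNIV * exp (C + \<eta> * real n) * (1 - \<delta> / 2) ^ (2 * nat \<lfloor>\<kappa> * real n\<rfloor>))"
      unfolding k_def by (intro cutoff_transfer[OF assms(1,2) \<delta> \<kappa>(1) dom]) auto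
  qed
qed

text \<open>The test polynomial is the kernel of \<open>M\<close> times the cutoff, in the extremal
  inequality of the reference measure for degree below \<open>n + k n\<close>. The diagonal value of
  \<open>M\<close> occurs squared on the left and once on the right, so one factor cancels.\<close>

lemma diagonal_upper:
  assumes s: "s \<longlonglongrightarrow> s0" and s0: "\<And>n. 0 \<le> s n"
  obtains U where "U \<longlonglongrightarrow> (1 + \<kappa>) * scaled_limit (1 + \<kappa>) s0 s0"
    and "eventually (\<lambda>n. M.K n (edge_point n (s n)) (edge_point n (s n)) / real n powr (2 * a) \<le> U n) sequentially"
proof -
  obtain T where T: "T \<longlonglongrightarrow> 0" "\<And>n m x. m \<le> n \<Longrightarrow>
    (LINT t|N. (M.K m x t * poly (cutoff (k n)) t)\<^sup>2) \<le> M.K m x x * (1 + \<kappa> + T n)"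
    using tail[OF N.interval_measure_axioms M.orthonormal_system_axioms subM domNM] by blast
  define x where "x n = edge_point n (s n)" for n
  define E where "E n = N.K (n + k n) (x n) (x n) / real n powr (2 * a)" for n
  define Q where "Q n = poly (cutoff (k n)) (x n)" for n
  have Q: "Q \<longlonglongrightarrow> 1" unfolding Q_def x_def by (rule cutoff_tendsto[OF s s0 k_le])
  have E: "E \<longlonglongrightarrow> scaled_limit (1 + \<kappa>) s0 s0"
    unfolding E_def x_def
  proof (rule asymp_scaled[OF _ _ s s])
    have "(\<lambda>n. 1 + real (k n) / real n) \<longlonglongrightarrow> 1 + \<kappa>"
      unfolding k_def using \<kappa> by (intro tendsto_add tendsto_const floor_ratio_tendsto) auto
    moreover have "eventually (\<lambda>n. 1 + real (k n) / real n = real (n + k n) / real n) sequentially"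
      using eventually_gt_at_top[of 0] by eventually_elim (simp add: add_divide_distrib)
    ultimately show "(\<lambda>n. real (n + k n) / real n) \<longlonglongrightarrow> 1 + \<kappa>" by (simp add: tendsto_cong)
  qed (use \<kappa> in auto)
  have lim: "(\<lambda>n. (1 + \<kappa> + T n) * E n / (Q n)\<^sup>2) \<longlonglongrightarrow> (1 + \<kappa> + 0) * scaled_limit (1 + \<kappa>) s0 s0 / 1\<^sup>2"
    by (intro tendsto_intros T E Q) auto
  have ev: "eventually (\<lambda>n. M.K n (x n) (x n) / real n powr (2 * a) \<le> (1 + \<kappa> + T n) * E n / (Q n)\<^sup>2) sequentially"
    using eventually_gt_at_top[of 0] order_tendstoD(1)[OF Q, of 0, simplified]
  proof eventually_elim
    case (elim n)
    define P where "P = M.kernel_poly n (x n) * cutoff (k n)"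
    have deg: "degree P < n + k n"
      unfolding P_def using degree_mult_le[of "M.kernel_poly n (x n)" "cutoff (k n)"] M.degree_kernel_poly[OF elim(1)]
      by (simp add: degree_cutoff) (meson add_less_mono1 le_less_trans)
    have "(M.K n (x n) (x n) * Q n)\<^sup>2 \<le> N.K (n + k n) (x n) (x n) * (LINT t|N. (M.K n (x n) t * poly (cutoff (k n)) t)\<^sup>2)"
      using N.christoffel_bound[OF deg, of "x n"] by (simp add: P_def Q_def)
    also have "\<dots> \<le> N.K (n + k n) (x n) (x n) * (M.K n (x n) (x n) * (1 + \<kappa> + T n))"
      by (intro mult_left_mono T N.K_nonneg) auto
    finally have "M.K n (x n) (x n) * (M.K n (x n) (x n) * (Q n)\<^sup>2) \<le> M.K n (x n) (x n) * (N.K (n + k n) (x n) (x n) * (1 + \<kappa> + T n))"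
      by (simp add: power2_eq_square mult_ac)
    then have "M.K n (x n) (x n) * (Q n)\<^sup>2 \<le> N.K (n + k n) (x n) (x n) * (1 + \<kappa> + T n)"
      using M.K_pos[OF elim(1), of "x n"] by simp
    then have "M.K n (x n) (x n) \<le> N.K (n + k n) (x n) (x n) * (1 + \<kappa> + T n) / (Q n)\<^sup>2"
      using elim(2) by (simp add: pos_le_divide_eq)
    then have "M.K n (x n) (x n) / real n powr (2 * a) \<le> N.K (n + k n) (x n) (x n) * (1 + \<kappa> + T n) / (Q n)\<^sup>2 / real n powr (2 * a)"
      by (intro divide_right_mono) auto
    then show ?case by (simp add: E_def mult_ac)
  qed
  show ?thesis using that[OF _ ev[unfolded x_def]] lim by simp
qed

text \<open>The limit of \<open>W\<close> in the next proof, where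
  \<open>- 2 * E + (1 + \<kappa>) * E\<close> is \<open>- (1 - \<kappa>) * E\<close>. The second
  factor tends to 0 with \<kappa>.\<close>

definition defect :: "real \<Rightarrow> real \<Rightarrow> real" where
  "defect s t = (1 + \<kappa>) * scaled_limit (1 + \<kappa>) t t *
     ((1 + \<kappa>) * scaled_limit (1 + \<kappa>) s s - (1 - \<kappa>) * scaled_limit (1 - \<kappa>) s s)"

text \<open>This is \<open>K_diff_bound\<close> with the reference kernel of degree below
  \<open>n - k n\<close> times the cutoff. The diagonal of \<open>M\<close> enters through the upper
  bounds \<open>U\<close> and \<open>V\<close> alone; a matching lower bound is part of the
  conclusion.\<close>

lemma kernel_near_reference:
  assumes s: "s \<longlonglongrightarrow> s0" and s0: "\<And>n. 0 \<le> s n" and t: "t \<longlonglongrightarrow> t0" and t0: "\<And>n. 0 \<le> t n"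
  shows "eventually (\<lambda>n. \<bar>M.K n (edge_point n (s n)) (edge_point n (t n)) / real n powr (2 * a) - scaled_limit (1 - \<kappa>) s0 t0\<bar>
     \<le> sqrt (defect s0 t0 + \<kappa>) + \<kappa>) sequentially"
proof -
  obtain T where T: "T \<longlonglongrightarrow> 0" "\<And>n m x. m \<le> n \<Longrightarrow>
    (LINT t|M. (N.K m x t * poly (cutoff (k n)) t)\<^sup>2) \<le> N.K m x x * (1 + \<kappa> + T n)"
    using tail[OF M.interval_measure_axioms N.orthonormal_system_axioms subN domMN] by blast
  obtain U where U: "U \<longlonglongrightarrow> (1 + \<kappa>) * scaled_limit (1 + \<kappa>) s0 s0"
    "eventually (\<lambda>n. M.K n (edge_point n (s n)) (edge_point n (s n)) / real n powr (2 * a) \<le> U n) sequentially"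
    using diagonal_upper[OF s s0] by blast
  obtain V where V: "V \<longlonglongrightarrow> (1 + \<kappa>) * scaled_limit (1 + \<kappa>) t0 t0"
    "eventually (\<lambda>n. M.K n (edge_point n (t n)) (edge_point n (t n)) / real n powr (2 * a) \<le> V n) sequentially"
    using diagonal_upper[OF t t0] by blast
  define x where "x n = edge_point n (s n)" for n
  define y where "y n = edge_point n (t n)" for n
  define c where "c n = real n powr (2 * a)" for n
  define m where "m n = n - k n" for n
  have m: "(\<lambda>n. real (m n) / real n) \<longlonglongrightarrow> 1 - \<kappa>"
  proof -
    have "(\<lambda>n. 1 - real (k n) / real n) \<longlonglongrightarrow> 1 - \<kappa>"
      unfolding k_def using \<kappa> by (intro tendsto_diff tendsto_const floor_ratio_tendsto) auto
    moreover have "eventually (\<lambda>n. 1 - real (k n) / real n = real (m n) / real n) sequentially"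
      using eventually_gt_at_top[of 0]
      by eventually_elim (simp add: m_def k_le of_nat_diff diff_divide_distrib)
    ultimately show ?thesis by (simp add: tendsto_cong)
  qed
  define E where "E n = N.K (m n) (x n) (x n) / c n" for n
  define F where "F n = N.K (m n) (x n) (y n) / c n" for n
  define Q where "Q n = poly (cutoff (k n)) (x n)" for n
  define R where "R n = poly (cutoff (k n)) (y n)" for n
  have Q: "Q \<longlonglongrightarrow> 1" unfolding Q_def x_def by (rule cutoff_tendsto[OF s s0 k_le])
  have R: "R \<longlonglongrightarrow> 1" unfolding R_def y_def by (rule cutoff_tendsto[OF t t0 k_le])
  have E: "E \<longlonglongrightarrow> scaled_limit (1 - \<kappa>) s0 s0"
    unfolding E_def x_def c_def using \<kappa> by (intro asymp_scaled m s) auto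
  have F: "F \<longlonglongrightarrow> scaled_limit (1 - \<kappa>) s0 t0"
    unfolding F_def x_def y_def c_def using \<kappa> by (intro asymp_scaled m s t) auto
  define W where "W n = V n * (U n - 2 * (E n * Q n) + E n * (1 + \<kappa> + T n))" for n
  have "W \<longlonglongrightarrow> (1 + \<kappa>) * scaled_limit (1 + \<kappa>) t0 t0 * ((1 + \<kappa>) * scaled_limit (1 + \<kappa>) s0 s0
     - 2 * (scaled_limit (1 - \<kappa>) s0 s0 * 1) + scaled_limit (1 - \<kappa>) s0 s0 * (1 + \<kappa> + 0))"
    unfolding W_def by (intro tendsto_intros T U V E Q)
  then have W: "W \<longlonglongrightarrow> defect s0 t0" by (simp add: defect_def algebra_simps)
  have FR: "(\<lambda>n. F n * R n) \<longlonglongrightarrow> scaled_limit (1 - \<kappa>) s0 t0 * 1" by (intro tendsto_mult F R)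
  then have FR: "eventually (\<lambda>n. \<bar>F n * R n - scaled_limit (1 - \<kappa>) s0 t0\<bar> < \<kappa>) sequentially"
    using tendstoD[OF FR \<kappa>(1)] by (simp add: dist_real_def)
  \<comment> \<open>Eventually \<open>n - k n\<close> is positive, which the strict degree bound for
    the kernel polynomial requires.\<close>
  have "filterlim (\<lambda>n. real (m n) / real n * real n) at_top sequentially"
    using \<kappa> by (intro filterlim_tendsto_pos_mult_at_top[OF m _ filterlim_real_sequentially]) auto
  then have mpos: "eventually (\<lambda>n. real (m n) / real n * real n > 0) sequentially"
    by (simp add: filterlim_at_top_dense)
  have "eventually (\<lambda>n. W n < defect s0 t0 + \<kappa>) sequentially"
    using order_tendstoD(2)[OF W] \<kappa> by simp
  then show ?thesis
    using U(2) V(2) FR mpos eventually_gt_at_top[of 0]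
  proof eventually_elim
    case (elim n)
    have mn: "0 < m n" using elim(5) by (cases "m n = 0") auto
    have c: "0 < c n" using elim(6) by (simp add: c_def)
    define P where "P = N.kernel_poly (m n) (x n) * cutoff (k n)"
    have deg: "degree P < n"
      using degree_mult_le[of "N.kernel_poly (m n) (x n)" "cutoff (k n)"] N.degree_kernel_poly[OF mn, of "x n"] k_le[of n]
      by (simp add: degree_cutoff P_def m_def)
    have "(M.K n (x n) (y n) - N.K (m n) (x n) (y n) * R n)\<^sup>2
      \<le> M.K n (y n) (y n) * (M.K n (x n) (x n) - 2 * (N.K (m n) (x n) (x n) * Q n)
          + (LINT t|M. (N.K (m n) (x n) t * poly (cutoff (k n)) t)\<^sup>2))"
      using M.K_diff_bound[OF deg, of "x n" "y n"] by (simp add: P_def Q_def R_def)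
    also have "\<dots> \<le> M.K n (y n) (y n) * (M.K n (x n) (x n) - 2 * (N.K (m n) (x n) (x n) * Q n)
          + N.K (m n) (x n) (x n) * (1 + \<kappa> + T n))"
      by (intro mult_left_mono add_left_mono T M.K_nonneg) (simp add: m_def)
    finally have "(M.K n (x n) (y n) - N.K (m n) (x n) (y n) * R n)\<^sup>2 / (c n)\<^sup>2
      \<le> M.K n (y n) (y n) * (M.K n (x n) (x n) - 2 * (N.K (m n) (x n) (x n) * Q n)
          + N.K (m n) (x n) (x n) * (1 + \<kappa> + T n)) / (c n)\<^sup>2"
      by (intro divide_right_mono) auto
    also have "\<dots> = (M.K n (y n) (y n) / c n) * (M.K n (x n) (x n) / c n - 2 * (E n * Q n) + E n * (1 + \<kappa> + T n))"
      by (simp add: E_def power2_eq_square add_divide_distrib diff_divide_distrib algebra_simps)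
    finally have sq: "(M.K n (x n) (y n) / c n - F n * R n)\<^sup>2
      \<le> (M.K n (y n) (y n) / c n) * (M.K n (x n) (x n) / c n - 2 * (E n * Q n) + E n * (1 + \<kappa> + T n))"
      by (simp add: F_def power_divide[symmetric] diff_divide_distrib)
    have "(M.K n (x n) (y n) / c n - F n * R n)\<^sup>2 \<le> W n"
    proof -
      \<comment> \<open>Replacing both factors by upper bounds needs \<open>0 \<le> A\<close>. This
        follows from the estimate itself, since its left-hand side is a square and the diagonal
        value is positive.\<close>
      define A where "A = M.K n (x n) (x n) / c n - 2 * (E n * Q n) + E n * (1 + \<kappa> + T n)"
      have Ky: "0 < M.K n (y n) (y n) / c n" using M.K_pos[OF elim(6)] c by simp
      have "0 \<le> M.K n (y n) (y n) / c n * A" using sq zero_le_power2 unfolding A_def by (rule order_trans[rotated])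
      then have A: "0 \<le> A" using Ky unfolding zero_le_mult_iff by linarith
      have "A \<le> U n - 2 * (E n * Q n) + E n * (1 + \<kappa> + T n)"
        using elim(2) by (simp add: A_def x_def c_def)
      then have "M.K n (y n) (y n) / c n * A \<le> W n"
        unfolding W_def using elim(3) A Ky by (intro mult_mono) (auto simp: y_def c_def)
      then show ?thesis using sq by (simp add: A_def)
    qed
    then have "\<bar>M.K n (x n) (y n) / c n - F n * R n\<bar> \<le> sqrt (defect s0 t0 + \<kappa>)"
      using elim(1) by (intro real_le_rsqrt) auto
    with elim(4) show ?case by (simp add: x_def y_def c_def)
  qed
qed

end

text \<open>A double limit: \<open>n\<close> tends to infinity for fixed \<kappa>, and then \<kappa>
  tends to 0. The values \<open>1 / (j + 2)\<close> lie strictly between 0 and 1 from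
  \<open>j = 0\<close> on.\<close>

theorem universality_sequence:
  assumes s: "s \<longlonglongrightarrow> s0" and s0: "\<And>n. 0 \<le> s n" and t: "t \<longlonglongrightarrow> t0" and t0: "\<And>n. 0 \<le> t n"
  shows "(\<lambda>n. M.K n (edge_point n (s n)) (edge_point n (t n)) / real n powr (2 * a)) \<longlonglongrightarrow> L s0 t0"
proof (rule tendstoI)
  fix e :: real assume e: "0 < e"
  define \<kappa> where "\<kappa> j = 1 / (real j + 2)" for j :: nat
  have \<kappa>: "0 < \<kappa> j" "\<kappa> j < 1" for j by (auto simp: \<kappa>_def)
  have \<kappa>0: "\<kappa> \<longlonglongrightarrow> 0"
  proof -
    have "(\<lambda>j. 1 / real (j + 2)) \<longlonglongrightarrow> 0"
      using LIMSEQ_ignore_initial_segment[OF lim_const_over_n[of 1], of 2] by simp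
    then show ?thesis by (simp add: \<kappa>_def[abs_def] add.commute)
  qed
  have lims: "(\<lambda>j. 1 + \<kappa> j) \<longlonglongrightarrow> 1" "(\<lambda>j. 1 - \<kappa> j) \<longlonglongrightarrow> 1"
    using tendsto_add[OF tendsto_const \<kappa>0, of 1] tendsto_diff[OF tendsto_const \<kappa>0, of 1] by simp_all
  have "(\<lambda>j. defect (\<kappa> j) s0 t0) \<longlonglongrightarrow> 1 * L t0 t0 * (1 * L s0 s0 - 1 * L s0 s0)"
    unfolding defect_def[OF \<kappa>] by (intro tendsto_intros scaled_limit_tendsto lims)
  then have d: "(\<lambda>j. defect (\<kappa> j) s0 t0) \<longlonglongrightarrow> 0" by simp
  have "(\<lambda>j. sqrt (defect (\<kappa> j) s0 t0 + \<kappa> j) + \<kappa> j + \<bar>scaled_limit (1 - \<kappa> j) s0 t0 - L s0 t0\<bar>)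
     \<longlonglongrightarrow> sqrt (0 + 0) + 0 + \<bar>L s0 t0 - L s0 t0\<bar>"
    by (intro tendsto_intros scaled_limit_tendsto lims d \<kappa>0)
  then have "(\<lambda>j. sqrt (defect (\<kappa> j) s0 t0 + \<kappa> j) + \<kappa> j + \<bar>scaled_limit (1 - \<kappa> j) s0 t0 - L s0 t0\<bar>) \<longlonglongrightarrow> 0" by simp
  from order_tendstoD(2)[OF this e] obtain j where
    j: "sqrt (defect (\<kappa> j) s0 t0 + \<kappa> j) + \<kappa> j + \<bar>scaled_limit (1 - \<kappa> j) s0 t0 - L s0 t0\<bar> < e"
    by (auto simp: eventually_sequentially)
  show "eventually (\<lambda>n. dist (M.K n (edge_point n (s n)) (edge_point n (t n)) / real n powr (2 * a)) (L s0 t0) < e) sequentially"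
    using kernel_near_reference[OF \<kappa>[of j] s s0 t t0]
    by eventually_elim (use j in \<open>auto simp: dist_real_def\<close>)
qed

end

section \<open>Identification with the Bessel kernel\<close>

text \<open>The quadratic weight dominates every polynomial factor in the shifted series below; it
  is itself absorbed through \<open>(1 + j) ^ 2 \<le> 4 ^ j\<close>.\<close>

lemma bessel_series_summable:
  assumes a: "0 < a"
  shows "summable (\<lambda>j. (1 + real j)\<^sup>2 * \<bar>bessel_series a v j\<bar>)"
proof -
  obtain E where E: "0 \<le> E" "\<And>i. \<bar>bessel_coeff a i\<bar> \<le> E * exp_term a i"
    using bessel_coeff_bound[OF a] by blast
  have pow: "(1 + real j)\<^sup>2 \<le> 4 ^ j" for j
  proof -
    have "1 + real j \<le> 2 ^ j" by (induction j) auto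
    then have "(1 + real j)\<^sup>2 \<le> (2 ^ j)\<^sup>2" by (intro power_mono) auto
    also have "(2 ^ j)\<^sup>2 = (4::real) ^ j" by (simp add: power2_eq_square flip: power_mult_distrib)
    finally show ?thesis .
  qed
  show ?thesis
  proof (rule summable_comparison_test'[where N = 0])
    show "summable (\<lambda>i. E * exp_term a i * (4 * \<bar>v\<bar>) ^ i)" by (rule summable_exp_term)
    fix j
    have "(1 + real j)\<^sup>2 * \<bar>bessel_series a v j\<bar> \<le> 4 ^ j * (E * exp_term a j * \<bar>v\<bar> ^ j)"
      unfolding bessel_series_def by (intro mult_mono pow bounded_power_mult E) auto
    then show "norm ((1 + real j)\<^sup>2 * \<bar>bessel_series a v j\<bar>) \<le> E * exp_term a j * (4 * \<bar>v\<bar>) ^ j"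
      by (simp add: power_mult_distrib mult_ac)
  qed
qed

lemma bessel_series_dominated_summable:
  assumes a: "0 < a" and le: "\<And>j. \<bar>f j\<bar> \<le> (1 + real j)\<^sup>2 * \<bar>bessel_series a v j\<bar> * C"
  shows "summable f"
  by (rule summable_comparison_test'[OF summable_mult2[OF bessel_series_summable[OF a, of v], of C], of 0]) (use le in simp)

lemma bessel_coeff_rec:
  assumes a: "0 < a"
  shows "bessel_coeff a i = real (Suc i) * (a + real i) * bessel_coeff a (Suc i)"
proof -
  have "Gamma (a + real i + 1) = (a + real i) * Gamma (a + real i)"
    using a by (intro Gamma_plus1) (auto elim!: nonpos_Ints_cases)
  then have "Gamma (a + real (Suc i)) = (a + real i) * Gamma (a + real i)" by (simp add: add_ac)
  moreover have "0 < Gamma (a + real i)" using a by (intro Gamma_real_pos) auto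
  moreover have "a + real i \<noteq> 0" using a by simp
  ultimately show ?thesis by (simp add: bessel_coeff_def del: of_nat_Suc)
qed

text \<open>Bessel's differential equation at the level of the terms of the series.\<close>

lemma bessel_series_rec:
  assumes a: "0 < a"
  shows "u * bessel_series a u i = - (real (Suc i) * (a + real i) * bessel_series a u (Suc i))"
  unfolding bessel_series_def by (subst bessel_coeff_rec[OF a]) simp

definition bessel_phi :: "real \<Rightarrow> real \<Rightarrow> real" where
  "bessel_phi a u = (\<Sum>i. bessel_series a u i)"

text \<open>The Euler derivative of \<open>bessel_phi\<close>, that is \<open>u\<close> times its
  derivative at \<open>u\<close>.\<close>

definition bessel_theta :: "real \<Rightarrow> real \<Rightarrow> real" where
  "bessel_theta a u = (\<Sum>i. real i * bessel_series a u i)"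

text \<open>Writing \<open>u\<close> times the \<open>i\<close>-th term of the series as a multiple of the next one, the
  difference of the two shifted double series has the coefficient
  \<open>(j (\<alpha> + j) - i (\<alpha> + i)) / (\<alpha> + i + j) = j - i\<close>, where \<open>\<alpha> = a - 1\<close>.\<close>

theorem bessel_form_christoffel_darboux:
  assumes a: "0 < a"
  shows "(u - v) * bessel_form a u v = bessel_phi a u * bessel_theta a v - bessel_theta a u * bessel_phi a v"
proof -
  define X where "X = bessel_series a u"
  define Y where "Y = bessel_series a v"
  define I where "I i = (\<Sum>j. Y j / (a + real i + real j))" for i
  \<comment> \<open>\<open>g\<close> and \<open>h\<close> are the terms after multiplication by
    \<open>v\<close> and by \<open>u\<close>, reindexed to a common denominator. The values
    \<open>g i 0\<close> and \<open>h 0 j\<close> vanish, so the reindexed series may start at 0;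
    the denominator is positive unless \<open>i = j = 0\<close>.\<close>
  define g where "g i j = real j * (a - 1 + real j) * Y j / (a - 1 + real i + real j)" for i j :: nat
  define h where "h i j = real i * (a - 1 + real i) * Y j / (a - 1 + real i + real j)" for i j :: nat
  define S where "S = (\<Sum>j. (1 + real j)\<^sup>2 * \<bar>Y j\<bar>)"
  have sumS: "summable (\<lambda>j. (1 + real j)\<^sup>2 * \<bar>Y j\<bar>)"
    unfolding Y_def by (rule bessel_series_summable[OF a])
  have sumY: "summable f" if "\<And>j. \<bar>f j\<bar> \<le> (1 + real j)\<^sup>2 * \<bar>Y j\<bar> * C" for f C
    using bessel_series_dominated_summable[OF a, of f v C] that by (simp add: Y_def)
  have sumX: "summable f" if "\<And>j. \<bar>f j\<bar> \<le> (1 + real j)\<^sup>2 * \<bar>X j\<bar> * C" for f C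
    using bessel_series_dominated_summable[OF a, of f u C] that by (simp add: X_def)
  have one_le: "1 \<le> (1 + real j)\<^sup>2" "real j \<le> (1 + real j)\<^sup>2" for j
    by (auto simp: power2_eq_square algebra_simps)
  have S_bound: "\<bar>suminf f\<bar> \<le> S * C" if le: "\<And>j. \<bar>f j\<bar> \<le> (1 + real j)\<^sup>2 * \<bar>Y j\<bar> * C" for f C
  proof -
    have s: "summable (\<lambda>j. \<bar>f j\<bar>)" by (rule sumY[of _ C]) (use le in simp)
    have "\<bar>suminf f\<bar> \<le> (\<Sum>j. \<bar>f j\<bar>)" by (rule summable_rabs[OF s])
    also have "\<dots> \<le> (\<Sum>j. (1 + real j)\<^sup>2 * \<bar>Y j\<bar> * C)"
      by (rule suminf_le[OF le s summable_mult2[OF sumS]])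
    also have "\<dots> = S * C" unfolding S_def by (rule suminf_mult2[OF sumS, symmetric])
    finally show ?thesis .
  qed
  have g_le: "\<bar>g i j\<bar> \<le> (1 + real j)\<^sup>2 * \<bar>Y j\<bar> * 1" for i j
  proof (cases "j = 0")
    case False
    then have pos: "0 < a - 1 + real j" using a by simp
    have "\<bar>g i j\<bar> = real j * \<bar>Y j\<bar> * ((a - 1 + real j) / (a - 1 + real i + real j))"
      using pos by (simp add: g_def abs_mult abs_divide)
    also have "\<dots> \<le> real j * \<bar>Y j\<bar> * 1" using pos by (intro mult_left_mono) auto
    also have "\<dots> \<le> (1 + real j)\<^sup>2 * \<bar>Y j\<bar> * 1" using one_le[of j] by (intro mult_right_mono) auto
    finally show ?thesis .
  qed (simp add: g_def)
  have h_le: "\<bar>h i j\<bar> \<le> (1 + real j)\<^sup>2 * \<bar>Y j\<bar> * real i" for i j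
  proof (cases "i = 0")
    case False
    then have pos: "0 < a - 1 + real i" using a by simp
    have "\<bar>h i j\<bar> = real i * \<bar>Y j\<bar> * ((a - 1 + real i) / (a - 1 + real i + real j))"
      using pos by (simp add: h_def abs_mult abs_divide)
    also have "\<dots> \<le> real i * \<bar>Y j\<bar> * 1" using pos by (intro mult_left_mono) auto
    also have "\<dots> \<le> (1 + real j)\<^sup>2 * (\<bar>Y j\<bar> * real i)"
    proof -
      have "1 * (\<bar>Y j\<bar> * real i) \<le> (1 + real j)\<^sup>2 * (\<bar>Y j\<bar> * real i)"
        by (intro mult_right_mono one_le) auto
      then show ?thesis by (simp add: mult_ac)
    qed
    finally show ?thesis by (simp add: mult_ac)
  qed (simp add: h_def)
  have sum_g: "summable (g i)" and sum_h: "summable (h i)" for i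
    using sumY[of "g i", OF g_le] sumY[of "h i", OF h_le] by blast+
  have I_le: "\<bar>Y j / (a + real i + real j)\<bar> \<le> (1 + real j)\<^sup>2 * \<bar>Y j\<bar> * (1 / a)" for i j
  proof -
    have "\<bar>Y j / (a + real i + real j)\<bar> \<le> \<bar>Y j\<bar> / a" by (rule abs_div_le[OF a]) simp
    also have "\<dots> = 1 * \<bar>Y j\<bar> * (1 / a)" by simp
    also have "\<dots> \<le> (1 + real j)\<^sup>2 * \<bar>Y j\<bar> * (1 / a)"
      using a by (intro mult_right_mono one_le) auto
    finally show ?thesis .
  qed
  have sum_I: "summable (\<lambda>j. Y j / (a + real i + real j))" for i by (rule sumY[OF I_le])
  have vI: "v * I i = - (\<Sum>j. g i j)" for i
  proof -
    have "v * I i = (\<Sum>j. v * (Y j / (a + real i + real j)))"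
      unfolding I_def by (rule suminf_mult[OF sum_I, symmetric])
    also have "\<dots> = (\<Sum>j. - g i (Suc j))"
    proof (rule suminf_cong)
      fix j
      have "v * (Y j / (a + real i + real j)) = v * Y j / (a + real i + real j)" by simp
      also have "v * Y j = - (real (Suc j) * (a + real j) * Y (Suc j))"
        unfolding Y_def by (rule bessel_series_rec[OF a])
      finally show "v * (Y j / (a + real i + real j)) = - g i (Suc j)" by (simp add: g_def)
    qed
    also have "\<dots> = - (\<Sum>j. g i (Suc j))"
      using sum_g[of i] by (intro suminf_minus) (simp add: summable_Suc_iff)
    also have "(\<Sum>j. g i (Suc j)) = (\<Sum>j. g i j)"
    proof -
      have "g i 0 = 0" by (simp add: g_def)
      then show ?thesis using suminf_split_head[OF sum_g[of i]] by simp
    qed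
    finally show ?thesis .
  qed
  define H where "H i = X i * (\<Sum>j. h i j)" for i
  have H_Suc: "u * (X i * I i) = - H (Suc i)" for i
  proof -
    have "(\<Sum>j. h (Suc i) j) = real (Suc i) * (a + real i) * I i"
    proof -
      have "h (Suc i) j = real (Suc i) * (a + real i) * (Y j / (a + real i + real j))" for j
        by (simp add: h_def)
      then show ?thesis unfolding I_def by (simp only: suminf_mult[OF sum_I])
    qed
    moreover have "u * X i = - (real (Suc i) * (a + real i) * X (Suc i))"
      unfolding X_def by (rule bessel_series_rec[OF a])
    ultimately show ?thesis unfolding H_def by (simp only: mult.assoc[symmetric]) (simp add: mult_ac)
  qed
  have S0: "0 \<le> S" unfolding S_def by (intro suminf_nonneg sumS) auto
  \<comment> \<open>The inner sums grow at most linearly in \<open>i\<close>, so the quadratic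
    weight suffices for the outer series.\<close>
  have sum_outer: "summable (\<lambda>i. X i * G i)" if G: "\<And>i. \<bar>G i\<bar> \<le> S * (C * (1 + real i))" and "0 \<le> C" for G C
  proof (rule sumX)
    fix i
    have "\<bar>X i * G i\<bar> \<le> \<bar>X i\<bar> * (S * (C * (1 + real i)\<^sup>2))"
      unfolding abs_mult using S0 that(2)
      by (intro mult_left_mono order_trans[OF G]) (auto simp: power2_eq_square algebra_simps)
    then show "\<bar>X i * G i\<bar> \<le> (1 + real i)\<^sup>2 * \<bar>X i\<bar> * (S * C)" by (simp add: mult_ac)
  qed
  have widen: "\<bar>r\<bar> \<le> S * (C * (1 + real i))" if "\<bar>r\<bar> \<le> S * D" "D \<le> C * (1 + real i)" for r C D i
    using that mult_left_mono[OF that(2) S0] by linarith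
  have sum_XI: "summable (\<lambda>i. X i * I i)"
    unfolding I_def by (rule sum_outer[where C = "1 / a", OF widen[OF S_bound[OF I_le]]]) (use a in \<open>auto simp: field_simps\<close>)
  have sum_G: "summable (\<lambda>i. X i * (\<Sum>j. g i j))"
    by (rule sum_outer[where C = 1, OF widen[OF S_bound[OF g_le]]]) auto
  have sum_H: "summable H"
    unfolding H_def by (rule sum_outer[where C = 1, OF widen[OF S_bound[OF h_le]]]) auto
  have form: "bessel_form a u v = (\<Sum>i. X i * I i)"
    by (simp add: bessel_form_def cauchy_form_def X_def I_def Y_def)
  have "u * bessel_form a u v = (\<Sum>i. u * (X i * I i))"
    unfolding form by (rule suminf_mult[OF sum_XI, symmetric])
  also have "\<dots> = - (\<Sum>i. H (Suc i))"
    unfolding H_Suc using sum_H by (intro suminf_minus) (simp add: summable_Suc_iff)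
  also have "(\<Sum>i. H (Suc i)) = (\<Sum>i. H i)"
  proof -
    have "h 0 = (\<lambda>j. 0)" by (rule ext) (simp add: h_def)
    then have "H 0 = 0" by (simp add: H_def)
    then show ?thesis using suminf_split_head[OF sum_H] by simp
  qed
  finally have u_form: "u * bessel_form a u v = - (\<Sum>i. H i)" .
  have "v * bessel_form a u v = (\<Sum>i. v * (X i * I i))"
    unfolding form by (rule suminf_mult[OF sum_XI, symmetric])
  also have "\<dots> = (\<Sum>i. - (X i * (\<Sum>j. g i j)))"
    using vI by (intro suminf_cong) (simp add: mult.left_commute[of v])
  also have "\<dots> = - (\<Sum>i. X i * (\<Sum>j. g i j))" by (rule suminf_minus[OF sum_G])
  finally have v_form: "v * bessel_form a u v = - (\<Sum>i. X i * (\<Sum>j. g i j))" .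
  have sY: "summable Y"
    by (rule sumY[of _ 1]) (use mult_right_mono[OF one_le(1) abs_ge_zero] in simp)
  have sX: "summable X"
    by (rule sumX[of _ 1]) (use mult_right_mono[OF one_le(1) abs_ge_zero] in simp)
  have sjY: "summable (\<lambda>j. real j * Y j)"
    by (rule sumY[of _ 1]) (use one_le in \<open>auto simp: abs_mult intro!: mult_right_mono\<close>)
  have sjX: "summable (\<lambda>j. real j * X j)"
    by (rule sumX[of _ 1]) (use one_le in \<open>auto simp: abs_mult intro!: mult_right_mono\<close>)
  have "(u - v) * bessel_form a u v = (\<Sum>i. X i * (\<Sum>j. g i j)) - (\<Sum>i. H i)"
    unfolding left_diff_distrib u_form v_form by simp
  also have "\<dots> = (\<Sum>i. X i * (\<Sum>j. g i j) - H i)" by (rule suminf_diff[OF sum_G sum_H])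
  also have "\<dots> = (\<Sum>i. X i * bessel_theta a v - real i * X i * bessel_phi a v)"
  proof (rule suminf_cong)
    fix i
    have "(\<Sum>j. g i j) - (\<Sum>j. h i j) = (\<Sum>j. g i j - h i j)" by (rule suminf_diff[OF sum_g sum_h])
    also have "\<dots> = (\<Sum>j. real j * Y j - real i * Y j)"
    proof (rule suminf_cong)
      fix j
      show "g i j - h i j = real j * Y j - real i * Y j"
      proof (cases "i = 0 \<and> j = 0")
        case False
        then have "1 \<le> i + j" by auto
        then have "1 \<le> real i + real j" by (metis of_nat_1 of_nat_add of_nat_le_iff)
        then have ne: "a - 1 + real i + real j \<noteq> 0" using a by linarith
        have "g i j - h i j = (real j * (a - 1 + real j) - real i * (a - 1 + real i)) * Y j / (a - 1 + real i + real j)"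
          by (simp add: g_def h_def diff_divide_distrib left_diff_distrib)
        also have "real j * (a - 1 + real j) - real i * (a - 1 + real i) = (real j - real i) * (a - 1 + real i + real j)"
          by (simp add: algebra_simps)
        finally have "g i j - h i j = (real j - real i) * Y j" using ne by simp
        then show ?thesis by (simp add: left_diff_distrib)
      qed (simp add: g_def h_def)
    qed
    also have "\<dots> = (\<Sum>j. real j * Y j) - (\<Sum>j. real i * Y j)"
      by (rule suminf_diff[OF sjY summable_mult[OF sY], symmetric])
    also have "\<dots> = bessel_theta a v - real i * bessel_phi a v"
      by (simp add: bessel_theta_def bessel_phi_def Y_def[symmetric] suminf_mult[OF sY])
    finally have "(\<Sum>j. g i j) - (\<Sum>j. h i j) = bessel_theta a v - real i * bessel_phi a v" .
    then have "X i * ((\<Sum>j. g i j) - (\<Sum>j. h i j)) = X i * (bessel_theta a v - real i * bessel_phi a v)" by simp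
    then show "X i * (\<Sum>j. g i j) - H i = X i * bessel_theta a v - real i * X i * bessel_phi a v"
      by (simp add: H_def algebra_simps)
  qed
  also have "\<dots> = (\<Sum>i. X i * bessel_theta a v) - (\<Sum>i. real i * X i * bessel_phi a v)"
    by (rule suminf_diff[OF summable_mult2[OF sX] summable_mult2[OF sjX], symmetric])
  also have "\<dots> = bessel_phi a u * bessel_theta a v - bessel_theta a u * bessel_phi a v"
    by (simp add: suminf_mult2[OF sX, symmetric] suminf_mult2[OF sjX, symmetric] bessel_phi_def[of a u] bessel_theta_def[of a u] X_def[symmetric])
  finally show ?thesis .
qed

section \<open>The Bessel function and its derivative in terms of the series\<close>

lemma bessel_J_eq: "bessel_J \<alpha> z = rpow (z / 2) \<alpha> * bessel_phi (\<alpha> + 1) (z\<^sup>2 / 4)"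
proof -
  have "(-1) ^ k / (fact k * Gamma (real k + \<alpha> + 1)) * (z / 2) ^ (2 * k) = bessel_series (\<alpha> + 1) (z\<^sup>2 / 4) k" for k
  proof -
    have "(z / 2) ^ (2 * k) = (z\<^sup>2 / 4) ^ k" by (simp add: power_mult power_divide)
    moreover have "(- (z\<^sup>2 / 4)) ^ k = (-1) ^ k * (z\<^sup>2 / 4) ^ k" by (rule power_minus)
    moreover have "real k + \<alpha> + 1 = \<alpha> + 1 + real k" by simp
    ultimately show ?thesis unfolding bessel_series_def bessel_coeff_def by (simp only:) simp
  qed
  then show ?thesis by (simp add: bessel_J_def bessel_phi_def)
qed

lemma bessel_phi_deriv:
  assumes a: "0 < a" and u: "u \<noteq> 0"
  shows "(bessel_phi a has_field_derivative bessel_theta a u / u) (at u)"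
proof -
  define c where "c i = bessel_coeff a i * (-1) ^ i" for i
  have ser: "bessel_series a x i = c i * x ^ i" for x i
    unfolding bessel_series_def c_def power_minus[of x] by simp
  have sum: "summable (\<lambda>i. c i * x ^ i)" for x
  proof -
    have "\<bar>bessel_series a x j\<bar> \<le> (1 + real j)\<^sup>2 * \<bar>bessel_series a x j\<bar> * 1" for j
    proof -
      have "1 * \<bar>bessel_series a x j\<bar> \<le> (1 + real j)\<^sup>2 * \<bar>bessel_series a x j\<bar>"
        by (intro mult_right_mono) (auto simp: power2_eq_square algebra_simps)
      then show ?thesis by simp
    qed
    from bessel_series_dominated_summable[OF a this] show ?thesis by (simp add: ser[symmetric])
  qed
  have "((\<lambda>x. \<Sum>i. c i * x ^ i) has_field_derivative (\<Sum>i. diffs c i * u ^ i)) (at u)"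
    by (rule termdiffs_strong_converges_everywhere[OF sum])
  moreover have "(\<Sum>i. diffs c i * u ^ i) = bessel_theta a u / u"
  proof -
    have "summable (\<lambda>i. diffs c i * u ^ i)" by (rule termdiff_converges_all[OF sum])
    then have "(\<lambda>i. of_nat i * c i * u ^ (i - Suc 0)) sums (\<Sum>i. diffs c i * u ^ i)" by (rule diffs_equiv)
    then have "(\<lambda>i. of_nat i * c i * u ^ (i - Suc 0) * u) sums ((\<Sum>i. diffs c i * u ^ i) * u)" by (rule sums_mult2)
    moreover have "of_nat i * c i * u ^ (i - Suc 0) * u = real i * bessel_series a u i" for i
      by (cases i) (simp_all add: ser)
    ultimately have "(\<Sum>i. diffs c i * u ^ i) * u = bessel_theta a u"
      unfolding bessel_theta_def by (simp add: sums_iff)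
    then show ?thesis using u by (simp add: field_simps)
  qed
  moreover have "bessel_phi a = (\<lambda>x. \<Sum>i. c i * x ^ i)"
    by (rule ext) (simp add: bessel_phi_def ser)
  ultimately show ?thesis by simp
qed

text \<open>With \<open>u = z ^ 2 / 4\<close> the operator \<open>z d/dz\<close> becomes
  \<open>2 u d/du\<close>, hence the factor 2 at \<open>bessel_theta\<close>.\<close>

lemma bessel_J_deriv:
  assumes \<alpha>: "-1 < \<alpha>" and z: "0 < z"
  shows "z * deriv (bessel_J \<alpha>) z
     = (z / 2) powr \<alpha> * (\<alpha> * bessel_phi (\<alpha> + 1) (z\<^sup>2 / 4) + 2 * bessel_theta (\<alpha> + 1) (z\<^sup>2 / 4))"
proof -
  have d: "((\<lambda>x. (x / 2) powr \<alpha> * bessel_phi (\<alpha> + 1) (x\<^sup>2 / 4)) has_field_derivative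
      (\<alpha> * (z / 2) powr (\<alpha> - 1) * (1 / 2) * bessel_phi (\<alpha> + 1) (z\<^sup>2 / 4)
       + bessel_theta (\<alpha> + 1) (z\<^sup>2 / 4) / (z\<^sup>2 / 4) * (z / 2) * (z / 2) powr \<alpha>)) (at z)"
  proof (rule DERIV_mult)
    show "((\<lambda>x. (x / 2) powr \<alpha>) has_field_derivative \<alpha> * (z / 2) powr (\<alpha> - 1) * (1 / 2)) (at z)"
      using z by (auto intro!: derivative_eq_intros simp: powr_diff field_simps)
    have "((\<lambda>x. x\<^sup>2 / 4) has_field_derivative (z / 2)) (at z)"
      by (auto intro!: derivative_eq_intros)
    then show "((\<lambda>x. bessel_phi (\<alpha> + 1) (x\<^sup>2 / 4)) has_field_derivative
       bessel_theta (\<alpha> + 1) (z\<^sup>2 / 4) / (z\<^sup>2 / 4) * (z / 2)) (at z)"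
      using \<alpha> z by (intro DERIV_chain2[OF bessel_phi_deriv]) auto
  qed
  have "eventually (\<lambda>x. x \<in> {0<..}) (nhds z)" using z by (intro eventually_nhds_in_open) auto
  then have ev: "eventually (\<lambda>x. bessel_J \<alpha> x = (x / 2) powr \<alpha> * bessel_phi (\<alpha> + 1) (x\<^sup>2 / 4)) (nhds z)"
    by eventually_elim (auto simp: bessel_J_eq rpow_def)
  have "deriv (bessel_J \<alpha>) z = \<alpha> * (z / 2) powr (\<alpha> - 1) * (1 / 2) * bessel_phi (\<alpha> + 1) (z\<^sup>2 / 4)
       + bessel_theta (\<alpha> + 1) (z\<^sup>2 / 4) / (z\<^sup>2 / 4) * (z / 2) * (z / 2) powr \<alpha>"
    using d ev by (simp add: deriv_cong_ev[OF ev refl] DERIV_imp_deriv)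
  moreover have "z * (\<alpha> * (z / 2) powr (\<alpha> - 1) * (1 / 2) * p + t / (z\<^sup>2 / 4) * (z / 2) * (z / 2) powr \<alpha>)
     = (z / 2) powr \<alpha> * (\<alpha> * p + 2 * t)" for p t
  proof -
    have "(z / 2) powr \<alpha> = (z / 2) * (z / 2) powr (\<alpha> - 1)" using z by (simp add: powr_diff)
    then have "z * (\<alpha> * (z / 2) powr (\<alpha> - 1) * (1 / 2) * p) = (z / 2) powr \<alpha> * (\<alpha> * p)" by simp
    moreover have "z * (t / (z\<^sup>2 / 4) * (z / 2) * (z / 2) powr \<alpha>) = (z / 2) powr \<alpha> * (2 * t)"
      using z by (simp add: power2_eq_square)
    ultimately show ?thesis by (simp only: distrib_left)
  qed
  ultimately show ?thesis by (simp only:)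
qed

section \<open>Closed form of the Bessel kernel\<close>

text \<open>The Bessel kernel without a removable singularity: the formula makes sense on the
  diagonal too, and on the axes when \<open>\<alpha> \<ge> 0\<close>. The power of 4 collects a
  factor \<open>2 powr \<alpha>\<close> from each \<open>sqrt x / 2\<close> and a 4 from the
  difference of \<open>s / 4\<close> and \<open>t / 4\<close>.\<close>

definition hard_edge_kernel :: "real \<Rightarrow> real \<Rightarrow> real \<Rightarrow> real" where
  "hard_edge_kernel \<alpha> s t = rpow s (\<alpha> / 2) * rpow t (\<alpha> / 2) * bessel_form (\<alpha> + 1) (s / 4) (t / 4) / 4 powr (\<alpha> + 1)"

text \<open>In the numerator the terms with the factor \<alpha> cancel, and the Christoffel-Darboux
  identity at \<open>s / 4\<close> and \<open>t / 4\<close> evaluates what is left.\<close>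

lemma bessel_kernel_quotient_eq:
  assumes \<alpha>: "-1 < \<alpha>" and st: "0 < s" "0 < t" "s \<noteq> t"
  shows "bessel_kernel_quotient \<alpha> s t = hard_edge_kernel \<alpha> s t"
proof -
  define f where "f = bessel_phi (\<alpha> + 1)"
  define th where "th = bessel_theta (\<alpha> + 1)"
  define B where "B = bessel_form (\<alpha> + 1) (s / 4) (t / 4)"
  have J: "bessel_J \<alpha> (sqrt x) = (sqrt x / 2) powr \<alpha> * f (x / 4)"
    "sqrt x * deriv (bessel_J \<alpha>) (sqrt x) = (sqrt x / 2) powr \<alpha> * (\<alpha> * f (x / 4) + 2 * th (x / 4))"
    if "0 < x" for x
    using that bessel_J_deriv[OF \<alpha>, of "sqrt x"] by (auto simp: bessel_J_eq rpow_def f_def th_def)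
  have root: "(sqrt x / 2) powr \<alpha> = rpow x (\<alpha> / 2) / 2 powr \<alpha>" if "0 < x" for x
  proof -
    have "sqrt x = x powr (1 / 2)" using that by (simp add: powr_half_sqrt)
    then have "sqrt x powr \<alpha> = x powr (\<alpha> / 2)" by (simp only: powr_powr) simp
    moreover have "(sqrt x / 2) powr \<alpha> = sqrt x powr \<alpha> / 2 powr \<alpha>" by (rule powr_divide)
    ultimately show ?thesis using that by (simp add: rpow_def)
  qed
  have CD: "(s - t) * B = 4 * (f (s / 4) * th (t / 4) - th (s / 4) * f (t / 4))"
    using bessel_form_christoffel_darboux[of "\<alpha> + 1" "s / 4" "t / 4"] \<alpha>
    by (simp add: B_def f_def th_def diff_divide_distrib[symmetric])
  define A where "A = (sqrt s / 2) powr \<alpha>"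
  define C where "C = (sqrt t / 2) powr \<alpha>"
  have "bessel_kernel_quotient \<alpha> s t = (A * f (s / 4) * (C * (\<alpha> * f (t / 4) + 2 * th (t / 4)))
      - C * f (t / 4) * (A * (\<alpha> * f (s / 4) + 2 * th (s / 4)))) / (2 * (s - t))"
    unfolding bessel_kernel_quotient_def using J[OF st(1)] J[OF st(2)]
    by (simp add: A_def C_def mult.assoc)
  also have "A * f (s / 4) * (C * (\<alpha> * f (t / 4) + 2 * th (t / 4)))
      - C * f (t / 4) * (A * (\<alpha> * f (s / 4) + 2 * th (s / 4)))
     = A * C * 2 * (f (s / 4) * th (t / 4) - th (s / 4) * f (t / 4))"
    by (simp add: algebra_simps)
  also have "\<dots> / (2 * (s - t)) = A * C / 4 * B"
  proof -
    have "f (s / 4) * th (t / 4) - th (s / 4) * f (t / 4) = (s - t) * B / 4" using CD by simp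
    moreover define r where "r = s - t"
    moreover have "r \<noteq> 0" using st(3) by (simp add: r_def)
    ultimately show ?thesis unfolding r_def[symmetric] by (simp only:) simp
  qed
  also have "\<dots> = hard_edge_kernel \<alpha> s t"
  proof -
    have "4 powr (\<alpha> + 1) = 2 powr \<alpha> * 2 powr \<alpha> * (4::real)"
    proof -
      have "4 powr \<alpha> = (2 * 2 :: real) powr \<alpha>" by simp
      also have "\<dots> = 2 powr \<alpha> * 2 powr \<alpha>" by (rule powr_mult)
      finally show ?thesis by (simp add: powr_add)
    qed
    then show ?thesis
      unfolding hard_edge_kernel_def A_def C_def root[OF st(1)] root[OF st(2)] B_def by simp
  qed
  finally show ?thesis .
qed

lemma rpow_tendsto:
  assumes f: "(f \<longlongrightarrow> x) F" and "eventually (\<lambda>y. 0 \<le> f y) F" and "0 < x \<or> 0 \<le> g"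
  shows "((\<lambda>y. rpow (f y) g) \<longlongrightarrow> rpow x g) F"
proof (cases "g = 0")
  case False
  with assms have "((\<lambda>y. f y powr g) \<longlongrightarrow> x powr g) F"
    by (intro tendsto_powr' tendsto_const) auto
  with False show ?thesis by (simp add: rpow_def)
qed (simp add: rpow_def)

lemma isCont_bessel_form:
  assumes a: "0 < a"
  shows "isCont (\<lambda>(u, v). bessel_form a u v) (u, v)"
  unfolding continuous_at_sequentially
proof (intro allI impI)
  fix x :: "nat \<Rightarrow> real \<times> real" assume x: "x \<longlonglongrightarrow> (u, v)"
  have "(\<lambda>n. bessel_form a (fst (x n)) (snd (x n))) \<longlonglongrightarrow> bessel_form a u v"
    using tendsto_fst[OF x] tendsto_snd[OF x] by (intro bessel_form_tendsto[OF a]) auto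
  then show "((\<lambda>(u, v). bessel_form a u v) \<circ> x) \<longlonglongrightarrow> (case (u, v) of (u, v) \<Rightarrow> bessel_form a u v)"
    by (simp add: o_def case_prod_beta)
qed

lemma hard_edge_kernel_tendsto:
  assumes \<alpha>: "-1 < \<alpha>" and uv: "0 \<le> u" "0 \<le> v" "0 \<le> \<alpha> \<or> (0 < u \<and> 0 < v)"
    and f: "(f \<longlongrightarrow> u) F" "eventually (\<lambda>x. 0 \<le> f x) F" and g: "(g \<longlongrightarrow> v) F" "eventually (\<lambda>x. 0 \<le> g x) F"
  shows "((\<lambda>x. hard_edge_kernel \<alpha> (f x) (g x)) \<longlongrightarrow> hard_edge_kernel \<alpha> u v) F"
proof -
  have "((\<lambda>x. (f x / 4, g x / 4)) \<longlongrightarrow> (u / 4, v / 4)) F"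
    by (intro tendsto_intros f g) auto
  then have "((\<lambda>x. case (f x / 4, g x / 4) of (u, v) \<Rightarrow> bessel_form (\<alpha> + 1) u v)
     \<longlongrightarrow> (case (u / 4, v / 4) of (u, v) \<Rightarrow> bessel_form (\<alpha> + 1) u v)) F"
    using \<alpha> by (intro isCont_tendsto_compose[OF isCont_bessel_form]) auto
  then have "((\<lambda>x. bessel_form (\<alpha> + 1) (f x / 4) (g x / 4)) \<longlongrightarrow> bessel_form (\<alpha> + 1) (u / 4) (v / 4)) F" by simp
  moreover have "((\<lambda>x. rpow (f x) (\<alpha> / 2)) \<longlongrightarrow> rpow u (\<alpha> / 2)) F" "((\<lambda>x. rpow (g x) (\<alpha> / 2)) \<longlongrightarrow> rpow v (\<alpha> / 2)) F"
    using uv by (auto intro!: rpow_tendsto f g)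
  ultimately show ?thesis
    unfolding hard_edge_kernel_def by (intro tendsto_divide tendsto_mult tendsto_const) auto
qed

text \<open>On the diagonal and the axes the kernel is a \<open>Lim\<close>. The limit exists by
  continuity of the closed form, and it is determined because the point is a limit point of the
  off-diagonal quadrant.\<close>

theorem bessel_kernel_eq:
  assumes \<alpha>: "-1 < \<alpha>" and uv: "0 \<le> u" "0 \<le> v" "0 \<le> \<alpha> \<or> (0 < u \<and> 0 < v)"
  shows "bessel_kernel \<alpha> u v = hard_edge_kernel \<alpha> u v"
proof (cases "0 < u \<and> 0 < v \<and> u \<noteq> v")
  case True
  then show ?thesis using bessel_kernel_quotient_eq[OF \<alpha>] by (simp add: bessel_kernel_def)
next
  case False
  define D where "D = {(s, t). 0 < s \<and> 0 < t \<and> s \<noteq> (t::real)}"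
  have in_D: "eventually (\<lambda>x. x \<in> D) (at (u, v) within D)" by (simp add: eventually_at_filter)
  have "((\<lambda>x. hard_edge_kernel \<alpha> (fst x) (snd x)) \<longlongrightarrow> hard_edge_kernel \<alpha> u v) (at (u, v) within D)"
  proof (rule hard_edge_kernel_tendsto[OF \<alpha> uv])
    show "((fst :: real \<times> real \<Rightarrow> real) \<longlongrightarrow> u) (at (u, v) within D)" "((snd :: real \<times> real \<Rightarrow> real) \<longlongrightarrow> v) (at (u, v) within D)"
      using tendsto_fst[OF tendsto_ident_at, of "(u, v)" D] tendsto_snd[OF tendsto_ident_at, of "(u, v)" D] by simp_all
    show "eventually (\<lambda>x. 0 \<le> fst x) (at (u, v) within D)" "eventually (\<lambda>x. 0 \<le> snd x) (at (u, v) within D)"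
      by (rule eventually_mono[OF in_D], force simp: D_def)+
  qed
  moreover have "eventually (\<lambda>x. hard_edge_kernel \<alpha> (fst x) (snd x) = (case x of (s, t) \<Rightarrow> bessel_kernel_quotient \<alpha> s t)) (at (u, v) within D)"
    using in_D by eventually_elim (auto simp: D_def bessel_kernel_quotient_eq[OF \<alpha>])
  ultimately have lim: "((\<lambda>(s, t). bessel_kernel_quotient \<alpha> s t) \<longlongrightarrow> hard_edge_kernel \<alpha> u v) (at (u, v) within D)"
    by (rule Lim_transform_eventually)
  have "(u, v) islimpt D"
    unfolding islimpt_approachable
  proof (intro allI impI)
    fix e :: real assume e: "0 < e"
    \<comment> \<open>Of the two candidate shifts of \<open>v\<close>, at most one lands on the
      diagonal.\<close>
    have "u + e / 4 \<noteq> v + e / 3 \<or> u + e / 4 \<noteq> v + e / 2" using e by linarith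
    then obtain d where d: "d = e / 3 \<or> d = e / 2" "u + e / 4 \<noteq> v + d" by metis
    have "dist (u + e / 4, v + d) (u, v) \<le> \<bar>e / 4\<bar> + \<bar>d\<bar>"
      using sqrt_sum_squares_le_sum_abs[of "e / 4" d] e by (simp add: dist_prod_def dist_real_def)
    also have "\<dots> < e" using d e by auto
    finally show "\<exists>x'\<in>D. x' \<noteq> (u, v) \<and> dist x' (u, v) < e"
      using d e uv by (intro bexI[of _ "(u + e / 4, v + d)"]) (auto simp: D_def)
  qed
  then have "\<not> trivial_limit (at (u, v) within D)" by (simp add: trivial_limit_within)
  then have "Lim (at (u, v) within D) (\<lambda>(s, t). bessel_kernel_quotient \<alpha> s t) = hard_edge_kernel \<alpha> u v"
    by (rule tendsto_Lim[OF _ lim])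
  then show ?thesis using False by (auto simp: bessel_kernel_def D_def)
qed

section \<open>The universality limit\<close>

text \<open>Regularity speaks of some orthonormal system; this transfers it to \<open>p\<close>.
  With \<open>r n = l p n + D\<close> and \<open>D\<close> of lower degree, the norm of
  \<open>r n\<close> forces \<open>l ^ 2 = 1\<close>; the locale leaves the sign of \<open>l\<close>
  open.\<close>

lemma (in orthonormal_system) abs_lead_coeff_unique:
  assumes "orthonormal_system M r"
  shows "\<bar>lead_coeff (r n)\<bar> = \<bar>lead_coeff (p n)\<bar>"
proof -
  interpret R: orthonormal_system M r by fact
  have nz: "coeff (p n) n \<noteq> 0" using leading_coeff_neq_0[OF p_nz[of n]] by simp
  define l where "l = coeff (r n) n / coeff (p n) n"
  define D where "D = r n - smult l (p n)"
  have D0: "D = 0 \<or> degree D < n"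
  proof -
    have "coeff D n = 0" using nz by (simp add: D_def l_def)
    moreover have "degree D \<le> n" unfolding D_def
      by (intro degree_diff_le) (auto intro: order_trans[OF degree_smult_le])
    ultimately show ?thesis by (metis eq_zero_or_degree_less)
  qed
  have pD: "(LINT x|M. poly (p n) x * poly D x) = 0" and rD: "(LINT x|M. poly (r n) x * poly D x) = 0"
    using D0 orthogonal_lower_degree[of D n] R.orthogonal_lower_degree[of D n] by auto
  have r: "poly (r n) x = l * poly (p n) x + poly D x" for x by (simp add: D_def)
  have "(LINT x|M. poly (p n) x * poly (r n) x) = (LINT x|M. l * (poly (p n) x * poly (p n) x) + poly (p n) x * poly D x)"
    by (simp add: r algebra_simps)
  also have "\<dots> = l"
    using integrable_poly_mult[of "p n" "p n"] integrable_poly_mult[of "p n" D] by (simp add: pD orthonormal)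
  finally have pr: "(LINT x|M. poly (p n) x * poly (r n) x) = l" .
  have "1 = (LINT x|M. poly (r n) x * poly (r n) x)" by (simp add: R.orthonormal)
  also have "\<dots> = (LINT x|M. l * (poly (p n) x * poly (r n) x) + poly (r n) x * poly D x)"
    by (rule Bochner_Integration.integral_cong) (simp_all add: r algebra_simps)
  also have "\<dots> = l * l"
    using integrable_poly_mult[of "p n" "r n"] integrable_poly_mult[of "r n" D] by (simp add: rD pr)
  finally have "\<bar>l\<bar> = 1" by (metis abs_mult_self_eq abs_1 abs_square_eq_1 power2_eq_square)
  then show ?thesis using nz by (simp add: l_def abs_divide divide_eq_eq)
qed

lemma root_limit_imp_exp_bound:
  fixes g :: "nat \<Rightarrow> real"
  assumes pos: "\<And>n. 0 < g n" and lim: "(\<lambda>n. root n (g n)) \<longlonglongrightarrow> 2" and \<delta>: "0 < \<delta>"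
  shows "\<exists>C. \<forall>n. \<bar>g n\<bar> \<le> exp (C + \<delta> * n) * 2 ^ n"
proof -
  have "2 < 2 * exp \<delta>" using \<delta> by simp
  from order_tendstoD(2)[OF lim this]
  obtain N where N: "\<And>n. N \<le> n \<Longrightarrow> root n (g n) < 2 * exp \<delta>" by (auto simp: eventually_sequentially)
  \<comment> \<open>\<open>Suc N\<close> puts \<open>n = 0\<close>, where \<open>root\<close>
    carries no information, among the finitely many terms absorbed in \<open>B\<close>.\<close>
  define B where "B = 1 + (\<Sum>k<Suc N. g k)"
  have B: "1 \<le> B" unfolding B_def using pos by (simp add: sum_nonneg less_imp_le)
  have "g n \<le> B * (exp (\<delta> * n) * 2 ^ n)" for n
  proof -
    have big: "1 \<le> exp (\<delta> * n) * (2::real) ^ n"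
      using \<delta> mult_mono[of 1 "exp (\<delta> * n)" 1 "2 ^ n"] by simp
    show ?thesis
    proof (cases "n < Suc N")
      case True
      then have "g n \<le> (\<Sum>k<Suc N. g k)" by (intro member_le_sum less_imp_le pos) auto
      then have "g n \<le> B * 1" by (simp add: B_def)
      also have "\<dots> \<le> B * (exp (\<delta> * n) * 2 ^ n)" using big B by (intro mult_left_mono) auto
      finally show ?thesis .
    next
      case False
      then have n: "0 < n" "N \<le> n" by auto
      have "g n = root n (g n) ^ n" using n pos[of n] by (simp add: less_imp_le)
      also have "\<dots> \<le> (2 * exp \<delta>) ^ n" using N[OF n(2)] pos[of n] n by (intro power_mono) (auto simp: less_imp_le)
      also have "\<dots> = exp (\<delta> * n) * 2 ^ n"
        by (simp add: power_mult_distrib exp_of_nat_mult[symmetric] mult_ac)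
      also have "\<dots> \<le> B * (exp (\<delta> * n) * 2 ^ n)" using mult_right_mono[OF B, of "exp (\<delta> * n) * 2 ^ n"] by simp
      finally show ?thesis .
    qed
  qed
  moreover have "exp (ln B + \<delta> * n) * 2 ^ n = B * (exp (\<delta> * n) * 2 ^ n)" for n
    using B by (simp add: exp_add mult.assoc)
  ultimately have "\<bar>g n\<bar> \<le> exp (ln B + \<delta> * n) * 2 ^ n" for n
    using pos[of n] by (simp only: abs_of_pos)
  then show ?thesis by blast
qed

section \<open>From densities to domination near the endpoint\<close>

text \<open>The inequality on sets orders the two measures restricted to the interval, and the
  integral is monotone in the measure.\<close>

lemma dominated_near_oneI:
  assumes "interval_measure M" "interval_measure N"
    and dom: "\<And>\<epsilon>. 0 < \<epsilon> \<Longrightarrow> \<exists>\<delta>. 0 < \<delta> \<and> \<delta> < 2 \<and>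
      (\<forall>A\<in>sets borel. A \<subseteq> {1 - \<delta><..<1} \<longrightarrow> emeasure M A \<le> ennreal (1 + \<epsilon>) * emeasure N A)"
  shows "dominated_near_one M N"
  unfolding dominated_near_one_def
proof (intro allI impI)
  interpret M: interval_measure M by fact
  interpret N: interval_measure N by fact
  fix \<epsilon> :: real assume \<epsilon>: "0 < \<epsilon>"
  obtain \<delta> where \<delta>: "0 < \<delta>" "\<delta> < 2"
    and le: "\<And>A. A \<in> sets borel \<Longrightarrow> A \<subseteq> {1 - \<delta><..<1} \<Longrightarrow> emeasure M A \<le> ennreal (1 + \<epsilon>) * emeasure N A"
    using dom[OF \<epsilon>] by blast
  define I where "I = {1 - \<delta><..<1}"
  define M1 where "M1 = density M (indicator I)"
  define N1 where "N1 = density N (\<lambda>x. ennreal (1 + \<epsilon>) * indicator I x)"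
  have I: "I \<in> sets M" "I \<in> sets N" by (simp_all add: I_def M.sets_M N.sets_M)
  have "M1 \<le> N1"
  proof (rule le_measure[THEN iffD2])
    show "sets M1 = sets N1" by (simp add: M1_def N1_def M.sets_M N.sets_M)
    show "\<forall>A\<in>sets M1. emeasure M1 A \<le> emeasure N1 A"
    proof
      fix A assume "A \<in> sets M1"
      then have A: "A \<in> sets borel" by (simp add: M1_def M.sets_M)
      have "emeasure M1 A = (\<integral>\<^sup>+x. indicator I x * indicator A x \<partial>M)"
        unfolding M1_def using A I by (intro emeasure_density) (auto simp: M.sets_M)
      also have "\<dots> = (\<integral>\<^sup>+x. indicator (A \<inter> I) x \<partial>M)"
        by (intro nn_integral_cong) (auto simp: indicator_def)
      also have "\<dots> = emeasure M (A \<inter> I)" using A I by (intro nn_integral_indicator) (auto simp: M.sets_M)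
      also have "\<dots> \<le> ennreal (1 + \<epsilon>) * emeasure N (A \<inter> I)"
        using A by (intro le) (auto simp: I_def)
      also have "\<dots> = (\<integral>\<^sup>+x. ennreal (1 + \<epsilon>) * indicator (A \<inter> I) x \<partial>N)"
        using A I by (subst nn_integral_cmult_indicator) (auto simp: N.sets_M)
      also have "\<dots> = emeasure N1 A"
        unfolding N1_def using A I
        by (subst emeasure_density) (auto simp: N.sets_M indicator_inter_arith mult_ac)
      finally show "emeasure M1 A \<le> emeasure N1 A" .
    qed
  qed
  have "(LINT x|M. indicator {1 - \<delta><..} x * (poly P x)\<^sup>2) \<le> (1 + \<epsilon>) * (LINT x|N. (poly P x)\<^sup>2)" for P
  proof -
    define f where "f x = ennreal ((poly P x)\<^sup>2)" for x
    have f: "f \<in> borel_measurable borel"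
      unfolding f_def by (intro borel_measurable_continuous_onI measurable_compose[OF _ measurable_ennreal] continuous_intros)
    have fM: "f \<in> borel_measurable M" "f \<in> borel_measurable N"
      using f by (simp_all cong: measurable_cong_sets add: M.sets_M N.sets_M)
    have intM: "integrable M (\<lambda>x. indicator {1 - \<delta><..} x * (poly P x)\<^sup>2)"
      by (rule M.integrable_indicator_poly) simp
    have intN: "integrable N (\<lambda>x. (poly P x)\<^sup>2)" by (intro N.integrable_continuous continuous_intros)
    have "ennreal (LINT x|M. indicator {1 - \<delta><..} x * (poly P x)\<^sup>2) = (\<integral>\<^sup>+x. ennreal (indicator {1 - \<delta><..} x * (poly P x)\<^sup>2) \<partial>M)"
      by (rule nn_integral_eq_integral[OF intM, symmetric]) auto
    \<comment> \<open>The points from 1 on are null for \<open>M\<close>, so the half line may be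
      cut off there.\<close>
    also have "\<dots> = (\<integral>\<^sup>+x. indicator I x * f x \<partial>M)"
      using M.AE_in by (intro nn_integral_cong_AE, eventually_elim) (auto simp: I_def f_def indicator_def)
    also have "\<dots> = (\<integral>\<^sup>+x. f x \<partial>M1)"
      unfolding M1_def using I fM by (subst nn_integral_density) auto
    also have "\<dots> \<le> (\<integral>\<^sup>+x. f x \<partial>N1)"
      by (rule nn_integral_mono_measure[OF _ \<open>M1 \<le> N1\<close>]) (simp add: M1_def N1_def M.sets_M N.sets_M)
    also have "\<dots> = (\<integral>\<^sup>+x. ennreal (1 + \<epsilon>) * indicator I x * f x \<partial>N)"
      unfolding N1_def using I fM by (subst nn_integral_density) auto
    also have "\<dots> \<le> (\<integral>\<^sup>+x. ennreal (1 + \<epsilon>) * f x \<partial>N)"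
      by (intro nn_integral_mono) (auto simp: indicator_def)
    also have "\<dots> = ennreal (1 + \<epsilon>) * (\<integral>\<^sup>+x. f x \<partial>N)"
      using fM by (intro nn_integral_cmult)
    also have "(\<integral>\<^sup>+x. f x \<partial>N) = ennreal (LINT x|N. (poly P x)\<^sup>2)"
      unfolding f_def by (rule nn_integral_eq_integral[OF intN]) auto
    also have "ennreal (1 + \<epsilon>) * \<dots> = ennreal ((1 + \<epsilon>) * (LINT x|N. (poly P x)\<^sup>2))"
      using \<epsilon> by (simp add: ennreal_mult'')
    finally show ?thesis using \<epsilon> by (subst (asm) ennreal_le_iff) auto
  qed
  with \<delta> show "\<exists>\<delta>. 0 < \<delta> \<and> \<delta> < 2 \<and>
     (\<forall>P. (LINT x|M. indicator {1 - \<delta><..} x * (poly P x)\<^sup>2) \<le> (1 + \<epsilon>) * (LINT x|N. (poly P x)\<^sup>2))"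
    by blast
qed

text \<open>The Lebesgue null set that carries the singular part meets \<open>J\<close> in a null
  set of \<open>M\<close>, by absolute continuity in \<open>J\<close>.\<close>

lemma emeasure_ac_density:
  assumes meas: "sets M = sets borel" and ac: "ac_density M w"
    and J: "J \<in> sets borel" "absolutely_continuous_in J M"
    and A: "A \<in> sets borel" "A \<subseteq> J"
  shows "emeasure M A = (\<integral>\<^sup>+x\<in>A. ennreal (w x) \<partial>lebesgue)"
proof -
  obtain Z where Z: "Z \<in> null_sets lborel" "\<And>A. A \<in> sets borel \<Longrightarrow> emeasure M (A - Z) = (\<integral>\<^sup>+x\<in>A. ennreal (w x) \<partial>lebesgue)"
    using ac unfolding ac_density_def by blast
  have AZ: "A \<inter> Z \<in> null_sets lborel" using Z(1) A(1) by (intro null_set_Int1) auto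
  then have "A \<inter> Z \<in> null_sets (restrict_space lborel J)"
    using J(1) A(2) by (subst null_sets_restrict_space) auto
  then have "A \<inter> Z \<in> null_sets (restrict_space M J)"
    using J(2) unfolding absolutely_continuous_in_def absolutely_continuous_def by blast
  then have "A \<inter> Z \<in> null_sets M" using J(1) meas by (subst (asm) null_sets_restrict_space) auto
  then have "emeasure M (A - A \<inter> Z) = emeasure M A"
    using A(1) meas by (intro emeasure_Diff_null_set) auto
  moreover have "A - A \<inter> Z = A - Z" by auto
  ultimately show ?thesis using Z(2)[OF A(1)] by simp
qed

lemma emeasure_edge:
  assumes "A \<in> sets borel" and "A \<subseteq> {-1<..<1}"
  shows "emeasure (edge_measure a c) A = (\<integral>\<^sup>+x\<in>A. ennreal (c * (1 - x) powr (a - 1)) \<partial>lebesgue)"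
proof -
  have "emeasure (edge_measure a c) A = (\<integral>\<^sup>+x\<in>A. ennreal (c * (1 - x) powr (a - 1)) \<partial>lborel)"
    unfolding edge_measure_def using assms
    by (subst emeasure_density) (auto intro!: nn_integral_cong simp: indicator_def)
  also have "\<dots> = (\<integral>\<^sup>+x\<in>A. ennreal (c * (1 - x) powr (a - 1)) \<partial>lebesgue)"
    using assms by (intro nn_integral_completion[symmetric])
  finally show ?thesis .
qed

section \<open>Uniform convergence from convergence along sequences\<close>

text \<open>Otherwise points that violate a fixed tolerance would exist for infinitely many
  \<open>n\<close>, and by compactness they would accumulate at a point where continuity of
  \<open>g\<close> yields a contradiction.\<close>

lemma uniform_limit_sequentiallyI:
  fixes f :: "nat \<Rightarrow> 'a :: metric_space \<Rightarrow> 'b :: metric_space"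
  assumes K: "compact K" and lim: "\<And>z z0. (\<And>n. z n \<in> K) \<Longrightarrow> z \<longlonglongrightarrow> z0 \<Longrightarrow> z0 \<in> K \<Longrightarrow> (\<lambda>n. f n (z n)) \<longlonglongrightarrow> g z0"
    and cont: "continuous_on K g"
  shows "uniform_limit K f g sequentially"
proof (rule ccontr)
  assume "\<not> ?thesis"
  then obtain e where e: "0 < e" "\<not> eventually (\<lambda>n. \<forall>x\<in>K. dist (f n x) (g x) < e) sequentially"
    unfolding uniform_limit_iff by blast
  define bad where "bad n = (\<exists>x\<in>K. \<not> dist (f n x) (g x) < e)" for n
  have inf: "infinite {n. bad n}"
    using e(2) unfolding bad_def eventually_sequentially infinite_nat_iff_unbounded_le by auto
  define r where "r = enumerate {n. bad n}"
  have r: "strict_mono r" "bad (r k)" for k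
    using strict_mono_enumerate[OF inf] enumerate_in_set[OF inf] by (auto simp: r_def)
  obtain y where y: "\<And>k. y k \<in> K" "\<And>k. \<not> dist (f (r k) (y k)) (g (y k)) < e"
    using r(2) unfolding bad_def by metis
  obtain z0 s where z0: "z0 \<in> K" "strict_mono s" "(y \<circ> s) \<longlonglongrightarrow> z0"
    using K y(1) unfolding compact_def by metis
  define t where "t = r \<circ> s"
  have t: "strict_mono t" unfolding t_def using r(1) z0(2) by (rule strict_mono_o)
  \<comment> \<open>The violating points exist only at the indices in \<open>range t\<close>.
    Filling the gaps with their limit gives a sequence over all \<open>n\<close>, to which
    \<open>lim\<close> applies.\<close>
  define z where "z n = (if n \<in> range t then y (s (inv t n)) else z0)" for n
  have zt: "z (t k) = y (s k)" for k
    using strict_mono_imp_inj_on[OF t] by (simp add: z_def)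
  have zK: "z n \<in> K" for n using y(1) z0(1) by (simp add: z_def)
  have zlim: "z \<longlonglongrightarrow> z0"
  proof (rule metric_LIMSEQ_I)
    fix d :: real assume "0 < d"
    then obtain N where N: "\<And>k. N \<le> k \<Longrightarrow> dist (y (s k)) z0 < d"
      using metric_LIMSEQ_D[OF z0(3)] by (auto simp: o_def)
    have "dist (z n) z0 < d" if n: "t N \<le> n" for n
    proof (cases "n \<in> range t")
      case True
      then obtain k where k: "n = t k" by blast
      then have "N \<le> k" using n t by (simp add: strict_mono_less_eq)
      then show ?thesis using N by (simp add: k zt)
    qed (use \<open>0 < d\<close> in \<open>simp add: z_def\<close>)
    then show "\<exists>no. \<forall>n\<ge>no. dist (z n) z0 < d" by blast
  qed
  have 1: "(\<lambda>k. f (t k) (z (t k))) \<longlonglongrightarrow> g z0"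
    using LIMSEQ_subseq_LIMSEQ[OF lim[OF zK zlim z0(1)] t] by (simp add: o_def)
  have 2: "(\<lambda>k. g (y (s k))) \<longlonglongrightarrow> g z0"
    using cont z0 y(1) unfolding continuous_on_sequentially by (auto simp: o_def)
  have "(\<lambda>k. dist (f (t k) (y (s k))) (g (y (s k)))) \<longlonglongrightarrow> dist (g z0) (g z0)"
    using 1 2 unfolding zt by (rule tendsto_dist)
  then have "eventually (\<lambda>k. dist (f (t k) (y (s k))) (g (y (s k))) < e) sequentially"
    using e(1) by (intro order_tendstoD(2)) auto
  then show False using y(2) by (auto simp: t_def eventually_sequentially)
qed

section \<open>Weights at the scaled points and assembly of the limit\<close>

lemma sqrt_rpow: "0 \<le> y \<Longrightarrow> sqrt (rpow y g) = rpow y (g / 2)"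
  by (simp add: rpow_def powr_half_sqrt_powr)

lemma rpow_divide: "0 \<le> y \<Longrightarrow> 0 < d \<Longrightarrow> rpow (y / d) g = rpow y g / d powr g"
  by (simp add: rpow_def powr_divide)

text \<open>With \<open>d = 2 * n ^ 2\<close>, each weight contributes
  \<open>d powr (- \<alpha> / 2)\<close> and the prefactor is \<open>1 / d\<close>. Together they
  offset the growth \<open>n powr (2 * (\<alpha> + 1))\<close> of the kernel and leave a power of
  2.\<close>

lemma edge_scaling:
  assumes n: "0 < n" and s: "0 \<le> s" "0 \<le> t"
  shows "1 / (2 * real n ^ 2) * (sqrt (X * rpow (s / (2 * (real n)\<^sup>2)) \<alpha>) * sqrt (Y * rpow (t / (2 * (real n)\<^sup>2)) \<alpha>) * k)
     = sqrt X * sqrt Y * (rpow s (\<alpha> / 2) * rpow t (\<alpha> / 2)) * (k / real n powr (2 * (\<alpha> + 1))) / 2 powr (\<alpha> + 1)"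
proof -
  define d where "d = 2 * (real n)\<^sup>2"
  have d: "0 < d" using n by (simp add: d_def)
  have root: "sqrt (rpow (r / d) \<alpha>) = rpow r (\<alpha> / 2) / d powr (\<alpha> / 2)" if "0 \<le> r" for r
    using that d by (subst sqrt_rpow) (simp_all add: rpow_divide)
  have "d powr (\<alpha> / 2) * d powr (\<alpha> / 2) * d = d powr (\<alpha> + 1)"
  proof -
    have "d powr (\<alpha> / 2) * d powr (\<alpha> / 2) = d powr \<alpha>" by (simp flip: powr_add)
    then show ?thesis using d by (simp add: powr_add)
  qed
  also have "d powr (\<alpha> + 1) = 2 powr (\<alpha> + 1) * real n powr (2 * (\<alpha> + 1))"
  proof -
    have "(real n)\<^sup>2 = real n powr 2" using n by (simp add: powr_numeral)
    then show ?thesis unfolding d_def powr_mult by (simp only: powr_powr)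
  qed
  finally have dd: "d powr (\<alpha> / 2) * d powr (\<alpha> / 2) * d = 2 powr (\<alpha> + 1) * real n powr (2 * (\<alpha> + 1))" .
  have "1 / d * (sqrt (X * rpow (s / d) \<alpha>) * sqrt (Y * rpow (t / d) \<alpha>) * k)
     = sqrt X * sqrt Y * (rpow s (\<alpha> / 2) * rpow t (\<alpha> / 2)) * k / (d powr (\<alpha> / 2) * d powr (\<alpha> / 2) * d)"
    unfolding real_sqrt_mult root[OF s(1)] root[OF s(2)] by (simp add: mult_ac)
  also have "\<dots> = sqrt X * sqrt Y * (rpow s (\<alpha> / 2) * rpow t (\<alpha> / 2)) * (k / real n powr (2 * (\<alpha> + 1))) / 2 powr (\<alpha> + 1)"
    unfolding dd by (simp add: mult_ac)
  finally show ?thesis by (simp only: d_def)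
qed

lemma nn_integral_weight_le:
  assumes A: "A \<in> sets borel" and g: "g \<in> borel_measurable lebesgue" and c: "0 \<le> c"
    and le: "\<And>x. x \<in> A \<Longrightarrow> f x \<le> c * g x"
  shows "(\<integral>\<^sup>+x\<in>A. ennreal (f x) \<partial>lebesgue) \<le> ennreal c * (\<integral>\<^sup>+x\<in>A. ennreal (g x) \<partial>lebesgue)"
proof -
  have A': "A \<in> sets lebesgue" using A by (simp add: sets_completionI_sets)
  have "(\<integral>\<^sup>+x\<in>A. ennreal (f x) \<partial>lebesgue) \<le> (\<integral>\<^sup>+x. ennreal c * (ennreal (g x) * indicator A x) \<partial>lebesgue)"
    using c by (intro nn_integral_mono) (auto simp: indicator_def ennreal_mult'[symmetric] intro!: ennreal_leI le)
  also have "\<dots> = ennreal c * (\<integral>\<^sup>+x\<in>A. ennreal (g x) \<partial>lebesgue)"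
    using g A' by (intro nn_integral_cmult borel_measurable_times_ennreal measurable_compose[OF g measurable_ennreal] borel_measurable_indicator)
  finally show ?thesis .
qed

theorem theorem1p2:
  fixes M :: "real measure" and p :: "nat \<Rightarrow> real poly"
    and w h :: "real \<Rightarrow> real" and \<rho> \<alpha> \<beta> :: real
  assumes "finite_borel_measure_on {-1<..<1} M"
    and "orthonormal_polynomials M p"
    and "regular_measure M"
    and "ac_density M w"
    and "0 < \<rho>" and "{1 - \<rho>..1} \<subseteq> {-1..1}"
    and "absolutely_continuous_in {1 - \<rho>..1} M"
    and "-1 < \<alpha>" and "-1 < \<beta>"
    and "\<And>x. x \<in> {1 - \<rho>..1} \<Longrightarrow> w x = h x * rpow (1 - x) \<alpha> * rpow (1 + x) \<beta>"
    and "0 < h 1" and "continuous (at 1 within {1 - \<rho>..1}) h"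
  shows "(\<forall>K. compact K \<and> K \<subseteq> {0<..} \<longrightarrow>
            uniform_limit (K \<times> K)
              (\<lambda>n (a, b). 1 / (2 * real n ^ 2) *
                 normalized_kernel w p n (1 - a / (2 * real n ^ 2)) (1 - b / (2 * real n ^ 2)))
              (\<lambda>(a, b). bessel_kernel \<alpha> a b) sequentially) \<and>
         (0 \<le> \<alpha> \<longrightarrow>
          (\<forall>K. compact K \<and> K \<subseteq> {0..} \<longrightarrow>
            uniform_limit (K \<times> K)
              (\<lambda>n (a, b). 1 / (2 * real n ^ 2) *
                 normalized_kernel w p n (1 - a / (2 * real n ^ 2)) (1 - b / (2 * real n ^ 2)))
              (\<lambda>(a, b). bessel_kernel \<alpha> a b) sequentially))"
proof -
  note M_on = assms(1) and p_on = assms(2) and \<rho> = assms(5) and \<alpha> = assms(8) and w_eq = assms(10)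
    and h1 = assms(11) and h_cont = assms(12)
  let ?f = "\<lambda>n a b. 1 / (2 * real n ^ 2) * normalized_kernel w p n (1 - a / (2 * real n ^ 2)) (1 - b / (2 * real n ^ 2))"
  define J where "J = {1 - \<rho>..1}"
  define c where "c = h 1 * rpow 2 \<beta>"
  have c: "0 < c" using h1 by (simp add: c_def rpow_def)
  interpret M: orthonormal_system M p
    using M_on p_on by unfold_locales (auto simp: orthonormal_polynomials_def)
  interpret E: edge "\<alpha> + 1" c using \<alpha> c by unfold_locales auto

  have subM: "subexponential p"
    unfolding subexponential_def
  proof (intro allI impI, rule M.regular_imp_subexponential)
    fix \<delta> :: real assume \<delta>: "0 < \<delta>"
    obtain r where r: "orthonormal_polynomials M r" "(\<lambda>n. root n (lead_coeff (r n))) \<longlonglongrightarrow> 2"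
      using assms(3) unfolding regular_measure_def by blast
    have "orthonormal_system M r"
      using M_on r(1) by unfold_locales (auto simp: orthonormal_polynomials_def)
    then have "\<bar>lead_coeff (r n)\<bar> = \<bar>lead_coeff (p n)\<bar>" for n by (rule M.abs_lead_coeff_unique)
    moreover have "\<And>n. 0 < lead_coeff (r n)" using r(1) unfolding orthonormal_polynomials_def by blast
    ultimately show "\<exists>C. \<forall>n. \<bar>lead_coeff (p n)\<bar> \<le> exp (C + \<delta> * real n) * 2 ^ n"
      using root_limit_imp_exp_bound[of "\<lambda>n. lead_coeff (r n)", OF _ r(2) \<delta>] by simp
  qed
  have subE: "subexponential E.q"
    unfolding subexponential_def
    by (intro allI impI E.regular_imp_subexponential E.lead_coeff_q_bound)

  \<comment> \<open>The factor of \<open>w\<close> that is continuous at 1; the remaining factor is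
    shared with the reference density.\<close>
  define \<phi> where "\<phi> x = h x * rpow (1 + x) \<beta>" for x
  have \<phi>_tendsto: "((\<lambda>x. \<phi> (f x)) \<longlongrightarrow> c) F" if "(f \<longlongrightarrow> 1) F" "eventually (\<lambda>x. f x \<in> J) F" for f F
  proof -
    have "((\<lambda>x. h (f x)) \<longlongrightarrow> h 1) F"
      by (rule continuous_within_tendsto_compose[OF h_cont[folded J_def] that(2,1)])
    moreover have "((\<lambda>x. rpow (1 + f x) \<beta>) \<longlongrightarrow> rpow (1 + 1) \<beta>) F"
    proof (intro rpow_tendsto tendsto_add tendsto_const that(1))
      show "eventually (\<lambda>x. 0 \<le> 1 + f x) F"
        using that(2) by eventually_elim (use assms(6) in \<open>auto simp: J_def\<close>)
    qed auto
    ultimately show ?thesis unfolding \<phi>_def c_def by (intro tendsto_mult) auto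
  qed
  have w_phi: "w x = \<phi> x * rpow (1 - x) \<alpha>" if "x \<in> J" for x
    using w_eq[of x] that by (simp add: J_def \<phi>_def)
  \<comment> \<open>One neighbourhood serves both directions of domination. The exponent
    \<open>\<alpha> + 1 - 1\<close> is that of \<open>edge_measure\<close> for
    \<open>a = \<alpha> + 1\<close>.\<close>
  have near: "\<exists>\<delta>. 0 < \<delta> \<and> \<delta> < 2 \<and> {1 - \<delta><..<1} \<subseteq> J \<and>
      (\<forall>x\<in>{1 - \<delta><..<1}. w x \<le> (1 + \<epsilon>) * (c * (1 - x) powr (\<alpha> + 1 - 1)) \<and> c * (1 - x) powr (\<alpha> + 1 - 1) \<le> (1 + \<epsilon>) * w x)"
    if \<epsilon>: "0 < \<epsilon>" for \<epsilon>
  proof -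
    have lim: "(\<phi> \<longlongrightarrow> c) (at 1 within J)"
      by (rule \<phi>_tendsto) (auto simp: eventually_at_filter)
    have "c / (1 + \<epsilon>) < c" "c < (1 + \<epsilon>) * c" using c \<epsilon> by (simp_all add: divide_less_eq)
    then have "eventually (\<lambda>x. c / (1 + \<epsilon>) < \<phi> x \<and> \<phi> x < (1 + \<epsilon>) * c) (at 1 within J)"
      using order_tendstoD[OF lim] by (intro eventually_conj) auto
    then obtain d where d: "0 < d" "\<And>x. x \<in> J \<Longrightarrow> x \<noteq> 1 \<Longrightarrow> dist x 1 < d \<Longrightarrow> c / (1 + \<epsilon>) < \<phi> x \<and> \<phi> x < (1 + \<epsilon>) * c"
      unfolding eventually_at by blast
    \<comment> \<open>\<rho> keeps the interval inside \<open>J\<close>, and the 1 ensures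
      \<open>\<delta> < 2\<close>.\<close>
    define \<delta> where "\<delta> = min d (min \<rho> 1)"
    show ?thesis
    proof (intro exI[of _ \<delta>] conjI ballI)
      show "0 < \<delta>" "\<delta> < 2" using d(1) \<rho> by (auto simp: \<delta>_def)
      show sub: "{1 - \<delta><..<1} \<subseteq> J" by (auto simp: \<delta>_def J_def)
      fix x assume x: "x \<in> {1 - \<delta><..<1}"
      have xJ: "x \<in> J" using sub x by blast
      have "dist x 1 < d" "x \<noteq> 1" using x by (auto simp: \<delta>_def dist_real_def)
      with d(2)[OF xJ] have b: "c / (1 + \<epsilon>) \<le> \<phi> x" "\<phi> x \<le> (1 + \<epsilon>) * c" by auto
      have w: "w x = \<phi> x * (1 - x) powr \<alpha>" using w_phi[OF xJ] x by (simp add: rpow_def)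
      have pos: "0 \<le> (1 - x) powr \<alpha>" by simp
      show "w x \<le> (1 + \<epsilon>) * (c * (1 - x) powr (\<alpha> + 1 - 1))"
        using mult_right_mono[OF b(2) pos] by (simp add: w mult.assoc)
      have "c \<le> (1 + \<epsilon>) * \<phi> x" using b(1) \<epsilon> by (simp add: divide_le_eq mult.commute)
      from mult_right_mono[OF this pos] show "c * (1 - x) powr (\<alpha> + 1 - 1) \<le> (1 + \<epsilon>) * w x"
        by (simp add: w mult.assoc)
    qed
  qed
  have emM: "emeasure M A = (\<integral>\<^sup>+x\<in>A. ennreal (w x) \<partial>lebesgue)" if "A \<in> sets borel" "A \<subseteq> J" for A
    using emeasure_ac_density[OF M.sets_M assms(4) _ assms(7), of A] that by (simp add: J_def)
  have w_meas: "w \<in> borel_measurable lebesgue" using assms(4) by (simp add: ac_density_def)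
  have e_meas: "(\<lambda>x. c * (1 - x) powr (\<alpha> + 1 - 1)) \<in> borel_measurable lebesgue"
    by (intro measurable_completion) measurable
  have em: "emeasure M A = (\<integral>\<^sup>+x\<in>A. ennreal (w x) \<partial>lebesgue)"
      "emeasure E.N A = (\<integral>\<^sup>+x\<in>A. ennreal (c * (1 - x) powr (\<alpha> + 1 - 1)) \<partial>lebesgue)"
    if "A \<in> sets borel" "\<delta> < 2" "{1 - \<delta><..<1} \<subseteq> J" "A \<subseteq> {1 - \<delta><..<1}" for A \<delta>
  proof -
    have "A \<subseteq> J" "A \<subseteq> {-1<..<1}" using that by auto
    then show "emeasure M A = (\<integral>\<^sup>+x\<in>A. ennreal (w x) \<partial>lebesgue)"
      "emeasure E.N A = (\<integral>\<^sup>+x\<in>A. ennreal (c * (1 - x) powr (\<alpha> + 1 - 1)) \<partial>lebesgue)"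
      using emM emeasure_edge that(1) by auto
  qed
  have domME: "dominated_near_one M E.N"
  proof (rule dominated_near_oneI[OF M.interval_measure_axioms E.interval_measure_axioms])
    fix \<epsilon> :: real assume \<epsilon>: "0 < \<epsilon>"
    from near[OF \<epsilon>] obtain \<delta> where \<delta>: "0 < \<delta>" "\<delta> < 2" "{1 - \<delta><..<1} \<subseteq> J"
      "\<And>x. x \<in> {1 - \<delta><..<1} \<Longrightarrow> w x \<le> (1 + \<epsilon>) * (c * (1 - x) powr (\<alpha> + 1 - 1))" by blast
    show "\<exists>\<delta>. 0 < \<delta> \<and> \<delta> < 2 \<and> (\<forall>A\<in>sets borel. A \<subseteq> {1 - \<delta><..<1} \<longrightarrow> emeasure M A \<le> ennreal (1 + \<epsilon>) * emeasure E.N A)"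
    proof (intro exI[of _ \<delta>] conjI ballI impI \<delta>(1,2))
      fix A :: "real set" assume A: "A \<in> sets borel" "A \<subseteq> {1 - \<delta><..<1}"
      show "emeasure M A \<le> ennreal (1 + \<epsilon>) * emeasure E.N A"
        unfolding em[OF A(1) \<delta>(2,3) A(2)] using \<epsilon> A \<delta>(4) by (intro nn_integral_weight_le e_meas) auto
    qed
  qed
  have domEM: "dominated_near_one E.N M"
  proof (rule dominated_near_oneI[OF E.interval_measure_axioms M.interval_measure_axioms])
    fix \<epsilon> :: real assume \<epsilon>: "0 < \<epsilon>"
    from near[OF \<epsilon>] obtain \<delta> where \<delta>: "0 < \<delta>" "\<delta> < 2" "{1 - \<delta><..<1} \<subseteq> J"
      "\<And>x. x \<in> {1 - \<delta><..<1} \<Longrightarrow> c * (1 - x) powr (\<alpha> + 1 - 1) \<le> (1 + \<epsilon>) * w x" by blast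
    show "\<exists>\<delta>. 0 < \<delta> \<and> \<delta> < 2 \<and> (\<forall>A\<in>sets borel. A \<subseteq> {1 - \<delta><..<1} \<longrightarrow> emeasure E.N A \<le> ennreal (1 + \<epsilon>) * emeasure M A)"
    proof (intro exI[of _ \<delta>] conjI ballI impI \<delta>(1,2))
      fix A :: "real set" assume A: "A \<in> sets borel" "A \<subseteq> {1 - \<delta><..<1}"
      show "emeasure E.N A \<le> ennreal (1 + \<epsilon>) * emeasure M A"
        unfolding em[OF A(1) \<delta>(2,3) A(2)] using \<epsilon> A \<delta>(4) by (intro nn_integral_weight_le w_meas) auto
    qed
  qed

  interpret C: edge_comparison M p E.N E.q "\<alpha> + 1" "\<lambda>u v. bessel_form (\<alpha> + 1) (u / 4) (v / 4) / E.mass"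
  proof (unfold_locales, rule domME, rule domEM, rule subM, rule subE, rule E.edge_kernel_asymptotics, assumption+)
    fix u v :: "nat \<Rightarrow> real" and u0 v0 assume "u \<longlonglongrightarrow> u0" "v \<longlonglongrightarrow> v0"
    then show "(\<lambda>n. bessel_form (\<alpha> + 1) (u n / 4) (v n / 4) / E.mass) \<longlonglongrightarrow> bessel_form (\<alpha> + 1) (u0 / 4) (v0 / 4) / E.mass"
      using \<alpha> E.mass_pos by (intro tendsto_divide bessel_form_tendsto tendsto_const) auto
  qed

  \<comment> \<open>The condition \<open>pos\<close> is where the two claims of the theorem part:
    \<open>rpow\<close> with a negative exponent is continuous only away from 0.\<close>
  have seq: "(\<lambda>n. ?f n (s n) (t n))
      \<longlonglongrightarrow> hard_edge_kernel \<alpha> s0 t0"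
    if s: "s \<longlonglongrightarrow> s0" "\<And>n. 0 \<le> s n" and t: "t \<longlonglongrightarrow> t0" "\<And>n. 0 \<le> t n"
      and pos: "0 \<le> \<alpha> \<or> (0 < s0 \<and> 0 < t0)" for s t :: "nat \<Rightarrow> real" and s0 t0
  proof -
    let ?g = "\<lambda>n. sqrt (\<phi> (edge_point n (s n))) * sqrt (\<phi> (edge_point n (t n))) * (rpow (s n) (\<alpha> / 2) * rpow (t n) (\<alpha> / 2))
        * (M.K n (edge_point n (s n)) (edge_point n (t n)) / real n powr (2 * (\<alpha> + 1))) / 2 powr (\<alpha> + 1)"
    let ?l = "sqrt c * sqrt c * (rpow s0 (\<alpha> / 2) * rpow t0 (\<alpha> / 2)) * (bessel_form (\<alpha> + 1) (s0 / 4) (t0 / 4) / E.mass) / 2 powr (\<alpha> + 1)"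
    have in_J: "eventually (\<lambda>n. edge_point n (r n) \<in> J) sequentially" if "r \<longlonglongrightarrow> r0" "\<And>n. 0 \<le> r n" for r r0
      using order_tendstoD(1)[OF edge_point_tendsto[OF that(1)], of "1 - \<rho>"] \<rho>
      by (auto elim!: eventually_mono simp: J_def edge_point_def that(2))
    have G: "(\<lambda>n. sqrt (\<phi> (edge_point n (r n)))) \<longlonglongrightarrow> sqrt c" if "r \<longlonglongrightarrow> r0" "\<And>n. 0 \<le> r n" for r r0
      by (intro tendsto_real_sqrt \<phi>_tendsto edge_point_tendsto[OF that(1)] in_J[OF that])
    have rp: "(\<lambda>n. rpow (s n) (\<alpha> / 2)) \<longlonglongrightarrow> rpow s0 (\<alpha> / 2)" "(\<lambda>n. rpow (t n) (\<alpha> / 2)) \<longlonglongrightarrow> rpow t0 (\<alpha> / 2)"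
      using s t pos by (auto intro!: rpow_tendsto)
    have lim: "(\<lambda>n. ?g n)
      \<longlonglongrightarrow> ?l"
      by (intro tendsto_divide tendsto_mult tendsto_const G[OF s] G[OF t] rp C.universality_sequence s t) auto
    \<comment> \<open>\<open>c / E.mass\<close> is the inverse of
      \<open>2 powr (\<alpha> + 1)\<close>, and the scaling of the weights contributes the same
      factor once more, which makes \<open>4 powr (\<alpha> + 1)\<close>.\<close>
    have "?l
       = hard_edge_kernel \<alpha> s0 t0"
    proof -
      have "(4::real) powr (\<alpha> + 1) = (2 * 2) powr (\<alpha> + 1)" by simp
      also have "\<dots> = 2 powr (\<alpha> + 1) * 2 powr (\<alpha> + 1)" by (rule powr_mult)
      finally have four: "(4::real) powr (\<alpha> + 1) = 2 powr (\<alpha> + 1) * 2 powr (\<alpha> + 1)" .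
      show ?thesis unfolding hard_edge_kernel_def E.mass_def four using c by simp
    qed
    moreover have "eventually (\<lambda>n. ?g n
      = ?f n (s n) (t n)) sequentially"
      using eventually_gt_at_top[of 0] in_J[OF s] in_J[OF t]
    proof eventually_elim
      case (elim n)
      have "1 - edge_point n r = r / (2 * (real n)\<^sup>2)" for r by (simp add: edge_point_def)
      then have "w (edge_point n (s n)) = \<phi> (edge_point n (s n)) * rpow (s n / (2 * (real n)\<^sup>2)) \<alpha>"
        "w (edge_point n (t n)) = \<phi> (edge_point n (t n)) * rpow (t n / (2 * (real n)\<^sup>2)) \<alpha>"
        using w_phi elim(2,3) by simp_all
      then show ?case
        using edge_scaling[OF elim(1) s(2)[of n] t(2)[of n], symmetric]
        by (simp only: normalized_kernel_def edge_point_def[symmetric])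
    qed
    ultimately show ?thesis using Lim_transform_eventually[OF lim] by simp
  qed

  have main: "uniform_limit (K \<times> K) (\<lambda>n (a, b). ?f n a b) (\<lambda>(a, b). bessel_kernel \<alpha> a b) sequentially"
    if K: "compact K" "K \<subseteq> {0..}" "0 \<le> \<alpha> \<or> K \<subseteq> {0<..}" for K
  proof (rule uniform_limit_sequentiallyI)
    have eq: "bessel_kernel \<alpha> u v = hard_edge_kernel \<alpha> u v" if "u \<in> K" "v \<in> K" for u v
      using that K by (intro bessel_kernel_eq[OF \<alpha>]) auto
    show "compact (K \<times> K)" using K(1) by (intro compact_Times)
    show "(\<lambda>n. case z n of (a, b) \<Rightarrow> ?f n a b)
       \<longlonglongrightarrow> (case z0 of (a, b) \<Rightarrow> bessel_kernel \<alpha> a b)"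
      if z: "\<And>n. z n \<in> K \<times> K" "z \<longlonglongrightarrow> z0" "z0 \<in> K \<times> K" for z z0
    proof -
      have mem: "fst (z n) \<in> K" "snd (z n) \<in> K" "fst z0 \<in> K" "snd z0 \<in> K" for n
        using z(1)[of n] z(3) by auto
      have "(\<lambda>n. ?f n (fst (z n)) (snd (z n)))
         \<longlonglongrightarrow> hard_edge_kernel \<alpha> (fst z0) (snd z0)"
        using mem K by (intro seq tendsto_fst tendsto_snd z(2)) auto
      then show ?thesis using eq[OF mem(3,4)] by (simp add: case_prod_beta)
    qed
    show "continuous_on (K \<times> K) (\<lambda>(a, b). bessel_kernel \<alpha> a b)"
    proof (subst continuous_on_cong[OF refl, where g = "\<lambda>x. hard_edge_kernel \<alpha> (fst x) (snd x)"])
      show "continuous_on (K \<times> K) (\<lambda>x. hard_edge_kernel \<alpha> (fst x) (snd x))"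
        unfolding continuous_on_def
      proof
        fix z assume z: "z \<in> K \<times> K"
        have ev: "eventually (\<lambda>x. x \<in> K \<times> K) (at z within K \<times> K)" by (simp add: eventually_at_filter)
        show "((\<lambda>x. hard_edge_kernel \<alpha> (fst x) (snd x)) \<longlongrightarrow> hard_edge_kernel \<alpha> (fst z) (snd z)) (at z within K \<times> K)"
          using z K
          by (intro hard_edge_kernel_tendsto[OF \<alpha>] tendsto_fst tendsto_snd tendsto_ident_at eventually_mono[OF ev]) auto
      qed
    qed (use eq in auto)
  qed
  show ?thesis
  proof (intro conjI allI impI)
    fix K :: "real set" assume "compact K \<and> K \<subseteq> {0<..}"
    moreover from this have "K \<subseteq> {0..}" by auto
    ultimately show "uniform_limit (K \<times> K) (\<lambda>n (a, b). ?f n a b) (\<lambda>(a, b). bessel_kernel \<alpha> a b) sequentially" by (intro main) auto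
  next
    fix K :: "real set" assume "0 \<le> \<alpha>" "compact K \<and> K \<subseteq> {0..}"
    then show "uniform_limit (K \<times> K) (\<lambda>n (a, b). ?f n a b) (\<lambda>(a, b). bessel_kernel \<alpha> a b) sequentially" by (intro main) auto
  qed
qed

end
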